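(* Let $\mathcal X=\mathrm{Av}(2413,3142,2143,3412)$, let $\mathcal C$ be the downward closure (for pattern containment) of $\oplus[\mathcal X,\mathcal X]=\{\oplus[\sigma,\tau]:\sigma,\tau\in\mathcal X\}$, and let $\boldsymbol\sigma_n$ be a uniform random permutation of size $n$ in $\mathcal C$. Then $\mu_{\boldsymbol\sigma_n}$ converges in distribution, as $n\to\infty$, to the random permuton $\boldsymbol\mu^{\oplus[X,X]}$.
   Context: $\mathrm{Av}(B)$ is the set of permutations (of all sizes $\ge 1$) avoiding every pattern in $B$. A permutation $\pi$ of size $k$ is a pattern of $\sigma$ if some subsequence of $\sigma(1)\cdots\sigma(n)$ has the same relative order as $\pi$; the downward closure of a set of permutations is the set of all patterns of its elements. $\oplus[\sigma,\tau]=12[\sigma,\tau]$ is the direct sum of $\sigma$ and $\tau$: the sequence $\sigma(1)\cdots\sigma(n)\,(\tau(1)+n)\cdots(\tau(m)+n)$, for $|\sigma|=n$, $|\tau|=m$. A permuton is a probability measure on $[0,1]^2$ with uniform marginals; the space of permutons carries the weak topology, and convergence in distribution of random permutons refers to it. For $\sigma$ of size $n$, $\mu_\sigma$ has density $n\mathbf 1_{\sigma(\lceil xn\rceil)=\lceil yn\rceil}$. Let $\mu^X=\mu^X_{(1/4,1/4,1/4,1/4)}$ be the permuton $\frac14\sum_{P}\nu(P,(1/2,1/2))$, where $P$ ranges over the four corners of $[0,1]^2$ and $\nu(P,Q)$ is the normalized one-dimensional Lebesgue measure on the segment $[P,Q]$. Let $\boldsymbol U$ be uniform in $[0,1]$.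 The random permuton $\boldsymbol\mu^{\oplus[X,X]}$ is defined as follows: on $[0,\boldsymbol U]^2$ it is the rescaled copy of $\mu^X$, of total mass $\boldsymbol U$ (i.e. $\boldsymbol\mu^{\oplus[X,X]}([\boldsymbol Ua,\boldsymbol Ub]\times[\boldsymbol Uc,\boldsymbol Ud])=\boldsymbol U\,\mu^X([a,b]\times[c,d])$); on $[\boldsymbol U,1]^2$ it is similarly the rescaled copy of $\mu^X$, of total mass $1-\boldsymbol U$; and it gives mass $0$ to $[0,\boldsymbol U]\times[\boldsymbol U,1]$ and to $[\boldsymbol U,1]\times[0,\boldsymbol U]$. *)

theory Defs
  imports
    "HOL-Probability.Probability"
    "HOL-Library.Sublist"
    "HOL-Combinatorics.Multiset_Permutations"
begin

section \<open>Permutations and patterns\<close>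

text \<open>A permutation of size \<open>n \<ge> 1\<close> is given in one-line notation, as a list over
  \<open>{1..n}\<close>; the list is indexed from 0, so \<open>\<sigma>(i)\<close> is \<open>\<sigma> ! (i - 1)\<close>.\<close>

definition perms :: "nat list set" where
  "perms = {\<sigma>. \<sigma> \<noteq> [] \<and> \<sigma> \<in> permutations_of_set {1..length \<sigma>}}"

definition is_pattern :: "nat list \<Rightarrow> nat list \<Rightarrow> bool" where
  "is_pattern \<pi> \<sigma> \<longleftrightarrow> (\<exists>\<rho>. subseq \<rho> \<sigma> \<and> length \<rho> = length \<pi> \<and>
     (\<forall>i<length \<pi>. \<forall>j<length \<pi>. \<rho> ! i < \<rho> ! j \<longleftrightarrow> \<pi> ! i < \<pi> ! j))"

definition Av :: "nat list set \<Rightarrow> nat list set" where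
  "Av B = {\<sigma> \<in> perms. \<forall>\<pi>\<in>B. \<not> is_pattern \<pi> \<sigma>}"

definition down_closure :: "nat list set \<Rightarrow> nat list set" where
  "down_closure A = {\<pi> \<in> perms. \<exists>\<sigma>\<in>A. is_pattern \<pi> \<sigma>}"

definition direct_sum :: "nat list \<Rightarrow> nat list \<Rightarrow> nat list" where
  "direct_sum \<sigma> \<tau> = \<sigma> @ map (\<lambda>i. i + length \<sigma>) \<tau>"

definition X_class :: "nat list set" where
  "X_class = Av {[2,4,1,3], [3,1,4,2], [2,1,4,3], [3,4,1,2]}"

definition XX_class :: "nat list set" where
  "XX_class = down_closure {direct_sum \<sigma> \<tau> |\<sigma> \<tau>. \<sigma> \<in> X_class \<and> \<tau> \<in> X_class}"

definition of_size :: "nat list set \<Rightarrow> nat \<Rightarrow> nat list set" where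
  "of_size A n = {\<sigma> \<in> A. length \<sigma> = n}"


section \<open>Permutons\<close>

abbreviation unit_square :: "(real \<times> real) set" where
  "unit_square \<equiv> {0..1} \<times> {0..1}"

abbreviation square_borel :: "(real \<times> real) measure" where
  "square_borel \<equiv> restrict_space borel unit_square"

definition permutons :: "(real \<times> real) measure set" where
  "permutons = {\<mu>. prob_space \<mu> \<and> sets \<mu> = sets square_borel \<and>
     distr \<mu> borel fst = uniform_measure lborel {0..1} \<and>
     distr \<mu> borel snd = uniform_measure lborel {0..1}}"

text \<open>The weak topology is the coarsest one making \<open>\<mu> \<mapsto> \<integral> f d\<mu>\<close> continuous for every
  continuous \<open>f\<close> on the (compact) unit square.\<close>

definition permuton_topology :: "(real \<times> real) measure topology" where
  "permuton_topology = topology_generated_by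
     {{\<mu> \<in> permutons. (\<integral>z. f z \<partial>\<mu>) \<in> V} |(f :: real \<times> real \<Rightarrow> real) V.
        continuous_on unit_square f \<and> open V}"

text \<open>For \<open>x = 0\<close> or \<open>y = 0\<close> the condition \<open>\<sigma>(\<lceil>xn\<rceil>) = \<lceil>yn\<rceil>\<close> refers to index or value 0; these
  points form a null set.\<close>

definition permuton_of :: "nat list \<Rightarrow> (real \<times> real) measure" where
  "permuton_of \<sigma> = (let n = length \<sigma> in
     density (restrict_space lborel unit_square)
       (\<lambda>(x, y). if int (\<sigma> ! (nat \<lceil>x * real n\<rceil> - 1)) = \<lceil>y * real n\<rceil> then of_nat n else 0))"

definition segment_measure :: "real \<times> real \<Rightarrow> real \<times> real \<Rightarrow> (real \<times> real) measure" where
  "segment_measure P Q =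
     distr (uniform_measure lborel {0..1}) borel (\<lambda>t. (1 - t) *\<^sub>R P + t *\<^sub>R Q)"

definition X_permuton :: "(real \<times> real) measure" where
  "X_permuton = measure_of unit_square (sets square_borel)
     (\<lambda>A. (\<Sum>P\<in>{0, 1} \<times> {0, 1}. emeasure (segment_measure P (1/2, 1/2)) A) / 4)"

text \<open>The realisation for \<open>U = u\<close>: \<open>u\<close> times the push-forward of \<open>X_permuton\<close> under the affine map
  onto \<open>[0,u]\<^sup>2\<close>, plus \<open>1 - u\<close> times its push-forward under the affine map onto \<open>[u,1]\<^sup>2\<close>.\<close>

definition XX_permuton :: "real \<Rightarrow> (real \<times> real) measure" where
  "XX_permuton u = measure_of unit_square (sets square_borel)
     (\<lambda>A. ennreal u * emeasure (distr X_permuton square_borel (\<lambda>z. u *\<^sub>R z)) A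
        + ennreal (1 - u) *
            emeasure (distr X_permuton square_borel (\<lambda>z. (u, u) + (1 - u) *\<^sub>R z)) A)"


section \<open>Convergence in distribution\<close>

definition borel_of :: "'a topology \<Rightarrow> 'a measure" where
  "borel_of T = sigma (topspace T) {S. openin T S}"

text \<open>\<open>X n\<close> is a random element of the space \<open>T\<close> defined on \<open>N n\<close> (for all large \<open>n\<close>), and the
  limit \<open>Y\<close> is one defined on \<open>M\<close>.\<close>

definition converges_in_distribution ::
  "'a topology \<Rightarrow> (nat \<Rightarrow> 'b measure) \<Rightarrow> (nat \<Rightarrow> 'b \<Rightarrow> 'a) \<Rightarrow> 'c measure \<Rightarrow> ('c \<Rightarrow> 'a) \<Rightarrow> bool" where
  "converges_in_distribution T N X M Y \<longleftrightarrow>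
     (\<forall>\<^sub>F n in sequentially. prob_space (N n) \<and> X n \<in> N n \<rightarrow>\<^sub>M borel_of T) \<and>
     prob_space M \<and> Y \<in> M \<rightarrow>\<^sub>M borel_of T \<and>
     (\<forall>f :: 'a \<Rightarrow> real. continuous_map T euclideanreal f \<longrightarrow> bounded (f ` topspace T) \<longrightarrow>
        (\<lambda>n. \<integral>\<omega>. f (X n \<omega>) \<partial>N n) \<longlonglongrightarrow> (\<integral>\<omega>. f (Y \<omega>) \<partial>M))"

end

theory Submission
  imports Defs "HOL-Real_Asymp.Real_Asymp"
begin

text \<open>A permutation in the X-class is obtained by successively inserting points into the corners of
  the square, so it is coded by a word over the four corners; forbidding a right corner followed by
  the opposite left one makes the code essentially unique. The Perron eigenvalue of the transfer
  matrix is \<open>2 + sqrt 2\<close>, and its two Perron eigenvectors have constant product, so each corner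
  has asymptotic frequency 1/4. A Chernoff bound makes this quantitative: up to an exponentially
  small proportion, every prefix of the word is balanced, and then the permutation is close to
  the X shape with mass equally distributed over the four branches.

  All but a fraction \<open>O(1/n)\<close> of the elements of size \<open>n\<close> of the class are, in a unique way, direct
  sums \<open>\<sigma> \<oplus> \<tau>\<close> with \<open>\<sigma>\<close> in X not ending with its maximum and \<open>\<tau>\<close> in X not increasing. Both
  families have size asymptotic to a constant times \<open>(2 + sqrt 2)^k\<close>, a purely exponential rate, so
  \<open>|\<sigma>| / n\<close> is asymptotically uniform. Hence the permuton of a random element is close to the
  realisation for \<open>u = |\<sigma>| / n\<close> of the limit; as these realisations form a compact path in the space
  of permutons, a continuous functional can be controlled along it by finitely many test functions.\<close>

section \<open>Patterns and order isomorphism\<close>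

text \<open>Words are used in one direction only: every permutation of X has an allowed word, so
  unbalanced words bound the unbalanced permutations from above, while the exact size of X comes
  from a recurrence. Excluding redundant letter pairs is essential for this: unrestricted words
  number 4^n, and an exponentially small proportion of them need not be small against (2 + sqrt
  2)^n, whereas the allowed words grow at the same rate as X.

  The shape appears because the first letter of a word is the outermost point: the coordinates of
  the point of letter t depend only on the sides chosen by this letter and on the numbers of earlier
  letters on the low sides. If these numbers are near t/2, the points move along four segments from
  the corners to the centre at constant speed.

  A summand may be short compared with the sum, and then it need not be concentrated at its own
  scale. Deviations are therefore measured against delta * n, with n the size of the sum, for both
  summands; this gives bounds uniform in the splitting point.\<close>

definition order_iso :: "nat list \<Rightarrow> nat list \<Rightarrow> bool" where
  "order_iso xs ys \<longleftrightarrow> length xs = length ys \<and>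
     (\<forall>p\<in>set (zip xs ys). \<forall>q\<in>set (zip xs ys). fst p < fst q \<longleftrightarrow> snd p < snd q)"

text \<open>Pairs of \<open>zip\<close> make sublists and appends easy to handle, since these only
  shrink or split a set; the index form shows at once that the relation is an equivalence.\<close>

lemma order_iso_nth:
  "order_iso xs ys \<longleftrightarrow> length xs = length ys \<and>
     (\<forall>i<length ys. \<forall>j<length ys. xs ! i < xs ! j \<longleftrightarrow> ys ! i < ys ! j)"
proof (cases "length xs = length ys")
  case True
  then have "set (zip xs ys) = (\<lambda>i. (xs ! i, ys ! i)) ` {..<length ys}" by (auto simp: set_zip)
  then show ?thesis using True unfolding order_iso_def by simp (simp add: Ball_def)
qed (simp add: order_iso_def)

lemma is_pattern_iff: "is_pattern \<pi> \<sigma> \<longleftrightarrow> (\<exists>\<rho>. subseq \<rho> \<sigma> \<and> order_iso \<rho> \<pi>)"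
  unfolding is_pattern_def order_iso_nth by auto

lemma order_iso_refl: "order_iso xs xs"
  by (simp add: order_iso_nth)

lemma order_iso_sym: "order_iso xs ys \<Longrightarrow> order_iso ys xs"
  by (simp add: order_iso_nth)

lemma order_iso_trans: "order_iso xs ys \<Longrightarrow> order_iso ys zs \<Longrightarrow> order_iso xs zs"
  by (simp add: order_iso_nth)

lemma order_iso_length: "order_iso xs ys \<Longrightarrow> length xs = length ys"
  by (simp add: order_iso_nth)

lemma order_iso_append:
  assumes "order_iso (xs @ ys) (xs' @ ys')" "length xs = length xs'"
  shows "order_iso xs xs'" "order_iso ys ys'"
  using assms unfolding order_iso_def by auto

lemma order_iso_map:
  assumes "strict_mono f" shows "order_iso (map f xs) xs"
  using assms by (simp add: order_iso_nth strict_mono_less)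

text \<open>The index set that cuts \<open>\<rho>\<close> out of \<open>\<sigma>\<close> is applied
  to \<open>\<sigma>'\<close>. Cutting commutes with \<open>zip\<close>, so the pairs to be compared
  are among the old ones.\<close>

lemma order_iso_subseq:
  assumes "order_iso \<sigma> \<sigma>'" "subseq \<rho> \<sigma>"
  obtains \<rho>' where "subseq \<rho>' \<sigma>'" "order_iso \<rho> \<rho>'"
proof -
  obtain I where I: "\<rho> = nths \<sigma> I" using assms(2) subseq_conv_nths by blast
  let ?z = "zip \<sigma> \<sigma>'"
  have len: "length \<sigma> = length \<sigma>'" using assms(1) by (simp add: order_iso_length)
  have e: "\<rho> = map fst (nths ?z I)" "nths \<sigma>' I = map snd (nths ?z I)"
    using len by (simp_all add: I flip: nths_map)
  have "set (nths ?z I) \<subseteq> set ?z" by (simp add: set_nths_subset)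
  moreover have "zip \<rho> (nths \<sigma>' I) = nths ?z I"
    unfolding e by (simp add: zip_map_fst_snd)
  ultimately have "order_iso \<rho> (nths \<sigma>' I)"
    using assms(1) e unfolding order_iso_def by (metis length_map subset_iff)
  then show ?thesis using that subseq_conv_nths by blast
qed

lemma is_pattern_trans:
  assumes "is_pattern \<pi> \<rho>" "is_pattern \<rho> \<sigma>" shows "is_pattern \<pi> \<sigma>"
proof -
  obtain a where a: "subseq a \<rho>" "order_iso a \<pi>" using assms(1) is_pattern_iff by auto
  obtain b where b: "subseq b \<sigma>" "order_iso b \<rho>" using assms(2) is_pattern_iff by auto
  obtain c where c: "subseq c b" "order_iso a c"
    using order_iso_subseq[OF order_iso_sym[OF b(2)] a(1)] by blast
  show ?thesis unfolding is_pattern_iff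
    using b(1) c a(2) by (meson order_iso_sym order_iso_trans subseq_order.order_trans)
qed

lemma is_pattern_order_iso: "order_iso \<pi> \<rho> \<Longrightarrow> subseq \<pi> \<sigma> \<Longrightarrow> is_pattern \<rho> \<sigma>"
  using is_pattern_iff by auto

lemma perms_iff: "\<sigma> \<in> perms \<longleftrightarrow> \<sigma> \<noteq> [] \<and> distinct \<sigma> \<and> set \<sigma> = {1..length \<sigma>}"
  unfolding perms_def permutations_of_set_def by auto

lemma X_class_perms: "\<sigma> \<in> X_class \<Longrightarrow> \<sigma> \<in> perms"
  by (simp add: X_class_def Av_def)

lemma X_class_pattern:
  assumes "\<sigma> \<in> X_class" "is_pattern \<pi> \<sigma>" "\<pi> \<in> perms" shows "\<pi> \<in> X_class"
  using assms is_pattern_trans unfolding X_class_def Av_def by blast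


section \<open>Corner points\<close>

text \<open>A corner of the square is a pair of truth values: the first component says
  whether it lies on the right, the second one whether it lies at the top.\<close>

definition ins :: "bool \<times> bool \<Rightarrow> nat list \<Rightarrow> nat list" where
  "ins l \<sigma> = (let v = (if snd l then Suc (length \<sigma>) else 1);
                  \<sigma>' = (if snd l then \<sigma> else map Suc \<sigma>)
              in if fst l then \<sigma>' @ [v] else v # \<sigma>')"

text \<open>The permutation of size one occupies all four corners at once, which is why size one is
  split off in the counting.\<close>

definition corner :: "bool \<times> bool \<Rightarrow> nat list \<Rightarrow> bool" where
  "corner l \<sigma> \<longleftrightarrow> (if fst l then last \<sigma> else hd \<sigma>) = (if snd l then length \<sigma> else 1)"

definition opposite :: "bool \<times> bool \<Rightarrow> bool \<times> bool" where
  "opposite l = (\<not> fst l, \<not> snd l)"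

lemma length_ins [simp]: "length (ins l \<sigma>) = Suc (length \<sigma>)"
  by (simp add: ins_def Let_def)

lemma corner_ins: "corner l (ins l \<sigma>)"
  by (simp add: corner_def ins_def Let_def)

lemma ins_inj: "ins l \<sigma> = ins l \<tau> \<Longrightarrow> \<sigma> = \<tau>"
  by (auto simp: ins_def Let_def split: if_splits dest: map_injective)

text \<open>Opposite corners concern different ends of the list and different extreme values, so an
  insertion at one of them merely shifts what is tested at the other. This is the redundancy that
  canonical words have to remove.\<close>

lemma corner_opposite_ins:
  "\<sigma> \<noteq> [] \<Longrightarrow> corner (opposite l) (ins l \<sigma>) \<longleftrightarrow> corner (opposite l) \<sigma>"
  by (auto simp: corner_def ins_def Let_def opposite_def hd_map last_map)

lemma ins_perms: assumes "\<sigma> = [] \<or> \<sigma> \<in> perms" shows "ins l \<sigma> \<in> perms"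
proof -
  have s: "distinct \<sigma>" "set \<sigma> = {1..length \<sigma>}" using assms by (auto simp: perms_iff)
  have "Suc ` {1..length \<sigma>} = {2..Suc (length \<sigma>)}" by (simp add: image_Suc_atLeastAtMost)
  moreover have "insert 1 {2..Suc (length \<sigma>)} = {1..Suc (length \<sigma>)}"
    "insert (Suc (length \<sigma>)) {1..length \<sigma>} = {1..Suc (length \<sigma>)}" by auto
  moreover have "1 \<notin> Suc ` {1..length \<sigma>}" by auto
  ultimately show ?thesis using s
    unfolding perms_iff ins_def by (auto simp: Let_def distinct_map)
qed

lemma uncorner_perms:
  assumes "\<sigma> \<in> perms" "length \<sigma> = Suc n" "n \<ge> 1" "corner l \<sigma>"
  obtains \<rho> where "\<rho> \<in> perms" "length \<rho> = n" "\<sigma> = ins l \<rho>"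
proof -
  have s: "\<sigma> \<noteq> []" "distinct \<sigma>" "set \<sigma> = {1..Suc n}" using assms by (auto simp: perms_iff)
  define rest where "rest = (if fst l then butlast \<sigma> else tl \<sigma>)"
  define v where "v = (if snd l then Suc n else 1)"
  have dec: "\<sigma> = (if fst l then rest @ [v] else v # rest)"
    using assms(4,2) s(1) append_butlast_last_id[OF s(1)] list.collapse[OF s(1)]
    unfolding rest_def v_def corner_def by (cases "fst l"; cases "snd l") simp_all
  have d: "distinct rest" "v \<notin> set rest" "length rest = n"
    using s(2) assms(2) arg_cong[OF dec, of length] by (auto simp: dec split: if_splits)
  have "set \<sigma> = insert v (set rest)" by (subst dec) auto
  then have sr: "set rest = {1..Suc n} - {v}" using s(3) d(2) by auto
  define \<rho> where "\<rho> = (if snd l then rest else map (\<lambda>x. x - 1) rest)"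
  have "set \<rho> = {1..n}"
  proof (cases "snd l")
    case True
    have "{1..Suc n} - {Suc n} = {1..n}" by auto
    then show ?thesis using sr True by (simp add: \<rho>_def v_def)
  next
    case False
    have "{1..Suc n} - {1} = Suc ` {1..n}" by (auto simp: image_Suc_atLeastAtMost)
    then have "set \<rho> = (\<lambda>x. x - 1) ` Suc ` {1..n}" using sr False by (simp add: \<rho>_def v_def)
    also have "\<dots> = {1..n}" by (simp only: image_image) simp
    finally show ?thesis .
  qed
  moreover have "length \<rho> = n" using d by (simp add: \<rho>_def)
  moreover have "distinct \<rho>" using \<open>set \<rho> = {1..n}\<close> \<open>length \<rho> = n\<close> by (intro card_distinct) simp
  moreover have "\<sigma> = ins l \<rho>"
  proof -
    have "0 \<notin> set rest" using sr by simp
    then have "map (\<lambda>x. Suc (x - 1)) rest = rest" by (intro map_idI) (metis Suc_pred' diff_Suc_1 gr0I)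
    then have "(if snd l then \<rho> else map Suc \<rho>) = rest" by (simp add: \<rho>_def comp_def)
    then show ?thesis using dec by (simp add: ins_def v_def \<open>length \<rho> = n\<close>)
  qed
  ultimately show ?thesis using that[of \<rho>] assms(3) unfolding perms_iff by fastforce
qed

section \<open>Stability of the X-class under insertion and removal of corner points\<close>

lemma is_pattern_ins: "is_pattern \<sigma> (ins l \<sigma>)"
proof -
  define \<sigma>' where "\<sigma>' = (if snd l then \<sigma> else map Suc \<sigma>)"
  have "order_iso \<sigma>' \<sigma>" unfolding \<sigma>'_def
    using order_iso_map[of Suc \<sigma>] by (auto simp: order_iso_refl strict_mono_def)
  moreover have "subseq \<sigma>' (ins l \<sigma>)"
    by (auto simp: ins_def Let_def \<sigma>'_def)
  ultimately show ?thesis using is_pattern_iff by blast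
qed

lemma X_class_uncorner:
  assumes "\<sigma> \<in> X_class" "length \<sigma> = Suc n" "n \<ge> 1" "corner l \<sigma>"
  obtains \<rho> where "\<rho> \<in> X_class" "length \<rho> = n" "\<sigma> = ins l \<rho>"
proof -
  obtain \<rho> where "\<rho> \<in> perms" "length \<rho> = n" "\<sigma> = ins l \<rho>"
    using uncorner_perms[OF X_class_perms[OF assms(1)] assms(2-4)] by blast
  then show ?thesis using that X_class_pattern[OF assms(1)] is_pattern_ins by metis
qed

text \<open>The common feature of the four forbidden patterns from which closure of the X-class
  under insertion follows: each of 2413, 3142, 2143 and 3412 begins and ends with an intermediate
  value.\<close>

definition cornerless :: "nat list \<Rightarrow> bool" where
  "cornerless \<pi> \<longleftrightarrow> (\<forall>e\<in>{hd \<pi>, last \<pi>}. (\<exists>x\<in>set \<pi>. x < e) \<and> (\<exists>x\<in>set \<pi>. e < x))"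

text \<open>The inserted entry \<open>v\<close> sits at an end of the list, so a copy of the pattern
  using it would have it as an end entry. But an end entry of a cornerless pattern lies strictly
  between two others in value, while \<open>v\<close> is extreme. Hence the copy avoids
  \<open>v\<close>.\<close>

lemma is_pattern_ins_cornerless:
  assumes "is_pattern \<pi> (ins l \<sigma>)" "\<sigma> = [] \<or> \<sigma> \<in> perms" "cornerless \<pi>" "\<pi> \<noteq> []"
  shows "is_pattern \<pi> \<sigma>"
proof -
  obtain \<rho> where \<rho>: "subseq \<rho> (ins l \<sigma>)" "order_iso \<rho> \<pi>" using assms(1) is_pattern_iff by blast
  define v where "v = (if snd l then Suc (length \<sigma>) else 1)"
  define \<sigma>' where "\<sigma>' = (if snd l then \<sigma> else map Suc \<sigma>)"
  have iso: "order_iso \<sigma>' \<sigma>" unfolding \<sigma>'_def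
    using order_iso_map[of Suc \<sigma>] by (auto simp: order_iso_refl strict_mono_def)
  have len: "length \<rho> = length \<pi>" using \<rho>(2) order_iso_length by blast
  have s: "set \<sigma> \<subseteq> {1..length \<sigma>}" using assms(2) by (auto simp: perms_iff)
  have ext: "(\<forall>x\<in>set (ins l \<sigma>). x \<le> v) \<or> (\<forall>x\<in>set (ins l \<sigma>). v \<le> x)"
    using s by (auto simp: ins_def Let_def v_def)
  have no: "\<rho> ! i \<noteq> v" if "i < length \<pi>" and i: "\<pi> ! i \<in> {hd \<pi>, last \<pi>}" for i
  proof
    assume e: "\<rho> ! i = v"
    obtain j k where "j < length \<pi>" "\<pi> ! j < \<pi> ! i" "k < length \<pi>" "\<pi> ! i < \<pi> ! k"
      using assms(3) i unfolding cornerless_def by (metis in_set_conv_nth)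
    then have "\<rho> ! j < v" "v < \<rho> ! k" using \<rho>(2) that e unfolding order_iso_nth by auto
    moreover have "\<rho> ! j \<in> set (ins l \<sigma>)" "\<rho> ! k \<in> set (ins l \<sigma>)"
      using \<open>j < length \<pi>\<close> \<open>k < length \<pi>\<close> len \<rho>(1)
      by (metis nth_mem in_set_nthsD subseq_conv_nths)+
    ultimately show False using ext by force
  qed
  have ne: "\<rho> \<noteq> []" using assms(4) len by auto
  have hd: "hd \<rho> \<noteq> v" using no[of 0] assms(4) ne len by (simp add: hd_conv_nth)
  have last: "last \<rho> \<noteq> v"
    using no[of "length \<pi> - 1"] assms(4) ne len by (simp add: last_conv_nth)
  have "subseq \<rho> \<sigma>'"
  proof (cases "fst l")
    case True
    then have "subseq \<rho> (\<sigma>' @ [v])" using \<rho>(1) by (simp add: ins_def Let_def v_def \<sigma>'_def)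
    then obtain a b where ab: "\<rho> = a @ b" "subseq a \<sigma>'" "subseq b [v]"
      by (auto simp: subseq_append_iff)
    have "set b \<subseteq> {v}" using ab(3) by (auto simp: subseq_conv_nths dest: in_set_nthsD)
    then have "b = []" using last ab(1) last_in_set[of b] by (metis last_appendR singletonD subsetD)
    then show ?thesis using ab by simp
  next
    case False
    then have "subseq \<rho> (v # \<sigma>')" using \<rho>(1) by (simp add: ins_def Let_def v_def \<sigma>'_def)
    then show ?thesis using hd by (cases \<rho>) (auto split: if_splits)
  qed
  then have "is_pattern \<rho> \<sigma>" using order_iso_subseq[OF iso] is_pattern_iff order_iso_sym by metis
  moreover have "is_pattern \<pi> \<rho>" using \<rho>(2) is_pattern_iff by blast
  ultimately show ?thesis using is_pattern_trans by blast
qed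

lemma X_class_ins: assumes "\<sigma> = [] \<or> \<sigma> \<in> X_class" shows "ins l \<sigma> \<in> X_class"
proof -
  have p: "\<sigma> = [] \<or> \<sigma> \<in> perms" using assms X_class_perms by blast
  have "\<not> is_pattern \<pi> (ins l \<sigma>)" if "\<pi> \<in> {[2,4,1,3], [3,1,4,2], [2,1,4,3], [3,4,1,2]}" for \<pi>
  proof
    assume a: "is_pattern \<pi> (ins l \<sigma>)"
    have "cornerless \<pi>" "\<pi> \<noteq> []" using that by (auto simp: cornerless_def)
    then have "is_pattern \<pi> \<sigma>" using is_pattern_ins_cornerless[OF a p] by blast
    then have "\<sigma> \<noteq> []" using \<open>\<pi> \<noteq> []\<close> by (auto simp: is_pattern_def)
    then show False using \<open>is_pattern \<pi> \<sigma>\<close> assms that unfolding X_class_def Av_def by blast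
  qed
  then show ?thesis unfolding X_class_def Av_def using ins_perms[OF p] by blast
qed

lemma subseq_pair: "x \<in> set xs \<Longrightarrow> y \<in> set xs \<Longrightarrow> x \<noteq> y \<Longrightarrow> subseq [x, y] xs \<or> subseq [y, x] xs"
  by (induction xs) (auto simp: subseq_singleton_left)

text \<open>If no corner is occupied, the first entry \<open>f\<close>, the last entry
  \<open>g\<close> and the two extreme values are four distinct points, with the extreme values
  strictly inside the list. The two relative orders of \<open>f\<close> and \<open>g\<close> and the
  two orders in which the extreme values appear combine to exactly the four forbidden
  patterns.\<close>

lemma X_class_corner:
  assumes "\<sigma> \<in> X_class" shows "\<exists>l. corner l \<sigma>"
proof (rule ccontr)
  assume no: "\<nexists>l. corner l \<sigma>"
  let ?n = "length \<sigma>"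
  have s: "\<sigma> \<noteq> []" "distinct \<sigma>" "set \<sigma> = {1..?n}"
    using X_class_perms[OF assms] by (auto simp: perms_iff)
  have n: "hd \<sigma> \<noteq> 1" "hd \<sigma> \<noteq> ?n" "last \<sigma> \<noteq> 1" "last \<sigma> \<noteq> ?n"
    using no unfolding corner_def by (metis fst_conv snd_conv)+
  have "length \<sigma> \<noteq> 1" using n s(3) by (metis atLeastAtMost_singleton hd_in_set s(1) singletonD)
  then obtain f m g where dec: "\<sigma> = f # m @ [g]"
    using s(1) by (cases \<sigma>) (auto, metis rev_exhaust)
  have fg: "f \<in> {1..?n}" "g \<in> {1..?n}" "f \<noteq> g" using s by (auto simp: dec)
  have b: "1 < f" "f < ?n" "1 < g" "g < ?n" using n fg by (auto simp: dec)
  have "1 \<in> set \<sigma>" "?n \<in> set \<sigma>" using s b by auto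
  then have "1 \<in> set m" "?n \<in> set m" using b by (auto simp: dec)
  then have "subseq [1, ?n] m \<or> subseq [?n, 1] m" using b by (intro subseq_pair) auto
  moreover have "subseq [f, x, y, g] \<sigma>" if "subseq [x, y] m" for x y
    unfolding dec using list_emb_append_mono[OF that, of "[g]" "[g]"] by simp
  ultimately have "subseq [f, 1, ?n, g] \<sigma> \<or> subseq [f, ?n, 1, g] \<sigma>" by blast
  then consider "f < g" "subseq [f, 1, ?n, g] \<sigma>" | "f > g" "subseq [f, 1, ?n, g] \<sigma>"
    | "f < g" "subseq [f, ?n, 1, g] \<sigma>" | "f > g" "subseq [f, ?n, 1, g] \<sigma>"
    using fg by linarith
  then show False
  proof cases
    case 1 then have "is_pattern [2,1,4,3] \<sigma>" using b
      by (intro is_pattern_order_iso[of "[f, 1, ?n, g]"]) (auto simp: order_iso_def)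
    then show False using assms by (auto simp: X_class_def Av_def)
  next
    case 2 then have "is_pattern [3,1,4,2] \<sigma>" using b
      by (intro is_pattern_order_iso[of "[f, 1, ?n, g]"]) (auto simp: order_iso_def)
    then show False using assms by (auto simp: X_class_def Av_def)
  next
    case 3 then have "is_pattern [2,4,1,3] \<sigma>" using b
      by (intro is_pattern_order_iso[of "[f, ?n, 1, g]"]) (auto simp: order_iso_def)
    then show False using assms by (auto simp: X_class_def Av_def)
  next
    case 4 then have "is_pattern [3,4,1,2] \<sigma>" using b
      by (intro is_pattern_order_iso[of "[f, ?n, 1, g]"]) (auto simp: order_iso_def)
    then show False using assms by (auto simp: X_class_def Av_def)
  qed
qed


section \<open>Counting the X-class\<close>

lemma finite_of_size: "A \<subseteq> perms \<Longrightarrow> finite (of_size A n)"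
  by (rule finite_subset[OF _ finite_lists_length_eq[of "{1..n}" n]])
     (auto simp: of_size_def perms_iff)

lemma finite_of_size_X [simp]: "finite (of_size X_class n)"
  by (rule finite_of_size) (auto simp: X_class_perms)

text \<open>Adjacent corners share either an end of the list, which would carry both extreme values,
  or an extreme value, which would occur at both ends.\<close>

lemma corner_conflict:
  assumes "\<sigma> \<in> perms" "length \<sigma> \<ge> 2" "corner l \<sigma>" "corner l' \<sigma>" "l' \<noteq> l"
  shows "l' = opposite l"
proof (rule ccontr)
  assume no: "l' \<noteq> opposite l"
  have "\<sigma> \<noteq> []" "distinct \<sigma>" using assms(1) by (auto simp: perms_iff)
  then have "hd \<sigma> \<noteq> last \<sigma>" using assms(2)
    by (simp add: hd_conv_nth last_conv_nth nth_eq_iff_index_eq)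
  then show False using assms(2-5) no
    by (cases l; cases l') (auto simp: corner_def opposite_def split: if_splits)
qed

lemma of_size_X_1: "of_size X_class 1 = {[1]}"
proof -
  have "[1] \<in> X_class" using X_class_ins[of "[]" "(False, False)"] by (simp add: ins_def)
  moreover have "\<sigma> = [1]" if "\<sigma> \<in> perms" "length \<sigma> = 1" for \<sigma>
    using that by (cases \<sigma>) (auto simp: perms_iff)
  ultimately show ?thesis using X_class_perms by (auto simp: of_size_def)
qed

lemma corner_X_eq:
  assumes "n \<ge> 1"
  shows "{\<sigma> \<in> of_size X_class (Suc n). corner l \<sigma>} = ins l ` of_size X_class n"
proof (intro subset_antisym subsetI)
  fix \<sigma> assume "\<sigma> \<in> {\<sigma> \<in> of_size X_class (Suc n). corner l \<sigma>}"
  then have "\<sigma> \<in> X_class" "length \<sigma> = Suc n" "corner l \<sigma>" by (auto simp: of_size_def)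
  then obtain \<rho> where "\<rho> \<in> X_class" "length \<rho> = n" "\<sigma> = ins l \<rho>"
    using X_class_uncorner assms by blast
  then show "\<sigma> \<in> ins l ` of_size X_class n" by (auto simp: of_size_def)
next
  fix \<sigma> assume "\<sigma> \<in> ins l ` of_size X_class n"
  then obtain \<rho> where "\<rho> \<in> X_class" "length \<rho> = n" "\<sigma> = ins l \<rho>" by (auto simp: of_size_def)
  then show "\<sigma> \<in> {\<sigma> \<in> of_size X_class (Suc n). corner l \<sigma>}"
    by (simp add: of_size_def X_class_ins corner_ins)
qed

lemma card_corner_X:
  assumes "n \<ge> 1"
  shows "card {\<sigma> \<in> of_size X_class (Suc n). corner l \<sigma>} = card (of_size X_class n)"
  unfolding corner_X_eq[OF assms] by (intro card_image inj_onI) (rule ins_inj)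

lemma card_corner_opposite_X:
  assumes "n \<ge> 1"
  shows "card {\<sigma> \<in> of_size X_class (Suc n). corner l \<sigma> \<and> corner (opposite l) \<sigma>}
       = card {\<sigma> \<in> of_size X_class n. corner (opposite l) \<sigma>}"
proof -
  have "{\<sigma> \<in> of_size X_class (Suc n). corner l \<sigma> \<and> corner (opposite l) \<sigma>}
      = {\<sigma> \<in> {\<sigma> \<in> of_size X_class (Suc n). corner l \<sigma>}. corner (opposite l) \<sigma>}" by auto
  also have "\<dots> = ins l ` {\<sigma> \<in> of_size X_class n. corner (opposite l) \<sigma>}"
  proof -
    have "corner (opposite l) (ins l \<sigma>) \<longleftrightarrow> corner (opposite l) \<sigma>" if "\<sigma> \<in> of_size X_class n" for \<sigma>
      using that assms by (intro corner_opposite_ins) (auto simp: of_size_def)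
    then show ?thesis unfolding corner_X_eq[OF assms] by auto
  qed
  finally show ?thesis by (simp add: card_image inj_onI ins_inj)
qed

text \<open>Inclusion-exclusion over the four corners. Each corner is occupied in as many
  permutations as there are of size \<open>n\<close>; adjacent corners exclude each other, so only
  the two diagonal pairs overlap, and each overlap is counted by
  \<open>card_corner_opposite_X\<close>.\<close>

lemma card_X_rec:
  assumes "n \<ge> 1"
  shows "card (of_size X_class (Suc n)) + 2 * card {\<sigma> \<in> of_size X_class n. corner (True, True) \<sigma>}
    = 4 * card (of_size X_class n)"
proof -
  define A where "A l = {\<sigma> \<in> of_size X_class (Suc n). corner l \<sigma>}" for l
  define D where "D l = A l \<union> A (opposite l)" for l
  have fin: "finite (A l)" for l by (simp add: A_def)
  \<comment> \<open>All corners are occupied equally often: trivially for size one, and by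
    \<open>card_corner_X\<close> one size below otherwise.\<close>
  have sym: "card {\<sigma> \<in> of_size X_class n. corner l \<sigma>} = card {\<sigma> \<in> of_size X_class n. corner (True, True) \<sigma>}" for l
  proof (cases "n = 1")
    case True
    have "{\<sigma> \<in> of_size X_class 1. corner l \<sigma>} = {[1]}" for l
      by (simp only: of_size_X_1) (auto simp: corner_def)
    then show ?thesis using True by simp
  next
    case False
    then obtain m where "n = Suc m" "m \<ge> 1" using assms by (cases n) auto
    then show ?thesis by (simp add: card_corner_X)
  qed
  have DD: "card (D l) + card {\<sigma> \<in> of_size X_class n. corner (True, True) \<sigma>} = 2 * card (of_size X_class n)" for l
  proof -
    have "A l \<inter> A (opposite l) = {\<sigma> \<in> of_size X_class (Suc n). corner l \<sigma> \<and> corner (opposite l) \<sigma>}"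
      by (auto simp: A_def)
    then have "card (A l \<inter> A (opposite l)) = card {\<sigma> \<in> of_size X_class n. corner (True, True) \<sigma>}"
      using card_corner_opposite_X[OF assms] sym by simp
    moreover have "card (A l) = card (of_size X_class n)" for l
      unfolding A_def by (rule card_corner_X[OF assms])
    ultimately show ?thesis using card_Un_Int[OF fin[of l] fin[of "opposite l"]] by (simp add: D_def)
  qed
  have "of_size X_class (Suc n) = D (False, False) \<union> D (False, True)"
  proof -
    have "\<sigma> \<in> D (False, False) \<union> D (False, True)" if \<sigma>: "\<sigma> \<in> of_size X_class (Suc n)" for \<sigma>
    proof -
      obtain a b where "corner (a, b) \<sigma>" using X_class_corner[of \<sigma>] \<sigma> by (auto simp: of_size_def)
      then show ?thesis using \<sigma> by (cases a; cases b) (auto simp: D_def A_def opposite_def)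
    qed
    then show ?thesis by (auto simp: D_def A_def)
  qed
  moreover have "D (False, False) \<inter> D (False, True) = {}"
    using corner_conflict assms X_class_perms
    by (fastforce simp: D_def A_def opposite_def of_size_def)
  ultimately have "card (of_size X_class (Suc n)) = card (D (False, False)) + card (D (False, True))"
    by (simp add: card_Un_disjoint D_def fin)
  then show ?thesis using DD[of "(False, False)"] DD[of "(False, True)"] by simp
qed

section \<open>Solution of the recurrence\<close>

abbreviation growth :: real where "growth \<equiv> 2 + sqrt 2"
abbreviation growth' :: real where "growth' \<equiv> 2 - sqrt 2"

lemma growth_sq: "growth\<^sup>2 = 4 * growth - 2" "growth'\<^sup>2 = 4 * growth' - 2"
  by (simp_all add: power2_eq_square algebra_simps)

text \<open>By \<open>card_corner_X\<close> the correction term of \<open>card_X_rec\<close> is,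
  from size two on, the count one size below. So the counts satisfy a_(n+1) = 4 a_n - 2 a_(n-1),
  with characteristic roots \<open>growth\<close> and \<open>growth'\<close> and initial values 1
  and 2.\<close>

lemma card_X: "real (card (of_size X_class (Suc n))) = (growth ^ n + growth' ^ n) / 2"
proof (induction n rule: less_induct)
  case (less n)
  consider "n = 0" | "n = 1" | m where "n = Suc (Suc m)"
    by (cases n rule: nat.exhaust; cases "n - 1") auto
  then show ?case
  proof cases
    case 1 then show ?thesis using of_size_X_1 by simp
  next
    case 2
    have "{\<sigma> \<in> of_size X_class 1. corner (True, True) \<sigma>} = {[1]}"
      by (simp only: of_size_X_1) (auto simp: corner_def)
    then have "card (of_size X_class (Suc 1)) = 2"
      using card_X_rec[of 1] by (simp only: of_size_X_1) simp
    then show ?thesis using 2 by simp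
  next
    case 3
    have "card (of_size X_class (Suc n)) + 2 * card (of_size X_class (Suc m)) = 4 * card (of_size X_class n)"
      using card_X_rec[of n] card_corner_X[of "Suc m" "(True, True)"] 3 by simp
    from arg_cong[OF this, of real] have "real (card (of_size X_class (Suc n))) =
       4 * real (card (of_size X_class (Suc (Suc m)))) - 2 * real (card (of_size X_class (Suc m)))"
      unfolding 3 by simp
    also have "\<dots> = 4 * ((growth ^ Suc m + growth' ^ Suc m) / 2) - 2 * ((growth ^ m + growth' ^ m) / 2)"
      using less[of m] less[of "Suc m"] 3 by (simp only: less_Suc_eq simp_thms)
    also have "\<dots> = (growth ^ m * (4 * growth - 2) + growth' ^ m * (4 * growth' - 2)) / 2"
      by (simp add: field_simps)
    also have "\<dots> = (growth ^ n + growth' ^ n) / 2"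
      unfolding growth_sq[symmetric] 3 by (simp add: power2_eq_square mult_ac)
    finally show ?thesis .
  qed
qed

lemma card_X_le: "real (card (of_size X_class n)) \<le> growth ^ n"
proof (cases n)
  case 0
  have "of_size X_class 0 = {}" using X_class_perms by (auto simp: of_size_def perms_iff)
  then show ?thesis using 0 by simp
next
  case (Suc m)
  have s: "0 < sqrt 2" "sqrt 2 < 2" by (auto intro: real_less_lsqrt)
  then have "growth' ^ m \<le> growth ^ m" by (intro power_mono) auto
  moreover have "growth ^ m \<le> growth * growth ^ m" using mult_right_mono[of 1 growth "growth ^ m"] by simp
  ultimately show ?thesis unfolding Suc card_X by simp
qed


section \<open>Corner words\<close>

text \<open>A word encodes the permutation from which its letters can be peeled off one after the
  other.  Peeling off opposite corners commutes, so words can be normalised to contain no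
  right corner immediately followed by the opposite left corner.\<close>

definition perm_of :: "(bool \<times> bool) list \<Rightarrow> nat list" where
  "perm_of w = foldr ins w []"

definition allowed :: "bool \<times> bool \<Rightarrow> bool \<times> bool \<Rightarrow> bool" where
  "allowed l l' \<longleftrightarrow> \<not> (fst l \<and> l' = opposite l)"

lemma perm_of_simps [simp]: "perm_of [] = []" "perm_of (l # w) = ins l (perm_of w)"
  by (simp_all add: perm_of_def)

lemma length_perm_of [simp]: "length (perm_of w) = length w"
  by (induction w) auto

text \<open>Peel off a left corner whenever one is occupied, and a right one otherwise. If a right
  letter \<open>l\<close> were followed by \<open>opposite l\<close>, that left corner would by
  \<open>corner_opposite_ins\<close> have been occupied already before \<open>l\<close> was peeled
  off.\<close>

lemma ex_canonical_word:
  assumes "\<sigma> \<in> X_class"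
  shows "\<exists>w. perm_of w = \<sigma> \<and> successively allowed w"
  using assms
proof (induction "length \<sigma>" arbitrary: \<sigma> rule: less_induct)
  case less
  have "\<sigma> \<noteq> []" using X_class_perms less.prems by (auto simp: perms_iff)
  then consider "length \<sigma> = 1" | n where "length \<sigma> = Suc n" "n \<ge> 1"
    by (cases "length \<sigma>") (auto simp: Suc_le_eq)
  then show ?case
  proof cases
    case 1
    then have "\<sigma> = [1]" using less.prems of_size_X_1 by (auto simp: of_size_def)
    \<comment> \<open>All four one-letter words code this permutation; any of them serves.\<close>
    then have "perm_of [(False, False)] = \<sigma>" by (simp add: ins_def)
    then show ?thesis by (metis successively.simps(2))
  next
    case 2
    obtain l where l: "corner l \<sigma>" "fst l \<Longrightarrow> \<not> corner (False, b) \<sigma>" for b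
      using X_class_corner[OF less.prems] by (metis fst_conv)
    obtain \<rho> where \<rho>: "\<rho> \<in> X_class" "length \<rho> = n" "\<sigma> = ins l \<rho>"
      using X_class_uncorner[OF less.prems 2 l(1)] by blast
    obtain w where w: "perm_of w = \<rho>" "successively allowed w"
      using less.hyps[of \<rho>] \<rho> 2 by auto
    have "allowed l (hd w)" if "w \<noteq> []"
    proof (rule ccontr)
      assume "\<not> allowed l (hd w)"
      then have a: "fst l" "hd w = opposite l" by (auto simp: allowed_def)
      then have "corner (opposite l) \<rho>" using w(1) corner_ins[of "opposite l"] that by (cases w) auto
      then have "corner (opposite l) \<sigma>"
        using corner_opposite_ins \<rho> 2(2) by (metis list.size(3) not_one_le_zero)
      then show False using l(2) a(1) by (simp add: opposite_def)
    qed
    then have "successively allowed (l # w)" using w(2) by (auto simp: successively_Cons)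
    then show ?thesis using w(1) \<rho>(3) by (metis perm_of_simps(2))
  qed
qed

text \<open>One coordinate of the point of letter \<open>t\<close>, \<open>True\<close> being the
  high side. When the first \<open>t\<close> letters are peeled off, \<open>length bs - t\<close>
  points remain, of which this one is the highest or the lowest; each earlier letter on the low side
  then shifts it up by one.\<close>

definition pos :: "bool list \<Rightarrow> nat \<Rightarrow> nat" where
  "pos bs t = (if bs ! t then length bs - t else 1) + count_list (take t bs) False"

lemma pos_Cons_Suc: "t < length bs \<Longrightarrow> pos (b # bs) (Suc t) = pos bs t + (if b then 0 else 1)"
  by (simp add: pos_def)

text \<open>The points are reindexed by the letters that create them. Stating this for sums of an
  arbitrary \<open>F\<close> avoids naming the bijection, and lets the induction hypothesis be
  applied to a shifted function when a letter is put in front.\<close>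

lemma sum_perm_of:
  fixes F :: "nat \<Rightarrow> nat \<Rightarrow> real"
  shows "(\<Sum>i<length w. F (Suc i) (perm_of w ! i))
       = (\<Sum>t<length w. F (pos (map fst w) t) (pos (map snd w) t))"
proof (induction w arbitrary: F)
  case (Cons l w)
  let ?n = "length w" and ?\<sigma> = "perm_of w"
  define dx where "dx = (if fst l then 0 else 1 :: nat)"
  define dy where "dy = (if snd l then 0 else 1 :: nat)"
  have "(\<Sum>i<Suc ?n. F (Suc i) (ins l ?\<sigma> ! i)) =
     F (pos (map fst (l # w)) 0) (pos (map snd (l # w)) 0) + (\<Sum>i<?n. F (Suc i + dx) (?\<sigma> ! i + dy))"
  proof (cases "fst l")
    case True
    then show ?thesis unfolding ins_def Let_def pos_def dx_def dy_def by (simp add: nth_append)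
  next
    case False
    then show ?thesis unfolding ins_def Let_def pos_def dx_def dy_def
      by (simp add: sum.lessThan_Suc_shift del: sum.lessThan_Suc)
  qed
  also have "(\<Sum>i<?n. F (Suc i + dx) (?\<sigma> ! i + dy))
      = (\<Sum>t<?n. F (pos (map fst w) t + dx) (pos (map snd w) t + dy))"
    by (rule Cons.IH[of "\<lambda>x y. F (x + dx) (y + dy)"])
  also have "\<dots> = (\<Sum>t<?n. F (pos (map fst (l # w)) (Suc t)) (pos (map snd (l # w)) (Suc t)))"
    by (intro sum.cong refl) (simp add: pos_Cons_Suc dx_def dy_def)
  finally show ?case by (simp add: sum.lessThan_Suc_shift del: sum.lessThan_Suc)
qed simp


section \<open>Exponential concentration for canonical words\<close>

text \<open>The preceding letter \<open>l\<close> is a parameter so that the transfer recursion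
  \<open>words_Suc\<close> holds. A left letter forbids nothing, so
  \<open>words n (False, False)\<close> consists of all canonical words of length
  \<open>n\<close>.\<close>

definition words :: "nat \<Rightarrow> bool \<times> bool \<Rightarrow> (bool \<times> bool) list set" where
  "words n l = {w. length w = n \<and> successively allowed (l # w)}"

text \<open>The Perron eigenvector, for the eigenvalue \<^const>\<open>growth\<close>, of the transfer matrix of
  canonical words.\<close>

definition perron :: "bool \<times> bool \<Rightarrow> real" where
  "perron l = (if fst l then 1 else sqrt 2)"

lemma words_0 [simp]: "words 0 l = {[]}"
  by (auto simp: words_def)

lemma words_Suc: "words (Suc n) l = (\<Union>l'\<in>{l'. allowed l l'}. (#) l' ` words n l')"
  by (auto simp: words_def length_Suc_conv successively_Cons image_iff)

lemma finite_words [simp]: "finite (words n l)"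
  by (induction n arbitrary: l) (auto simp: words_Suc)

lemma sum_words_Suc:
  "(\<Sum>w\<in>words (Suc n) l. f w) = (\<Sum>l'\<in>{l'. allowed l l'}. \<Sum>w\<in>words n l'. f (l' # w))"
  unfolding words_Suc by (subst sum.UNION_disjoint) (auto simp: sum.reindex intro!: sum.cong)

lemma allowed_set:
  "{l'. allowed l l'} = (if fst l then UNIV - {opposite l} else UNIV)"
  by (auto simp: allowed_def)

lemma UNIV_corner: "(UNIV :: (bool \<times> bool) set) = {(False, False), (False, True), (True, False), (True, True)}"
  by (auto simp: UNIV_bool)

lemma sum_allowed:
  "(\<Sum>l'\<in>{l'. allowed l l'}. f l') =
     f (False, False) + f (False, True) + f (True, False) + f (True, True)
     - (if fst l then f (opposite l) else (0 :: real))"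
proof -
  have "(\<Sum>l'\<in>UNIV. f l') = f (False, False) + f (False, True) + f (True, False) + f (True, True)"
    unfolding UNIV_corner by simp
  then show ?thesis unfolding allowed_set by (simp add: sum_diff1)
qed

lemma perron_eigenvector: "(\<Sum>l'\<in>{l'. allowed l l'}. perron l') = growth * perron l"
  by (cases l) (auto simp: sum_allowed perron_def opposite_def algebra_simps)

lemma exp_le_quadratic:
  fixes y :: real assumes "\<bar>y\<bar> \<le> 1" shows "exp y \<le> 1 + y + y\<^sup>2"
proof (cases "y \<ge> 0")
  case True then show ?thesis using exp_bound assms by simp
next
  case False
  define x where "x = - y"
  have x: "0 \<le> x" "x \<le> 1" using False assms by (auto simp: x_def)
  \<comment> \<open>The product equals 1 + x^3.\<close>
  have "1 \<le> (1 + x) * (1 - x + x\<^sup>2)" using x by (simp add: algebra_simps power2_eq_square)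
  also have "\<dots> \<le> exp x * (1 - x + x\<^sup>2)"
    using x exp_ge_add_one_self by (intro mult_right_mono) auto
  finally have "exp (- x) \<le> 1 - x + x\<^sup>2" by (simp add: exp_minus field_simps)
  then show ?thesis by (simp add: x_def)
qed

definition poisson_pair :: "(bool \<times> bool \<Rightarrow> real) \<Rightarrow> (bool \<times> bool \<Rightarrow> real) \<Rightarrow> bool" where
  "poisson_pair \<phi> g \<longleftrightarrow>
     (\<forall>l. (\<Sum>l'\<in>{l'. allowed l l'}. perron l' * (\<phi> l' + g l')) = growth * perron l * g l) \<and>
     (\<forall>l l'. \<bar>\<phi> l' + g l' - g l\<bar> \<le> 2) \<and> (\<forall>l. \<bar>g l\<bar> \<le> 1)"

text \<open>The first condition is the Poisson equation of the Markov chain with transition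
  probabilities \<open>perron l' / (growth * perron l)\<close>; it makes the exponential sums over words
  submultiplicative up to a second order term in \<open>z\<close>.\<close>

lemma exponential_drift:
  assumes "poisson_pair \<phi> g" and z: "2 * \<bar>z\<bar> \<le> 1"
  shows "(\<Sum>l'\<in>{l'. allowed l l'}. perron l' * exp (z * (\<phi> l' + g l')))
     \<le> growth * (1 + 4 * z\<^sup>2) * perron l * exp (z * g l)"
proof -
  let ?A = "{l'. allowed l l'}"
  have poisson: "(\<Sum>l'\<in>?A. perron l' * (\<phi> l' + g l')) = growth * perron l * g l"
    and bnd: "\<bar>\<phi> l' + g l' - g l\<bar> \<le> 2" for l'
    using assms(1) unfolding poisson_pair_def by blast+
  define X where "X l' = \<phi> l' + g l' - g l" for l'
  have p0: "perron l' \<ge> 0" for l' by (simp add: perron_def)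
  have e: "exp (z * X l') \<le> 1 + 4 * z\<^sup>2 + z * X l'" for l'
  proof -
    have b: "\<bar>z * X l'\<bar> \<le> 2 * \<bar>z\<bar>"
      unfolding abs_mult X_def using mult_left_mono[OF bnd[of l'], of "\<bar>z\<bar>"] by simp
    then have "exp (z * X l') \<le> 1 + z * X l' + (z * X l')\<^sup>2"
      using z by (intro exp_le_quadratic) linarith
    moreover have "(z * X l')\<^sup>2 \<le> (2 * \<bar>z\<bar>)\<^sup>2" using power_mono[OF b, of 2] by simp
    ultimately show ?thesis by (simp add: power_mult_distrib)
  qed
  have "(\<Sum>l'\<in>?A. perron l' * exp (z * (\<phi> l' + g l'))) = exp (z * g l) * (\<Sum>l'\<in>?A. perron l' * exp (z * X l'))"
    unfolding sum_distrib_left X_def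
    by (intro sum.cong refl) (simp add: algebra_simps flip: exp_add)
  also have "\<dots> \<le> exp (z * g l) * (\<Sum>l'\<in>?A. perron l' * (1 + 4 * z\<^sup>2 + z * X l'))"
    by (intro mult_left_mono sum_mono e p0) auto
  also have "(\<Sum>l'\<in>?A. perron l' * (1 + 4 * z\<^sup>2 + z * X l'))
      = (1 + 4 * z\<^sup>2 - z * g l) * (\<Sum>l'\<in>?A. perron l') + z * (\<Sum>l'\<in>?A. perron l' * (\<phi> l' + g l'))"
    unfolding sum_distrib_left sum.distrib[symmetric] X_def by (intro sum.cong refl) (simp add: algebra_simps)
  \<comment> \<open>The linear terms cancel: by the eigenvector and Poisson equations the increments
    \<open>X\<close> have weighted mean zero.\<close>
  also have "\<dots> = growth * (1 + 4 * z\<^sup>2) * perron l"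
    unfolding perron_eigenvector poisson by (simp add: algebra_simps)
  finally show ?thesis by (simp add: mult_ac)
qed

text \<open>By \<open>exponential_drift\<close>, the weight \<open>perron l * exp (z * g l)\<close>
  picks up at most a factor \<open>growth * (1 + 4 * z\<^sup>2)\<close> with each of the first
  \<open>t\<close> letters; the later ones are merely counted. The factor \<open>exp 1\<close> pays
  for \<open>exp (z * g l)\<close>, possibly less than one, at the moment when mere counting
  starts.\<close>

lemma exponential_sum_bound:
  assumes pair: "poisson_pair \<phi> g" and z: "2 * \<bar>z\<bar> \<le> 1" and "t \<le> n"
  shows "(\<Sum>w\<in>words n l. exp (z * (\<Sum>i<t. \<phi> (w ! i))))
     \<le> exp 1 * growth ^ n * (1 + 4 * z\<^sup>2) ^ t * perron l * exp (z * g l)"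
  using \<open>t \<le> n\<close>
proof (induction n arbitrary: t l)
  have g: "1 \<le> exp 1 * exp (z * g l)" for l
  proof -
    have "\<bar>g l\<bar> \<le> 1" using pair unfolding poisson_pair_def by blast
    then have "\<bar>z * g l\<bar> \<le> 1" unfolding abs_mult using z by (intro mult_le_one) auto
    then show ?thesis by (simp flip: exp_add)
  qed
  have v: "1 \<le> perron l" for l by (simp add: perron_def)
  {
    case 0
    then show ?case using mult_mono[OF v g] v by (simp add: mult_ac) (smt (verit) v)
  next
    case (Suc n t l)
    show ?case
    proof (cases t)
      case 0
      have "(\<Sum>w\<in>words (Suc n) l. exp (z * (\<Sum>i<t. \<phi> (w ! i)))) = (\<Sum>l'\<in>{l'. allowed l l'}. real (card (words n l')))"
        unfolding sum_words_Suc 0 by simp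
      have cw: "real (card (words m l)) \<le> growth ^ m * perron l" for m l
      proof (induction m arbitrary: l)
        case 0 then show ?case using v by simp
      next
        case (Suc m)
        have "real (card (words (Suc m) l)) = (\<Sum>l'\<in>{l'. allowed l l'}. real (card (words m l')))"
          using sum_words_Suc[of "\<lambda>_. 1 :: real" m l] by simp
        also have "\<dots> \<le> (\<Sum>l'\<in>{l'. allowed l l'}. growth ^ m * perron l')"
          by (intro sum_mono Suc)
        also have "\<dots> = growth ^ Suc m * perron l"
          unfolding sum_distrib_left[symmetric] perron_eigenvector by simp
        finally show ?case .
      qed
      have "growth ^ Suc n * perron l * 1 \<le> growth ^ Suc n * perron l * (exp 1 * exp (z * g l))"
        using v[of l] by (intro mult_left_mono g) auto
      then show ?thesis using cw[of "Suc n" l] by (simp add: 0 mult_ac)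
    next
      case (Suc s)
      let ?C = "exp 1 * growth ^ n * (1 + 4 * z\<^sup>2) ^ s"
      have C: "0 \<le> ?C" by (intro mult_nonneg_nonneg zero_le_power) auto
      have "(\<Sum>w\<in>words (Suc n) l. exp (z * (\<Sum>i<t. \<phi> (w ! i))))
         = (\<Sum>l'\<in>{l'. allowed l l'}. exp (z * \<phi> l') * (\<Sum>w\<in>words n l'. exp (z * (\<Sum>i<s. \<phi> (w ! i)))))"
        unfolding sum_words_Suc Suc sum.lessThan_Suc_shift
        by (simp add: distrib_left exp_add sum_distrib_left)
      also have "\<dots> \<le> (\<Sum>l'\<in>{l'. allowed l l'}. exp (z * \<phi> l') * (?C * perron l' * exp (z * g l')))"
        using Suc.IH[of s] Suc.prems Suc by (intro sum_mono mult_left_mono) auto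
      also have "\<dots> = ?C * (\<Sum>l'\<in>{l'. allowed l l'}. perron l' * exp (z * (\<phi> l' + g l')))"
        unfolding sum_distrib_left by (intro sum.cong refl) (simp add: distrib_left exp_add mult_ac)
      also have "\<dots> \<le> ?C * (growth * (1 + 4 * z\<^sup>2) * perron l * exp (z * g l))"
        by (intro mult_left_mono exponential_drift pair z C)
      finally show ?thesis by (simp add: Suc mult_ac)
    qed
  }
qed

text \<open>Exponential Markov inequality for both tails, with \<open>z\<close> and
  \<open>- z\<close>. The constant 4 is 2 for the tails times a bound 2 for
  \<open>perron (False, False)\<close>, and \<open>g (False, False) = 0\<close> removes the boundary
  factor.\<close>

lemma card_deviation_bound:
  assumes pair: "poisson_pair \<phi> g" and z: "0 < z" "2 * z \<le> 1"
    and "t \<le> n" and g0: "g (False, False) = 0"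
  shows "real (card {w \<in> words n (False, False). d < \<bar>\<Sum>i<t. \<phi> (w ! i)\<bar>})
     \<le> 4 * exp 1 * growth ^ n * exp (4 * z\<^sup>2 * n - z * d)"
proof -
  let ?S = "\<lambda>w. \<Sum>i<t. \<phi> (w ! i)" and ?W = "words n (False, False)"
  have "real (card {w \<in> ?W. d < \<bar>?S w\<bar>}) * exp (z * d) = (\<Sum>w\<in>{w \<in> ?W. d < \<bar>?S w\<bar>}. exp (z * d))"
    by simp
  also have "\<dots> \<le> (\<Sum>w\<in>{w \<in> ?W. d < \<bar>?S w\<bar>}. exp (z * ?S w) + exp ((- z) * ?S w))"
  proof (intro sum_mono)
    fix w assume "w \<in> {w \<in> ?W. d < \<bar>?S w\<bar>}"
    then have "d \<le> ?S w \<or> d \<le> - ?S w" by auto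
    then have "z * d \<le> z * ?S w \<or> z * d \<le> (- z) * ?S w"
      using z mult_left_mono[of d "?S w" z] mult_left_mono[of d "- ?S w" z] by auto
    then show "exp (z * d) \<le> exp (z * ?S w) + exp ((- z) * ?S w)"
      by (smt (verit) exp_le_cancel_iff exp_gt_zero)
  qed
  also have "\<dots> \<le> (\<Sum>w\<in>?W. exp (z * ?S w) + exp ((- z) * ?S w))"
    by (intro sum_mono2) (auto simp: add_nonneg_nonneg)
  also have "\<dots> \<le> exp 1 * growth ^ n * (1 + 4 * z\<^sup>2) ^ t * sqrt 2 * 2"
    using exponential_sum_bound[OF pair, of z t n "(False, False)"]
      exponential_sum_bound[OF pair, of "- z" t n "(False, False)"] z \<open>t \<le> n\<close>
    by (simp add: sum.distrib g0 perron_def)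
  also have "\<dots> \<le> exp 1 * growth ^ n * exp (4 * z\<^sup>2 * n) * 2 * 2"
  proof -
    have "(1 + 4 * z\<^sup>2) ^ t \<le> exp (4 * z\<^sup>2) ^ t"
      using exp_ge_add_one_self by (intro power_mono) auto
    also have "\<dots> \<le> exp (4 * z\<^sup>2) ^ n" using \<open>t \<le> n\<close> by (intro power_increasing) auto
    also have "\<dots> = exp (4 * z\<^sup>2 * n)" by (simp add: exp_of_nat_mult mult_ac flip: exp_of_nat_mult)
    finally have "(1 + 4 * z\<^sup>2) ^ t \<le> exp (4 * z\<^sup>2 * n)" .
    moreover have "sqrt 2 \<le> 2" by (simp add: real_sqrt_le_iff' sqrt_le_D real_le_lsqrt)
    ultimately show ?thesis by (intro mult_mono mult_left_mono) auto
  qed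
  finally show ?thesis by (simp add: exp_diff field_simps)
qed

text \<open>The three nontrivial characters of the group \<open>(\<int>/2)\<^sup>2\<close> of corners.\<close>

definition chi_x :: "bool \<times> bool \<Rightarrow> real" where "chi_x l = (if fst l then -1 else 1)"
definition chi_y :: "bool \<times> bool \<Rightarrow> real" where "chi_y l = (if snd l then -1 else 1)"
definition chi_xy :: "bool \<times> bool \<Rightarrow> real" where "chi_xy l = chi_x l * chi_y l"

text \<open>All prefixes are tested, because the place of a point depends on the letters before it.
  The length of a prefix and its sums of the three characters together determine how often each of
  the four corners occurs in it.\<close>

definition balanced :: "real \<Rightarrow> (bool \<times> bool) list \<Rightarrow> bool" where
  "balanced d w \<longleftrightarrow> (\<forall>t\<le>length w. \<forall>\<psi>\<in>{chi_x, chi_y, chi_xy}. \<bar>\<Sum>i<t. \<psi> (w ! i)\<bar> \<le> d)"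

text \<open>Each nontrivial character satisfies the Poisson equation without subtracting a mean,
  that is, it averages to zero in the stationary law of the chain; this is the equidistribution of
  the four corners.\<close>

lemma card_chi_deviation:
  assumes "\<psi> \<in> {chi_x, chi_y, chi_xy}" "0 < z" "2 * z \<le> 1" "t \<le> n"
  shows "real (card {w \<in> words n (False, False). d < \<bar>\<Sum>i<t. \<psi> (w ! i)\<bar>})
     \<le> 4 * exp 1 * growth ^ n * exp (4 * z\<^sup>2 * n - z * d)"
proof -
  \<comment> \<open>Solved from the Poisson equation. After a left letter nothing is forbidden and
    the weighted sum vanishes, so \<open>g l = 0\<close>. After a right letter the missing term
    leaves growth * g l = - sqrt 2 * \<psi>(opposite l), and (2 + sqrt 2) * (sqrt 2 - 1) = sqrt
    2.\<close>
  define g where "g l = (if fst l then if snd l \<or> \<psi> = chi_x then 1 - sqrt 2 else sqrt 2 - 1 else 0)" for l :: "bool \<times> bool"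
  have "sqrt 2 < 3 / 2" by (rule real_less_lsqrt) (simp_all add: power2_eq_square)
  then have s: "1 < sqrt 2" "sqrt 2 < 3 / 2" by simp_all
  have ne: "chi_y \<noteq> chi_x" "chi_xy \<noteq> chi_x"
    by (auto simp: fun_eq_iff chi_x_def chi_y_def chi_xy_def)
  have "poisson_pair \<psi> g" unfolding poisson_pair_def
  proof (intro conjI allI)
    show "(\<Sum>l'\<in>{l'. allowed l l'}. perron l' * (\<psi> l' + g l')) = growth * perron l * g l" for l
      using assms(1) ne unfolding sum_allowed
      by (cases l) (auto simp: g_def perron_def chi_x_def chi_y_def chi_xy_def opposite_def algebra_simps)
    show "\<bar>\<psi> l' + g l' - g l\<bar> \<le> 2" for l l'
    proof -
      have "\<bar>1 - 2 * sqrt 2\<bar> \<le> 2" "\<bar>2 * sqrt 2 - 1\<bar> \<le> 2" "1 \<le> 2 * sqrt 2" using s by linarith+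
      then show ?thesis using assms(1) ne s(2)
        by (cases l; cases l') (auto simp: g_def chi_x_def chi_y_def chi_xy_def)
    qed
    show "\<bar>g l\<bar> \<le> 1" for l using s by (auto simp: g_def)
  qed
  then show ?thesis using assms by (intro card_deviation_bound[where g = g]) (auto simp: g_def)
qed

text \<open>The factor 12 (n + 1) is a union bound over n + 1 prefix lengths and three characters,
  each with constant 4.\<close>

lemma card_unbalanced:
  assumes "0 < z" "2 * z \<le> 1"
  shows "real (card {w \<in> words n (False, False). \<not> balanced d w})
     \<le> 12 * exp 1 * (n + 1) * growth ^ n * exp (4 * z\<^sup>2 * n - z * d)"
proof -
  let ?B = "\<lambda>t \<psi>. {w \<in> words n (False, False). d < \<bar>\<Sum>i<t. (\<psi> :: bool \<times> bool \<Rightarrow> real) (w ! i)\<bar>}"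
  let ?X = "{chi_x, chi_y, chi_xy}"
  have "{w \<in> words n (False, False). \<not> balanced d w} \<subseteq> (\<Union>(t, \<psi>)\<in>{..n} \<times> ?X. ?B t \<psi>)"
    by (auto simp: balanced_def words_def not_le)
  then have "card {w \<in> words n (False, False). \<not> balanced d w} \<le> card (\<Union>(t, \<psi>)\<in>{..n} \<times> ?X. ?B t \<psi>)"
    by (intro card_mono) auto
  also have "\<dots> \<le> (\<Sum>(t, \<psi>)\<in>{..n} \<times> ?X. card (?B t \<psi>))"
    using card_UN_le[of "{..n} \<times> ?X" "\<lambda>(t, \<psi>). ?B t \<psi>"] by (simp add: case_prod_beta)
  finally have "real (card {w \<in> words n (False, False). \<not> balanced d w}) \<le> (\<Sum>(t, \<psi>)\<in>{..n} \<times> ?X. real (card (?B t \<psi>)))"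
    by (simp add: case_prod_beta flip: of_nat_sum)
  also have "\<dots> \<le> (\<Sum>(t, \<psi>)\<in>{..n} \<times> ?X. 4 * exp 1 * growth ^ n * exp (4 * z\<^sup>2 * n - z * d))"
    using card_chi_deviation[OF _ assms] by (intro sum_mono) auto
  also have "\<dots> = real (card ({..n} \<times> ?X)) * (4 * exp 1 * growth ^ n * exp (4 * z\<^sup>2 * n - z * d))"
    by (simp add: case_prod_beta)
  also have "\<dots> \<le> real (3 * (n + 1)) * (4 * exp 1 * growth ^ n * exp (4 * z\<^sup>2 * n - z * d))"
  proof (intro mult_right_mono)
    have "card ?X \<le> 3" by (simp add: card_insert_if)
    then have "card {..n} * card ?X \<le> (n + 1) * 3" by (intro mult_mono) auto
    then show "real (card ({..n} \<times> ?X)) \<le> real (3 * (n + 1))"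
      unfolding card_cartesian_product by (simp only: of_nat_le_iff mult.commute)
  qed auto
  finally show ?thesis by (simp add: algebra_simps)
qed

text \<open>Any balanced word coding the permutation will do, canonical or not, since the geometric
  estimates hold for every coding word.\<close>

definition balanced_perms :: "real \<Rightarrow> nat list set" where
  "balanced_perms d = {perm_of w |w. balanced d w}"

text \<open>A permutation outside \<open>balanced_perms d\<close> has in particular an unbalanced
  canonical word, so the unbalanced canonical words map onto a set containing all these
  permutations.\<close>

lemma card_unbalanced_X:
  assumes "0 < z" "2 * z \<le> 1"
  shows "real (card (of_size X_class n - balanced_perms d))
     \<le> 12 * exp 1 * (n + 1) * growth ^ n * exp (4 * z\<^sup>2 * n - z * d)"
proof -
  have "of_size X_class n - balanced_perms d \<subseteq> perm_of ` {w \<in> words n (False, False). \<not> balanced d w}"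
  proof
    fix \<sigma> assume s: "\<sigma> \<in> of_size X_class n - balanced_perms d"
    then obtain w where w: "perm_of w = \<sigma>" "successively allowed w"
      using ex_canonical_word[of \<sigma>] by (auto simp: of_size_def)
    have "length w = n" using s w(1) by (auto simp: of_size_def)
    moreover have "successively allowed ((False, False) # w)"
      using w(2) by (auto simp: successively_Cons allowed_def)
    moreover have "\<not> balanced d w" using s w(1) by (auto simp: balanced_perms_def)
    ultimately show "\<sigma> \<in> perm_of ` {w \<in> words n (False, False). \<not> balanced d w}"
      using w(1) by (auto simp: words_def)
  qed
  then have "card (of_size X_class n - balanced_perms d) \<le> card {w \<in> words n (False, False). \<not> balanced d w}"
    by (rule surj_card_le[rotated]) simp
  then show ?thesis using card_unbalanced[OF assms, of n d] by linarith
qed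


section \<open>The class XX\<close>

text \<open>A direct sum of two elements of the X-class that is not itself in the X-class splits uniquely
  if the increasing run between the two nontrivial blocks is attributed to the second summand.\<close>

definition left_part :: "nat \<Rightarrow> nat list set" where
  "left_part k = {\<sigma> \<in> of_size X_class k. \<not> corner (True, True) \<sigma>}"

definition right_part :: "nat \<Rightarrow> nat list set" where
  "right_part k = {\<sigma> \<in> of_size X_class k. \<not> sorted \<sigma>}"

lemma length_direct_sum [simp]: "length (direct_sum \<sigma> \<tau>) = length \<sigma> + length \<tau>"
  by (simp add: direct_sum_def)

text \<open>A point lying between the two blocks may be attributed to either summand. This is the
  ambiguity that the condition in \<open>left_part\<close> removes.\<close>

lemma direct_sum_ins: "direct_sum (ins (True, True) \<sigma>) \<tau> = direct_sum \<sigma> (ins (False, False) \<tau>)"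
  by (simp add: direct_sum_def ins_def comp_def)

lemma direct_sum_perms:
  assumes "\<sigma> \<in> perms" "\<tau> \<in> perms" shows "direct_sum \<sigma> \<tau> \<in> perms"
proof -
  have s: "distinct \<sigma>" "set \<sigma> = {1..length \<sigma>}" "distinct \<tau>" "set \<tau> = {1..length \<tau>}"
    using assms by (auto simp: perms_iff)
  have "(\<lambda>i. i + length \<sigma>) ` {1..length \<tau>} = {length \<sigma> + 1..length \<sigma> + length \<tau>}"
    using image_add_atLeastAtMost[of "length \<sigma>" 1 "length \<tau>"] by (simp add: add.commute)
  moreover have "{1..length \<sigma>} \<union> {length \<sigma> + 1..length \<sigma> + length \<tau>} = {1..length \<sigma> + length \<tau>}" by auto
  ultimately show ?thesis
    using assms(1) s by (auto simp: perms_iff direct_sum_def distinct_map)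
qed

lemma sorted_perm: "\<sigma> \<in> perms \<Longrightarrow> sorted \<sigma> \<longleftrightarrow> \<sigma> = [1..<Suc (length \<sigma>)]"
proof
  assume s: "\<sigma> \<in> perms" "sorted \<sigma>"
  show "\<sigma> = [1..<Suc (length \<sigma>)]"
  proof (rule sorted_distinct_set_unique)
    show "set \<sigma> = set [1..<Suc (length \<sigma>)]" "distinct \<sigma>"
      using s(1) unfolding perms_iff set_upt atLeastLessThanSuc_atLeastAtMost by auto
  qed (use s in \<open>simp_all only: sorted_upt distinct_upt\<close>)
next
  assume "\<sigma> = [1..<Suc (length \<sigma>)]" then show "sorted \<sigma>" by (metis sorted_upt)
qed

lemma X_class_direct_sum_increasing:
  assumes "\<sigma> = [] \<or> \<sigma> \<in> X_class"
  shows "direct_sum \<sigma> [1..<Suc m] = [] \<or> direct_sum \<sigma> [1..<Suc m] \<in> X_class"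
proof (induction m)
  case 0
  then show ?case using assms by (simp add: direct_sum_def)
next
  case (Suc m)
  have "direct_sum \<sigma> [1..<Suc (Suc m)] = ins (True, True) (direct_sum \<sigma> [1..<Suc m])"
    by (simp add: direct_sum_def ins_def)
  then show ?case using Suc X_class_ins by metis
qed

text \<open>Points at the top right corner of \<open>\<sigma>\<close> are moved one by one to
  \<open>\<tau>\<close> by \<open>direct_sum_ins\<close>, whence the induction on the length and the
  possibly empty \<open>\<sigma>\<close>. If none is left and \<open>\<tau>\<close> is increasing,
  the whole sum arises from \<open>\<sigma>\<close> by insertions at the top right corner and so
  belongs to X.\<close>

lemma direct_sum_cases:
  assumes "\<sigma> = [] \<or> \<sigma> \<in> X_class" "\<tau> \<in> X_class"
  shows "direct_sum \<sigma> \<tau> \<in> X_class \<or> (\<exists>\<sigma>'\<in>X_class. \<exists>\<tau>'\<in>X_class. \<not> corner (True, True) \<sigma>' \<and> \<not> sorted \<tau>'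
     \<and> direct_sum \<sigma> \<tau> = direct_sum \<sigma>' \<tau>')"
  using assms
proof (induction "length \<sigma>" arbitrary: \<sigma> \<tau>)
  case 0
  then show ?case by (simp add: direct_sum_def)
next
  case (Suc n)
  then have \<sigma>: "\<sigma> \<in> X_class" by auto
  show ?case
  proof (cases "corner (True, True) \<sigma>")
    case True
    obtain \<rho> where \<rho>: "\<rho> = [] \<or> \<rho> \<in> X_class" "length \<rho> = n" "\<sigma> = ins (True, True) \<rho>"
    proof (cases n)
      case 0
      then have "\<sigma> \<in> of_size X_class 1" using Suc(2) \<sigma> by (simp add: of_size_def)
      then have "\<sigma> = ins (True, True) []" unfolding of_size_X_1 by (simp add: ins_def)
      then show ?thesis using that 0 by simp
    next
      case (Suc m)
      then show ?thesis using X_class_uncorner[OF \<sigma> _ _ True, of n] \<open>Suc n = length \<sigma>\<close> that by auto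
    qed
    then show ?thesis
      unfolding \<rho>(3) direct_sum_ins using X_class_ins[of \<tau>] Suc.prems by (intro Suc.hyps) auto
  next
    case False
    show ?thesis
    proof (cases "sorted \<tau>")
      case True
      then have "\<tau> = [1..<Suc (length \<tau>)]" using Suc.prems X_class_perms sorted_perm by blast
      then show ?thesis using X_class_direct_sum_increasing[of \<sigma> "length \<tau>"] \<sigma> X_class_perms[OF \<sigma>]
        by (metis direct_sum_def Nil_is_append_conv perms_iff)
    next
      case F: False
      then show ?thesis using False \<sigma> Suc.prems(2) by blast
    qed
  qed
qed

section \<open>Decomposition of the elements of the class and its uniqueness\<close>

lemma initial_interval:
  fixes A B :: "nat set"
  assumes "A \<union> B = {1..n}" "\<And>x y. x \<in> A \<Longrightarrow> y \<in> B \<Longrightarrow> x < y"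
  shows "A = {1..card A}"
proof (cases "A = {}")
  case False
  have fin: "finite A" using assms(1) by (metis finite_Un finite_atLeastAtMost)
  have "A = {1..Max A}"
  proof
    show "A \<subseteq> {1..Max A}" using fin assms(1) by auto
    show "{1..Max A} \<subseteq> A"
    proof
      fix x assume x: "x \<in> {1..Max A}"
      have m: "Max A \<in> A" using fin False by simp
      then have "Max A \<le> n" using assms(1) by auto
      then have "x \<in> A \<union> B" using assms(1) x by auto
      moreover have "x \<notin> B" using assms(2)[OF m, of x] x by auto
      ultimately show "x \<in> A" by blast
    qed
  qed
  then show ?thesis by (metis card_atLeastAtMost diff_Suc_1)
qed simp

text \<open>An occurrence in \<open>direct_sum \<sigma> \<tau>\<close> is cut where it passes from
  \<open>\<sigma>\<close> to \<open>\<tau>\<close>. All values of the first piece lie below those of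
  the second, so the pieces fill an initial and a final interval of values, and each nonempty one
  is, up to a shift, a pattern of an element of X.\<close>

lemma XX_class_split:
  assumes "\<pi> \<in> XX_class"
  shows "\<exists>\<sigma> \<tau>. (\<sigma> = [] \<or> \<sigma> \<in> X_class) \<and> \<tau> \<in> X_class \<and> \<pi> = direct_sum \<sigma> \<tau>"
proof -
  obtain \<sigma> \<tau> where X: "\<sigma> \<in> X_class" "\<tau> \<in> X_class" and p: "is_pattern \<pi> (direct_sum \<sigma> \<tau>)"
    and \<pi>: "\<pi> \<in> perms" using assms by (auto simp: XX_class_def down_closure_def)
  let ?\<tau>' = "map (\<lambda>i. i + length \<sigma>) \<tau>"
  obtain \<rho> where \<rho>: "subseq \<rho> (\<sigma> @ ?\<tau>')" "order_iso \<rho> \<pi>"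
    using p unfolding direct_sum_def is_pattern_iff by blast
  obtain a b where ab: "\<rho> = a @ b" "subseq a \<sigma>" "subseq b ?\<tau>'"
    using \<rho>(1) subseq_append_iff by blast
  let ?p = "length a"
  let ?u = "take ?p \<pi>" and ?v = "drop ?p \<pi>"
  have len: "length \<rho> = length \<pi>" using \<rho>(2) order_iso_length by blast
  have iso: "order_iso a ?u" "order_iso b ?v"
    using order_iso_append[of a b ?u ?v] \<rho>(2) ab(1) len by auto
  have less: "x < y" if xy: "x \<in> set ?u" "y \<in> set ?v" for x y
  proof -
    obtain i where i: "i < ?p" "x = \<pi> ! i" using xy(1) len ab(1) by (auto simp: in_set_conv_nth)
    have "length ?v = length b" using len ab(1) by auto
    then obtain j where j: "j < length b" "y = \<pi> ! (?p + j)"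
      using xy(2) len ab(1) by (metis add.commute in_set_conv_nth le_add2 length_append nth_drop)
    have "a ! i \<in> set \<sigma>" using i(1) ab(2) by (metis nth_mem in_set_nthsD subseq_conv_nths)
    moreover have "b ! j \<in> set ?\<tau>'" using j(1) ab(3) by (metis nth_mem in_set_nthsD subseq_conv_nths)
    ultimately have "a ! i < b ! j" using X X_class_perms by (force simp: perms_iff)
    then have "\<rho> ! i < \<rho> ! (?p + j)" using i j by (simp add: ab(1) nth_append)
    moreover have "i < length \<pi>" "?p + j < length \<pi>" using i(1) j(1) len ab(1) by auto
    ultimately show ?thesis using \<rho>(2) unfolding order_iso_nth i(2) j(2) by blast
  qed
  have d: "distinct \<pi>" "set \<pi> = {1..length \<pi>}" using \<pi> by (auto simp: perms_iff)
  have un: "set ?u \<union> set ?v = {1..length \<pi>}" using d by (metis append_take_drop_id set_append)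
  have pl: "?p \<le> length \<pi>" using len ab(1) by auto
  have "set ?u = {1..card (set ?u)}" by (rule initial_interval[OF un less])
  moreover have "card (set ?u) = ?p" using d(1) pl by (simp add: distinct_card)
  ultimately have su: "set ?u = {1..?p}" by simp
  moreover have "set ?u \<inter> set ?v = {}" using less by blast
  ultimately have "set ?v = {1..length \<pi>} - {1..?p}" using un by blast
  moreover have "{1..length \<pi>} - {1..?p} = {Suc ?p..length \<pi>}" by auto
  ultimately have sv: "set ?v = {Suc ?p..length \<pi>}" by (rule trans)
  define v where "v = map (\<lambda>i. i - ?p) ?v"
  have vv: "?v = map (\<lambda>i. i + ?p) v"
  proof -
    have "map (\<lambda>i. i - ?p + ?p) ?v = ?v" by (rule map_idI) (simp add: sv)
    then show ?thesis by (simp add: v_def comp_def)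
  qed
  have lu: "length ?u = ?p" using pl by simp
  have dec: "\<pi> = direct_sum ?u v"
    unfolding direct_sum_def lu vv[symmetric] by simp
  have isov: "order_iso ?v v" unfolding vv by (rule order_iso_map) (simp add: strict_mono_def)
  have uX: "?u = [] \<or> ?u \<in> X_class"
  proof (cases "?u = []")
    case False
    have "?u \<in> perms" using False d(1) su lu by (simp add: perms_iff)
    moreover have "is_pattern ?u \<sigma>" using iso(1) ab(2) is_pattern_iff by blast
    ultimately show ?thesis using X_class_pattern X(1) by blast
  qed simp
  have vX: "v = [] \<or> v \<in> X_class"
  proof (cases "v = []")
    case False
    have "length v = length \<pi> - ?p" by (simp add: v_def)
    moreover have "set v = (\<lambda>i. i - ?p) ` {Suc ?p..length \<pi>}" unfolding v_def using sv by simp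
    then have "set v = {1..length \<pi> - ?p}"
    proof -
      have e: "{Suc ?p..length \<pi>} = (\<lambda>i. i + ?p) ` {1..length \<pi> - ?p}"
        unfolding image_add_atLeastAtMost' using pl by simp
      show ?thesis using \<open>set v = _\<close> unfolding e image_image by simp
    qed
    moreover have "distinct v" using d(1) vv by (metis distinct_drop distinct_map)
    ultimately have "v \<in> perms" using False by (simp add: perms_iff)
    moreover have "is_pattern v ?\<tau>'" using order_iso_trans[OF iso(2) isov] ab(3) is_pattern_iff by blast
    moreover have "order_iso ?\<tau>' \<tau>" by (rule order_iso_map) (simp add: strict_mono_def)
    then have "is_pattern ?\<tau>' \<tau>" unfolding is_pattern_iff using order_iso_sym by blast
    ultimately show ?thesis using X_class_pattern X(2) is_pattern_trans by blast
  qed simp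
  show ?thesis
  proof (cases "v = []")
    case True
    then have "\<pi> = ?u" using dec by (simp add: direct_sum_def)
    moreover have "\<pi> \<noteq> []" using \<pi> by (simp add: perms_iff)
    ultimately have "\<pi> \<in> X_class" using uX by metis
    \<comment> \<open>If nothing falls into the second block, all of \<open>\<pi>\<close> is
      declared to be the second summand, so that only the first one can be empty.\<close>
    moreover have "\<pi> = direct_sum [] \<pi>" by (simp add: direct_sum_def)
    ultimately show ?thesis by blast
  next
    case False then show ?thesis using uX vX dec by blast
  qed
qed

lemma XX_class_perms: "XX_class \<subseteq> perms"
  by (auto simp: XX_class_def down_closure_def)

lemma direct_sum_XX:
  assumes "\<sigma> \<in> X_class" "\<tau> \<in> X_class" shows "direct_sum \<sigma> \<tau> \<in> XX_class"
proof -
  have "is_pattern \<pi> \<pi>" for \<pi> using order_iso_refl is_pattern_iff by blast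
  then show ?thesis unfolding XX_class_def down_closure_def
    using assms direct_sum_perms X_class_perms by blast
qed

text \<open>The extreme values \<open>k = 0\<close> and \<open>k = n\<close> contribute nothing,
  there being no permutations of size 0; including them makes the sum over \<open>k\<close> a plain
  convolution.\<close>

definition genuine_sums :: "nat \<Rightarrow> nat list set" where
  "genuine_sums n = (\<Union>k\<in>{..n}. (\<lambda>(\<sigma>, \<tau>). direct_sum \<sigma> \<tau>) ` (left_part k \<times> right_part (n - k)))"

lemma XX_class_eq:
  "genuine_sums n \<subseteq> of_size XX_class n" "of_size XX_class n - genuine_sums n \<subseteq> of_size X_class n"
proof -
  show "genuine_sums n \<subseteq> of_size XX_class n"
    using direct_sum_XX by (auto simp: genuine_sums_def left_part_def right_part_def of_size_def)
  show "of_size XX_class n - genuine_sums n \<subseteq> of_size X_class n"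
  proof
    fix \<pi> assume a: "\<pi> \<in> of_size XX_class n - genuine_sums n"
    then obtain \<sigma> \<tau> where st: "\<sigma> = [] \<or> \<sigma> \<in> X_class" "\<tau> \<in> X_class" "\<pi> = direct_sum \<sigma> \<tau>"
      using XX_class_split by (force simp: of_size_def)
    show "\<pi> \<in> of_size X_class n"
    proof (rule ccontr)
      assume "\<pi> \<notin> of_size X_class n"
      then have "direct_sum \<sigma> \<tau> \<notin> X_class" using a st by (auto simp: of_size_def)
      then obtain \<sigma>' \<tau>' where *: "\<sigma>' \<in> X_class" "\<tau>' \<in> X_class" "\<not> corner (True, True) \<sigma>'" "\<not> sorted \<tau>'"
        "\<pi> = direct_sum \<sigma>' \<tau>'" using direct_sum_cases[OF st(1,2)] st(3) by blast
      moreover have "n = length \<sigma>' + length \<tau>'" using a * by (auto simp: of_size_def)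
      ultimately have "\<pi> \<in> genuine_sums n" unfolding genuine_sums_def left_part_def right_part_def
        by (intro UN_I[of "length \<sigma>'"]) (auto simp: of_size_def)
      then show False using a by blast
    qed
  qed
qed

lemma not_sorted_subseq:
  assumes "\<not> sorted (xs :: nat list)" obtains a b where "subseq [a, b] xs" "b < a"
proof -
  obtain i j where ij: "i < j" "j < length xs" "xs ! j < xs ! i"
    using assms by (metis linorder_not_le sorted_iff_nth_mono_less)
  have "xs = take j xs @ drop j xs" by simp
  moreover have "xs ! i \<in> set (take j xs)" using ij by (metis in_set_conv_nth length_take min.absorb4 nth_take)
  moreover have "xs ! j \<in> set (drop j xs)" using ij by (metis Cons_nth_drop_Suc list.set_intros(1))
  ultimately have "subseq ([xs ! i] @ [xs ! j]) xs"
    by (metis list_emb_append_mono subseq_singleton_left)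
  then show ?thesis using that ij by simp
qed

text \<open>If \<open>k < k'\<close>, then \<open>\<sigma>'\<close> is \<open>\<sigma>\<close>
  followed by a shifted initial piece \<open>\<rho>\<close> of \<open>\<tau>\<close>. A descent in
  \<open>\<rho>\<close> together with one coming from \<open>\<tau>'\<close>, which is not
  increasing, would form 2143 inside \<open>\<tau>\<close>. So \<open>\<rho>\<close> is increasing
  and \<open>\<sigma>'\<close> ends with its maximum, which \<open>left_part\<close>
  excludes.\<close>

lemma direct_sum_unique_aux:
  assumes s: "\<sigma> \<in> left_part k" "\<sigma>' \<in> left_part k'" "\<tau> \<in> right_part j" "\<tau>' \<in> right_part j'"
    and eq: "direct_sum \<sigma> \<tau> = direct_sum \<sigma>' \<tau>'"
  shows "\<not> k < k'"
proof
  assume "k < k'"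
  have len: "length \<sigma> = k" "length \<sigma>' = k'" using s by (auto simp: left_part_def of_size_def)
  define \<rho> where "\<rho> = take (k' - k) \<tau>"
  define \<upsilon> where "\<upsilon> = drop (k' - k) \<tau>"
  have X: "\<sigma>' \<in> X_class" "\<tau> \<in> X_class" using s by (auto simp: left_part_def right_part_def of_size_def)
  have "take k' (direct_sum \<sigma> \<tau>) = \<sigma> @ map (\<lambda>i. i + k) \<rho>"
    using \<open>k < k'\<close> len by (simp add: direct_sum_def \<rho>_def take_map)
  then have \<sigma>': "\<sigma>' = \<sigma> @ map (\<lambda>i. i + k) \<rho>" unfolding eq using len by (simp add: direct_sum_def)
  have "drop k' (direct_sum \<sigma> \<tau>) = map (\<lambda>i. i + k) \<upsilon>"
    using \<open>k < k'\<close> len by (simp add: direct_sum_def \<upsilon>_def drop_map)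
  then have \<tau>': "map (\<lambda>i. i + k') \<tau>' = map (\<lambda>i. i + k) \<upsilon>" unfolding eq using len by (simp add: direct_sum_def)
  have split: "\<tau> = \<rho> @ \<upsilon>" by (simp add: \<rho>_def \<upsilon>_def)
  have lr: "length \<rho> = k' - k" using \<sigma>' len by (metis add_diff_cancel_left' length_append length_map)
  have "sorted \<rho>"
  proof (rule ccontr)
    assume "\<not> sorted \<rho>"
    then obtain a b where ab: "subseq [a, b] \<rho>" "b < a" by (rule not_sorted_subseq)
    have "\<not> sorted \<tau>'" using s by (simp add: right_part_def)
    then obtain c d where cd: "subseq [c, d] \<tau>'" "d < c" by (rule not_sorted_subseq)
    have "subseq (map (\<lambda>i. i + k') [c, d]) (map (\<lambda>i. i + k) \<upsilon>)"
      unfolding \<tau>'[symmetric] using cd(1) by (rule subseq_map)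
    then obtain I where "map (\<lambda>i. i + k') [c, d] = map (\<lambda>i. i + k) (nths \<upsilon> I)"
      by (metis subseq_conv_nths nths_map)
    then obtain c' d' where "nths \<upsilon> I = [c', d']" and cd'': "c' + k = c + k'" "d' + k = d + k'"
      by (auto simp: Cons_eq_map_conv)
    then have cd': "subseq [c', d'] \<upsilon>" "c' + k = c + k'" "d' + k = d + k'"
      by (metis subseq_conv_nths)+
    have "a \<in> set \<rho>" "d \<in> set \<tau>'" using ab(1) cd(1)
      by (metis list.set_intros subseq_conv_nths in_set_nthsD)+
    moreover have "set \<sigma>' = {1..k'}" "set \<tau>' = {1..length \<tau>'}"
      using X_class_perms s len by (auto simp: perms_iff left_part_def right_part_def of_size_def)
    ultimately have "a + k \<le> k'" "1 \<le> d" using \<sigma>' by auto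
    then have "a < d'" "d' < c'" using cd' cd(2) by auto
    moreover have "subseq [a, b, c', d'] \<tau>"
      using list_emb_append_mono[OF ab(1) cd'(1)] split by simp
    ultimately have "is_pattern [2,1,4,3] \<tau>" using ab(2)
      by (intro is_pattern_order_iso[of "[a, b, c', d']"]) (auto simp: order_iso_def)
    then show False using X(2) by (auto simp: X_class_def Av_def)
  qed
  have "\<rho> \<noteq> []" using lr \<open>k < k'\<close> by auto
  then have last: "last \<sigma>' = last \<rho> + k" using \<sigma>' by (simp add: last_map)
  have sets: "set \<sigma>' = {1..k'}" "set \<sigma> = {1..k}"
    using X_class_perms s len by (auto simp: perms_iff left_part_def of_size_def)
  then have "k' \<in> set \<sigma>'" "k' \<notin> set \<sigma>" using \<open>k < k'\<close> by auto
  then obtain x where "x \<in> set \<rho>" "k' = x + k" using \<sigma>' by auto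
  moreover have "x \<le> last \<rho>" if "x \<in> set \<rho>" for x
    using \<open>sorted \<rho>\<close> that by (induction \<rho>) auto
  moreover have "last \<sigma>' \<le> k'" using sets(1) \<sigma>' \<open>\<rho> \<noteq> []\<close> last_in_set[of \<sigma>'] by auto
  ultimately have "last \<sigma>' = k'" using last by fastforce
  then have "corner (True, True) \<sigma>'" using len by (simp add: corner_def)
  then show False using s(2) by (simp add: left_part_def)
qed

lemma direct_sum_unique:
  assumes "\<sigma> \<in> left_part k" "\<sigma>' \<in> left_part k'" "\<tau> \<in> right_part j" "\<tau>' \<in> right_part j'"
    and "direct_sum \<sigma> \<tau> = direct_sum \<sigma>' \<tau>'"
  shows "k = k'" "\<sigma> = \<sigma>'" "\<tau> = \<tau>'"
proof -
  show k: "k = k'" using direct_sum_unique_aux assms by (metis linorder_neqE_nat)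
  then have "length \<sigma> = length \<sigma>'" using assms by (auto simp: left_part_def of_size_def)
  then show "\<sigma> = \<sigma>'" "\<tau> = \<tau>'" using assms(5)
    by (auto simp: direct_sum_def dest: map_injective intro: injI)
qed

lemma finite_parts [simp]: "finite (left_part k)" "finite (right_part k)"
  by (auto simp: left_part_def right_part_def)

lemma sum_genuine_sums:
  fixes f :: "nat list \<Rightarrow> real"
  shows "(\<Sum>\<pi>\<in>genuine_sums n. f \<pi>) = (\<Sum>k\<le>n. \<Sum>\<sigma>\<in>left_part k. \<Sum>\<tau>\<in>right_part (n - k). f (direct_sum \<sigma> \<tau>))"
proof -
  have "(\<Sum>\<pi>\<in>genuine_sums n. f \<pi>) =
      (\<Sum>k\<le>n. \<Sum>\<pi>\<in>(\<lambda>(\<sigma>, \<tau>). direct_sum \<sigma> \<tau>) ` (left_part k \<times> right_part (n - k)). f \<pi>)"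
    unfolding genuine_sums_def
    by (intro sum.UNION_disjoint) (auto dest: direct_sum_unique(1))
  also have "\<dots> = (\<Sum>k\<le>n. \<Sum>(\<sigma>, \<tau>)\<in>left_part k \<times> right_part (n - k). f (direct_sum \<sigma> \<tau>))"
    by (intro sum.cong refl, subst sum.reindex)
       (auto simp: inj_on_def case_prod_beta dest: direct_sum_unique(2,3))
  also have "\<dots> = (\<Sum>k\<le>n. \<Sum>\<sigma>\<in>left_part k. \<Sum>\<tau>\<in>right_part (n - k). f (direct_sum \<sigma> \<tau>))"
    by (simp add: sum.cartesian_product)
  finally show ?thesis .
qed

section \<open>Cardinalities of the two families of summands\<close>

lemma card_right_part: "n \<ge> 1 \<Longrightarrow> card (right_part n) = card (of_size X_class n) - 1"
proof -
  assume n: "n \<ge> 1"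
  have "[1..<Suc n] \<in> X_class"
    using X_class_direct_sum_increasing[of "[]" n] n
    by (simp only: direct_sum_def append_Nil list.size(3) add_0_right map_ident upt_eq_Nil_conv) simp
  then have "{\<sigma> \<in> of_size X_class n. sorted \<sigma>} = {[1..<Suc n]}"
    using sorted_perm X_class_perms by (auto simp: of_size_def simp del: upt_Suc)
  moreover have "right_part n = of_size X_class n - {\<sigma> \<in> of_size X_class n. sorted \<sigma>}"
    by (auto simp: right_part_def)
  ultimately show ?thesis by (metis (no_types, lifting) card_Diff_singleton insertI1 mem_Collect_eq)
qed

lemma card_left_part: "n \<ge> 1 \<Longrightarrow> card (left_part (Suc n)) = card (of_size X_class (Suc n)) - card (of_size X_class n)"
proof -
  assume n: "n \<ge> 1"
  have "left_part (Suc n) = of_size X_class (Suc n) - {\<sigma> \<in> of_size X_class (Suc n). corner (True, True) \<sigma>}"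
    by (auto simp: left_part_def)
  then show ?thesis using card_corner_X[OF n, of "(True, True)"] by (simp add: card_Diff_subset)
qed


section \<open>The space of permutons\<close>

lemma space_permuton: "\<mu> \<in> permutons \<Longrightarrow> space \<mu> = unit_square"
  using sets_eq_imp_space_eq[of \<mu> square_borel] by (auto simp: permutons_def space_restrict_space)

lemma integrable_permuton:
  fixes f :: "real \<times> real \<Rightarrow> real"
  assumes \<mu>: "\<mu> \<in> permutons" and f: "continuous_on unit_square f" shows "integrable \<mu> f"
proof -
  interpret prob_space \<mu> using \<mu> by (simp add: permutons_def)
  have "sets \<mu> = sets square_borel" using \<mu> by (simp add: permutons_def)
  then have m: "f \<in> borel_measurable \<mu>"
    using borel_measurable_continuous_on_restrict[OF f] by (simp cong: measurable_cong_sets)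
  have "compact (f ` unit_square)" by (intro compact_continuous_image f compact_Times) auto
  then obtain B where "\<forall>x\<in>f ` unit_square. norm x \<le> B"
    using compact_imp_bounded bounded_iff by blast
  then have "\<And>z. z \<in> unit_square \<Longrightarrow> \<bar>f z\<bar> \<le> B" unfolding real_norm_def by blast
  then show ?thesis using space_permuton[OF \<mu>] m by (intro integrable_const_bound[of f B]) auto
qed

lemma integral_permuton_diff_le:
  fixes f g :: "real \<times> real \<Rightarrow> real"
  assumes \<mu>: "\<mu> \<in> permutons" and c: "continuous_on unit_square f" "continuous_on unit_square g"
    and e: "\<And>z. z \<in> unit_square \<Longrightarrow> \<bar>f z - g z\<bar> \<le> e"
  shows "\<bar>(\<integral>z. f z \<partial>\<mu>) - (\<integral>z. g z \<partial>\<mu>)\<bar> \<le> e"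
proof -
  interpret prob_space \<mu> using \<mu> by (simp add: permutons_def)
  have i: "integrable \<mu> f" "integrable \<mu> g" using integrable_permuton \<mu> c by auto
  have "\<bar>(\<integral>z. f z \<partial>\<mu>) - (\<integral>z. g z \<partial>\<mu>)\<bar> = \<bar>\<integral>z. f z - g z \<partial>\<mu>\<bar>" using i by simp
  also have "\<dots> \<le> (\<integral>z. \<bar>f z - g z\<bar> \<partial>\<mu>)" by (rule integral_abs_bound)
  also have "\<dots> \<le> (\<integral>z. e \<partial>\<mu>)" using i space_permuton[OF \<mu>] e by (intro integral_mono) auto
  also have "\<dots> = e" by (simp add: prob_space)
  finally show ?thesis .
qed

section \<open>Lipschitz test functions\<close>

definition lipschitz_test :: "(real \<times> real \<Rightarrow> real) \<Rightarrow> bool" where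
  "lipschitz_test f \<longleftrightarrow> (\<exists>B L. \<forall>z z'. \<bar>f z\<bar> \<le> B \<and> \<bar>f z - f z'\<bar> \<le> L * dist z z')"

lemma lipschitz_test_continuous: "lipschitz_test f \<Longrightarrow> continuous_on A f"
proof -
  assume "lipschitz_test f"
  then obtain B L where L: "\<And>z z'. \<bar>f z - f z'\<bar> \<le> L * dist z z'" unfolding lipschitz_test_def by blast
  have "\<bar>L\<bar>-lipschitz_on A f"
  proof (rule lipschitz_onI)
    fix x y show "dist (f x) (f y) \<le> \<bar>L\<bar> * dist x y"
      using L[of x y] mult_right_mono[OF abs_ge_self[of L], of "dist x y"] by (simp add: dist_real_def)
  qed simp
  then show ?thesis by (rule lipschitz_on_continuous_on)
qed

text \<open>Bounds on the square only, which unlike global ones are available for polynomials and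
  stable under products; the signs of the constants are recorded for the product estimate.\<close>

definition square_lipschitz :: "(real \<times> real \<Rightarrow> real) \<Rightarrow> real \<Rightarrow> real \<Rightarrow> bool" where
  "square_lipschitz f B L \<longleftrightarrow> 0 \<le> B \<and> 0 \<le> L \<and>
     (\<forall>z\<in>unit_square. \<forall>z'\<in>unit_square. \<bar>f z\<bar> \<le> B \<and> \<bar>f z - f z'\<bar> \<le> L * dist z z')"

lemma polynomial_lipschitz_on_square:
  fixes f :: "real \<times> real \<Rightarrow> real"
  assumes "real_polynomial_function f"
  shows "\<exists>B L. square_lipschitz f B L"
  using assms
proof (induction rule: real_polynomial_function.induct)
  case (linear f)
  then obtain K where K: "K \<ge> 0" "\<And>z. \<bar>f z\<bar> \<le> norm z * K"
    using bounded_linear.nonneg_bounded[of f] by auto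
  have "\<bar>f z - f z'\<bar> \<le> K * dist z z'" for z z'
    using K(2)[of "z - z'"] linear by (simp add: dist_norm mult.commute linear_diff bounded_linear.linear)
  moreover have "\<bar>f z\<bar> \<le> 2 * K" if z: "z \<in> unit_square" for z
  proof -
    have "norm z \<le> 2" using z norm_Pair_le[of "fst z" "snd z"] by auto
    then show ?thesis using K mult_right_mono[of "norm z" 2 K] by (meson order_trans)
  qed
  ultimately have "square_lipschitz f (2 * K) K" using K(1) by (simp add: square_lipschitz_def)
  then show ?case by blast
next
  case (const c)
  have "square_lipschitz (\<lambda>z. c) \<bar>c\<bar> 0" by (simp add: square_lipschitz_def)
  then show ?case by blast
next
  case (add f g)
  obtain B1 L1 where f: "square_lipschitz f B1 L1" using add.IH(1) by blast
  obtain B2 L2 where g: "square_lipschitz g B2 L2" using add.IH(2) by blast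
  note fg = f[unfolded square_lipschitz_def] g[unfolded square_lipschitz_def]
  have "\<bar>f z + g z\<bar> \<le> B1 + B2 \<and> \<bar>(f z + g z) - (f z' + g z')\<bar> \<le> (L1 + L2) * dist z z'"
    if "z \<in> unit_square" "z' \<in> unit_square" for z z'
  proof -
    have "\<bar>f z\<bar> \<le> B1" "\<bar>f z - f z'\<bar> \<le> L1 * dist z z'" "\<bar>g z\<bar> \<le> B2" "\<bar>g z - g z'\<bar> \<le> L2 * dist z z'"
      using fg that by blast+
    then show ?thesis unfolding distrib_right by linarith
  qed
  then have "square_lipschitz (\<lambda>z. f z + g z) (B1 + B2) (L1 + L2)"
    using fg unfolding square_lipschitz_def by (intro conjI ballI add_nonneg_nonneg) blast+
  then show ?case by blast
next
  case (mult f g)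
  obtain B1 L1 where f: "square_lipschitz f B1 L1" using mult.IH(1) by blast
  obtain B2 L2 where g: "square_lipschitz g B2 L2" using mult.IH(2) by blast
  note fg = f[unfolded square_lipschitz_def] g[unfolded square_lipschitz_def]
  have "\<bar>f z * g z\<bar> \<le> B1 * B2 \<and> \<bar>f z * g z - f z' * g z'\<bar> \<le> (B1 * L2 + L1 * B2) * dist z z'"
    if z: "z \<in> unit_square" "z' \<in> unit_square" for z z'
  proof
    have b: "\<bar>f z\<bar> \<le> B1" "\<bar>f z - f z'\<bar> \<le> L1 * dist z z'" "\<bar>g z\<bar> \<le> B2" "\<bar>g z'\<bar> \<le> B2"
      "\<bar>g z - g z'\<bar> \<le> L2 * dist z z'" "0 \<le> B1" "0 \<le> L1" "0 \<le> L2"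
      using fg z by blast+
    show "\<bar>f z * g z\<bar> \<le> B1 * B2" unfolding abs_mult using b by (intro mult_mono) auto
    have "f z * g z - f z' * g z' = f z * (g z - g z') + (f z - f z') * g z'" by (simp add: algebra_simps)
    then have "\<bar>f z * g z - f z' * g z'\<bar> \<le> \<bar>f z\<bar> * \<bar>g z - g z'\<bar> + \<bar>f z - f z'\<bar> * \<bar>g z'\<bar>"
      by (metis abs_mult abs_triangle_ineq)
    also have "\<dots> \<le> B1 * (L2 * dist z z') + (L1 * dist z z') * B2"
      using b by (intro add_mono mult_mono) auto
    finally show "\<bar>f z * g z - f z' * g z'\<bar> \<le> (B1 * L2 + L1 * B2) * dist z z'" by (simp add: algebra_simps)
  qed
  then have "square_lipschitz (\<lambda>z. f z * g z) (B1 * B2) (B1 * L2 + L1 * B2)"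
    using fg unfolding square_lipschitz_def
    by (intro conjI ballI add_nonneg_nonneg mult_nonneg_nonneg) blast+
  then show ?case by blast
qed

text \<open>A polynomial close to \<open>f\<close> on the square is composed with
  \<open>clamp\<close>, the nearest point map of the square, which does not increase distances.
  Bounds on the square thus become bounds on the whole plane, and test functions can later be
  compared at points without checking that these lie in the square.\<close>

lemma ex_lipschitz_test_approx:
  fixes f :: "real \<times> real \<Rightarrow> real"
  assumes "continuous_on unit_square f" "e > 0"
  obtains g where "lipschitz_test g" "\<And>z. z \<in> unit_square \<Longrightarrow> \<bar>f z - g z\<bar> < e"
proof -
  have "compact unit_square" by (intro compact_Times) auto
  then obtain p where p: "real_polynomial_function p" "\<And>z. z \<in> unit_square \<Longrightarrow> \<bar>f z - p z\<bar> < e"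
    using Stone_Weierstrass_real_polynomial_function assms by metis
  obtain B L where BL: "L \<ge> 0" "\<And>z z'. z \<in> unit_square \<Longrightarrow> z' \<in> unit_square \<Longrightarrow> \<bar>p z\<bar> \<le> B \<and> \<bar>p z - p z'\<bar> \<le> L * dist z z'"
    using polynomial_lipschitz_on_square[OF p(1)] unfolding square_lipschitz_def by blast
  let ?a = "(0, 0) :: real \<times> real" and ?b = "(1, 1) :: real \<times> real"
  have box: "cbox ?a ?b = unit_square" by (simp add: cbox_Pair_eq)
  then have "cbox ?a ?b \<noteq> {}" by auto
  then have cl: "clamp ?a ?b z \<in> unit_square" for z
    unfolding box_ne_empty box[symmetric] by (intro clamp_in_interval) auto
  define g where "g = (\<lambda>z. p (clamp ?a ?b z))"
  have "\<bar>g z\<bar> \<le> B \<and> \<bar>g z - g z'\<bar> \<le> L * dist z z'" for z z'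
    using BL(2)[OF cl[of z] cl[of z']] mult_left_mono[OF dist_clamps_le_dist_args[of ?a ?b z z'] BL(1)]
    unfolding g_def by linarith
  then have "lipschitz_test g" unfolding lipschitz_test_def by blast
  moreover have "\<bar>f z - g z\<bar> < e" if "z \<in> unit_square" for z
    using p(2) that box by (simp add: g_def)
  ultimately show ?thesis using that by blast
qed

section \<open>Neighbourhoods in the weak topology\<close>

lemma topspace_permuton_topology: "topspace permuton_topology = permutons"
proof -
  have "permutons = {\<mu> \<in> permutons. (\<integral>z. (\<lambda>_. 0 :: real) z \<partial>\<mu>) \<in> UNIV}" by simp
  then have "permutons \<in> {{\<mu> \<in> permutons. (\<integral>z. f z \<partial>\<mu>) \<in> V} |(f :: real \<times> real \<Rightarrow> real) V.
        continuous_on unit_square f \<and> open V}" (is "_ \<in> ?S")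
    using continuous_on_const open_UNIV by blast
  then have "\<Union>?S = permutons" by blast
  then show ?thesis unfolding permuton_topology_def topology_generated_by_topspace .
qed

definition permuton_nbhd :: "(real \<times> real \<Rightarrow> real) set \<Rightarrow> real \<Rightarrow> (real \<times> real) measure \<Rightarrow> (real \<times> real) measure set" where
  "permuton_nbhd A \<eta> \<mu> = {\<nu> \<in> permutons. \<forall>f\<in>A. \<bar>(\<integral>z. f z \<partial>\<nu>) - (\<integral>z. f z \<partial>\<mu>)\<bar> < \<eta>}"

text \<open>A subbasic set is governed by one continuous function. Replacing it by a Lipschitz
  function uniformly within \<open>e / 3\<close> changes its integral by at most
  \<open>e / 3\<close> against every permuton, all of them having mass one. Finite intersections
  merge the finite sets of test functions.\<close>

lemma permuton_nbhd_base:
  assumes "openin permuton_topology W" "\<mu> \<in> W"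
  shows "\<exists>A \<eta>. finite A \<and> Ball A lipschitz_test \<and> \<eta> > 0 \<and> permuton_nbhd A \<eta> \<mu> \<subseteq> W"
proof -
  have "generate_topology_on {{\<mu> \<in> permutons. (\<integral>z. f z \<partial>\<mu>) \<in> V} |(f :: real \<times> real \<Rightarrow> real) V.
        continuous_on unit_square f \<and> open V} W"
    using assms(1) unfolding permuton_topology_def openin_topology_generated_by_iff .
  then show ?thesis using assms(2)
  proof (induction arbitrary: \<mu>)
    case Empty
    then show ?case by simp
  next
    case (Int a b)
    obtain A \<eta> where 1: "finite A" "Ball A lipschitz_test" "\<eta> > 0" "permuton_nbhd A \<eta> \<mu> \<subseteq> a"
      using Int.IH(1)[OF IntD1[OF Int.prems]] by (elim exE conjE)
    obtain A' \<eta>' where 2: "finite A'" "Ball A' lipschitz_test" "\<eta>' > 0" "permuton_nbhd A' \<eta>' \<mu> \<subseteq> b"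
      using Int.IH(2)[OF IntD2[OF Int.prems]] by (elim exE conjE)
    have "permuton_nbhd (A \<union> A') (min \<eta> \<eta>') \<mu> \<subseteq> permuton_nbhd A \<eta> \<mu> \<inter> permuton_nbhd A' \<eta>' \<mu>"
      by (simp add: permuton_nbhd_def subset_iff)
    then have "permuton_nbhd (A \<union> A') (min \<eta> \<eta>') \<mu> \<subseteq> a \<inter> b" using 1(4) 2(4) by blast
    moreover have "finite (A \<union> A')" "Ball (A \<union> A') lipschitz_test" "min \<eta> \<eta>' > 0"
      using 1(1-3) 2(1-3) by auto
    ultimately show ?case by (intro exI conjI)
  next
    case (UN K)
    then obtain k where k: "k \<in> K" "\<mu> \<in> k" by blast
    obtain A \<eta> where "finite A" "Ball A lipschitz_test" "\<eta> > 0" "permuton_nbhd A \<eta> \<mu> \<subseteq> k"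
      using UN.IH[OF k] by (elim exE conjE)
    moreover have "k \<subseteq> \<Union>K" using k(1) by blast
    ultimately show ?case by (meson subset_trans)
  next
    case (Basis s)
    then obtain f :: "real \<times> real \<Rightarrow> real" and V where s: "s = {\<mu> \<in> permutons. (\<integral>z. f z \<partial>\<mu>) \<in> V}"
      and f: "continuous_on unit_square f" and V: "open V" by blast
    have \<mu>: "\<mu> \<in> permutons" "(\<integral>z. f z \<partial>\<mu>) \<in> V" using Basis.prems s by auto
    obtain e where e: "e > 0" "\<And>y. \<bar>y - (\<integral>z. f z \<partial>\<mu>)\<bar> < e \<Longrightarrow> y \<in> V"
      using V \<mu>(2) unfolding open_dist dist_real_def by blast
    have e3: "e / 3 > 0" using e(1) by simp
    obtain g where g: "lipschitz_test g" "\<And>z. z \<in> unit_square \<Longrightarrow> \<bar>f z - g z\<bar> < e / 3"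
      using ex_lipschitz_test_approx[OF f e3] by blast
    have "\<nu> \<in> s" if \<nu>: "\<nu> \<in> permuton_nbhd {g} (e / 3) \<mu>" for \<nu>
    proof -
      have d: "\<bar>(\<integral>z. f z \<partial>\<kappa>) - (\<integral>z. g z \<partial>\<kappa>)\<bar> \<le> e / 3" if "\<kappa> \<in> permutons" for \<kappa>
        using integral_permuton_diff_le[OF that f lipschitz_test_continuous[OF g(1)]] g(2)
        by (metis less_imp_le)
      have n: "\<nu> \<in> permutons" "\<bar>(\<integral>z. g z \<partial>\<nu>) - (\<integral>z. g z \<partial>\<mu>)\<bar> < e / 3"
        using \<nu> by (auto simp: permuton_nbhd_def)
      have "\<bar>(\<integral>z. f z \<partial>\<nu>) - (\<integral>z. f z \<partial>\<mu>)\<bar> < e" using d[OF n(1)] d[OF \<mu>(1)] n(2) by linarith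
      then show ?thesis using e(2) n(1) s by blast
    qed
    then have "permuton_nbhd {g} (e / 3) \<mu> \<subseteq> s" by blast
    moreover have "finite {g}" "Ball {g} lipschitz_test" using g(1) by simp_all
    ultimately show ?case using e3 by (intro exI conjI)
  qed
qed

text \<open>Isolates what the compactness argument uses of the realisations of the limit. For
  Lipschitz functions the continuity is a matter of integrals depending on a parameter.\<close>

locale permuton_path =
  fixes Y :: "real \<Rightarrow> (real \<times> real) measure"
  assumes permuton: "\<And>u. u \<in> {0..1} \<Longrightarrow> Y u \<in> permutons"
    and continuous: "\<And>f. lipschitz_test f \<Longrightarrow> continuous_on {0..1} (\<lambda>u. \<integral>z. f z \<partial>Y u)"
begin

lemma eventually_nbhd:
  assumes "finite A" "Ball A lipschitz_test" "\<eta> > 0" "u \<in> {0..1}"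
  obtains \<rho> where "\<rho> > 0" "\<And>u'. u' \<in> {0..1} \<Longrightarrow> dist u u' < \<rho> \<Longrightarrow> Y u' \<in> permuton_nbhd A \<eta> (Y u)"
proof -
  have "\<forall>f\<in>A. \<forall>\<^sub>F u' in at u within {0..1}. \<bar>(\<integral>z. f z \<partial>Y u') - (\<integral>z. f z \<partial>Y u)\<bar> < \<eta>"
  proof
    fix f assume "f \<in> A"
    then have "((\<lambda>u. \<integral>z. f z \<partial>Y u) \<longlongrightarrow> (\<integral>z. f z \<partial>Y u)) (at u within {0..1})"
      using continuous assms(2,4) by (auto simp: continuous_on_def)
    from tendstoD[OF this assms(3)]
    show "\<forall>\<^sub>F u' in at u within {0..1}. \<bar>(\<integral>z. f z \<partial>Y u') - (\<integral>z. f z \<partial>Y u)\<bar> < \<eta>" by (simp add: dist_real_def)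
  qed
  then have "\<forall>\<^sub>F u' in at u within {0..1}. \<forall>f\<in>A. \<bar>(\<integral>z. f z \<partial>Y u') - (\<integral>z. f z \<partial>Y u)\<bar> < \<eta>"
    using assms(1) by (simp add: eventually_ball_finite_distrib)
  then obtain \<rho> where \<rho>: "\<rho> > 0" "\<And>u'. u' \<in> {0..1} \<Longrightarrow> u' \<noteq> u \<Longrightarrow> dist u' u < \<rho> \<Longrightarrow>
      \<forall>f\<in>A. \<bar>(\<integral>z. f z \<partial>Y u') - (\<integral>z. f z \<partial>Y u)\<bar> < \<eta>"
    unfolding eventually_at by blast
  have "Y u' \<in> permuton_nbhd A \<eta> (Y u)" if "u' \<in> {0..1}" "dist u u' < \<rho>" for u'
    using \<rho>(2)[OF that(1)] that permuton[of u'] assms(3)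
    by (cases "u' = u") (auto simp: permuton_nbhd_def dist_commute)
  then show ?thesis using that \<rho>(1) by blast
qed

text \<open>Serves twice: it makes the limit a random element of the space, and turns a continuous
  functional into a continuous function of \<open>u\<close>.\<close>

lemma path_continuous: "continuous_map (top_of_set {0..1}) permuton_topology Y"
  unfolding continuous_map_def topspace_permuton_topology
proof (intro conjI allI impI)
  show "Y \<in> topspace (top_of_set {0..1}) \<rightarrow> permutons" using permuton by auto
next
  fix W assume W: "openin permuton_topology W"
  have "\<exists>T. openin (top_of_set {0..1}) T \<and> u \<in> T \<and> T \<subseteq> {u \<in> {0..1}. Y u \<in> W}" if u: "u \<in> {0..1}" "Y u \<in> W" for u
  proof -
    obtain A \<eta> where A: "finite A" "Ball A lipschitz_test" "\<eta> > 0" "permuton_nbhd A \<eta> (Y u) \<subseteq> W"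
      using permuton_nbhd_base[OF W u(2)] by blast
    obtain \<rho> where "\<rho> > 0" "\<And>u'. u' \<in> {0..1} \<Longrightarrow> dist u u' < \<rho> \<Longrightarrow> Y u' \<in> permuton_nbhd A \<eta> (Y u)"
      using eventually_nbhd[OF A(1-3) u(1)] by blast
    then show ?thesis using A(4) u(1)
      by (intro exI[of _ "{0..1} \<inter> ball u \<rho>"]) (auto simp: openin_open)
  qed
  then have "openin (top_of_set {0..1}) {u \<in> {0..1}. Y u \<in> W}"
    by (subst openin_subopen) blast
  then show "openin (top_of_set {0..1}) {u \<in> topspace (top_of_set {0..1}). Y u \<in> W}" by simp
qed

text \<open>The Lebesgue number argument: only finitely many test functions are needed along the whole
  compact path.\<close>

lemma uniformly_continuous_at_path:
  assumes F: "continuous_map permuton_topology euclideanreal F" and e: "e > 0"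
  obtains A \<eta> where "finite A" "Ball A lipschitz_test" "\<eta> > 0"
    "\<And>u \<nu>. u \<in> {0..1} \<Longrightarrow> \<nu> \<in> permuton_nbhd A \<eta> (Y u) \<Longrightarrow> \<bar>F \<nu> - F (Y u)\<bar> < e"
proof -
  \<comment> \<open>Near \<open>Y u\<close>: the functional varies by less than \<open>e / 2\<close>
    on the neighbourhood of radius \<open>\<eta>\<close>, while path points with parameter within
    \<open>\<rho>\<close> of \<open>u\<close> stay in the one of radius \<open>\<eta> / 2\<close>.
    The halves leave room for the triangle inequality.\<close>
  define P where "P u A \<eta> \<rho> \<longleftrightarrow> finite A \<and> Ball A lipschitz_test \<and> \<eta> > 0 \<and> \<rho> > 0 \<and>
    (\<forall>\<nu>\<in>permuton_nbhd A \<eta> (Y u). \<bar>F \<nu> - F (Y u)\<bar> < e / 2) \<and>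
    (\<forall>u'\<in>{0..1}. dist u u' < \<rho> \<longrightarrow> Y u' \<in> permuton_nbhd A (\<eta> / 2) (Y u))" for u A \<eta> \<rho>
  have "\<exists>A \<eta> \<rho>. P u A \<eta> \<rho>" if u: "u \<in> {0..1}" for u
  proof -
    let ?W = "{\<nu> \<in> topspace permuton_topology. F \<nu> \<in> ball (F (Y u)) (e / 2)}"
    have op: "openin permuton_topology ?W" by (rule openin_continuous_map_preimage[OF F]) simp
    have "Y u \<in> ?W" using permuton[OF u] e by (simp add: topspace_permuton_topology)
    from permuton_nbhd_base[OF op this]
    obtain A \<eta> where A: "finite A" "Ball A lipschitz_test" "\<eta> > 0" "permuton_nbhd A \<eta> (Y u) \<subseteq> ?W"
      by (elim exE conjE)
    have \<eta>2: "\<eta> / 2 > 0" using A(3) by simp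
    obtain \<rho> where \<rho>: "\<rho> > 0" "\<And>u'. u' \<in> {0..1} \<Longrightarrow> dist u u' < \<rho> \<Longrightarrow> Y u' \<in> permuton_nbhd A (\<eta> / 2) (Y u)"
      using eventually_nbhd[OF A(1,2) \<eta>2 u] by blast
    have "\<bar>F \<nu> - F (Y u)\<bar> < e / 2" if "\<nu> \<in> permuton_nbhd A \<eta> (Y u)" for \<nu>
      using subsetD[OF A(4) that] by (simp add: dist_real_def abs_minus_commute)
    then have "P u A \<eta> \<rho>" using A(1-3) \<rho> unfolding P_def by blast
    then show ?thesis by blast
  qed
  then have "\<forall>u\<in>{0..1}. \<exists>x. P u (fst x) (fst (snd x)) (snd (snd x))" by simp
  then obtain h where h: "\<forall>u\<in>{0..1}. P u (fst (h u)) (fst (snd (h u))) (snd (snd (h u)))"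
    by (rule bchoice[THEN exE])
  define A \<eta> \<rho> where "A = (\<lambda>u. fst (h u))" and "\<eta> = (\<lambda>u. fst (snd (h u)))" and "\<rho> = (\<lambda>u. snd (snd (h u)))"
  have P: "P u (A u) (\<eta> u) (\<rho> u)" if "u \<in> {0..1}" for u
    using h that by (simp add: A_def \<eta>_def \<rho>_def)
  have pos: "\<rho> u > 0" "\<eta> u > 0" "finite (A u)" "Ball (A u) lipschitz_test" if "u \<in> {0..1}" for u
    using P[OF that] unfolding P_def by blast+
  obtain C where C: "C \<subseteq> {0..1}" "finite C" "{0..1} \<subseteq> (\<Union>c\<in>C. ball c (\<rho> c))"
  proof (rule compactE_image[of "{0..1::real}" "{0..1}" "\<lambda>c. ball c (\<rho> c)"])
    show "{0..1} \<subseteq> (\<Union>c\<in>{0..1}. ball c (\<rho> c))"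
    proof
      fix u :: real assume "u \<in> {0..1}"
      moreover from this have "u \<in> ball u (\<rho> u)" using pos(1) by simp
      ultimately show "u \<in> (\<Union>c\<in>{0..1}. ball c (\<rho> c))" by blast
    qed
  qed auto
  have "(0 :: real) \<in> {0..1}" by simp
  then have ne: "C \<noteq> {}" using C(3) by blast
  \<comment> \<open>Then \<open>\<nu>\<close> within \<open>\<eta>'\<close> of \<open>Y u\<close>,
    and \<open>Y u\<close> within \<open>\<eta> c / 2\<close> of \<open>Y c\<close>, give
    \<open>\<nu>\<close> within \<open>\<eta> c\<close> of \<open>Y c\<close>.\<close>
  define \<eta>' where "\<eta>' = Min (\<eta> ` C) / 2"
  show ?thesis
  proof (rule that[of "\<Union>c\<in>C. A c" \<eta>'])
    show "finite (\<Union>c\<in>C. A c)" "Ball (\<Union>c\<in>C. A c) lipschitz_test" using C(1,2) pos(3,4) by blast+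
    have "\<forall>c\<in>C. \<eta> c > 0" using C(1) pos(2) by blast
    then show "\<eta>' > 0" using C(2) ne by (simp add: \<eta>'_def)
    fix u \<nu> assume u: "u \<in> {0..1}" and \<nu>: "\<nu> \<in> permuton_nbhd (\<Union>c\<in>C. A c) \<eta>' (Y u)"
    then have "u \<in> (\<Union>c\<in>C. ball c (\<rho> c))" using C(3) by blast
    then obtain c where c: "c \<in> C" "dist c u < \<rho> c" by auto
    then have c01: "c \<in> {0..1}" using C(1) by blast
    note Pc = P[OF c01]
    have Yu: "Y u \<in> permuton_nbhd (A c) (\<eta> c / 2) (Y c)" using Pc c(2) u unfolding P_def by blast
    have le: "\<eta>' \<le> \<eta> c / 2" using C(2) c(1) by (simp add: \<eta>'_def)
    have "\<nu> \<in> permuton_nbhd (A c) (\<eta> c) (Y c)"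
      unfolding permuton_nbhd_def
    proof (intro CollectI conjI ballI)
      show "\<nu> \<in> permutons" using \<nu> by (simp add: permuton_nbhd_def)
      fix f assume f: "f \<in> A c"
      have "\<bar>(\<integral>z. f z \<partial>\<nu>) - (\<integral>z. f z \<partial>Y u)\<bar> < \<eta>'" using \<nu> f c(1) by (auto simp: permuton_nbhd_def)
      moreover have "\<bar>(\<integral>z. f z \<partial>Y u) - (\<integral>z. f z \<partial>Y c)\<bar> < \<eta> c / 2" using Yu f by (auto simp: permuton_nbhd_def)
      ultimately show "\<bar>(\<integral>z. f z \<partial>\<nu>) - (\<integral>z. f z \<partial>Y c)\<bar> < \<eta> c" using le by linarith
    qed
    moreover have "Y u \<in> permuton_nbhd (A c) (\<eta> c) (Y c)"
    proof -
      have "\<eta> c / 2 < \<eta> c" using pos(2)[OF c01] by simp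
      then show ?thesis using Yu unfolding permuton_nbhd_def by (auto intro: less_trans)
    qed
    ultimately have "\<bar>F \<nu> - F (Y c)\<bar> < e / 2" "\<bar>F (Y u) - F (Y c)\<bar> < e / 2" using Pc unfolding P_def by blast+
    then show "\<bar>F \<nu> - F (Y u)\<bar> < e" by linarith
  qed
qed

end


section \<open>The permuton of a permutation\<close>

lemma unit_square_borel [measurable]: "unit_square \<in> sets borel"
  by (intro borel_closed closed_Times) auto

lemma sets_square_borel: "A \<in> sets square_borel \<longleftrightarrow> A \<in> sets borel \<and> A \<subseteq> unit_square"
  by (auto simp: sets_restrict_space_iff)

lemma measurable_square_borelI:
  assumes "f \<in> borel_measurable M" "\<And>x. x \<in> space M \<Longrightarrow> f x \<in> unit_square"
  shows "f \<in> M \<rightarrow>\<^sub>M square_borel"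
  using assms by (intro measurable_restrict_space2) auto

lemma coordinate_sets:
  assumes "pr = fst \<or> pr = snd" "B \<in> sets borel"
  shows "{z \<in> unit_square. pr z \<in> B} \<in> sets square_borel"
proof -
  have "{z \<in> unit_square. fst z \<in> B} = (B \<inter> {0..1}) \<times> {0..1}" "{z \<in> unit_square. snd z \<in> B} = {0..1} \<times> (B \<inter> {0..1})" by auto
  moreover have "(B \<inter> {0..1}) \<times> {0..1::real} \<in> sets borel" "{0..1::real} \<times> (B \<inter> {0..1}) \<in> sets borel"
    unfolding borel_prod[symmetric] using assms(2) by auto
  ultimately show ?thesis using assms(1) unfolding sets_square_borel by auto
qed

lemma permutonI:
  assumes s: "sets \<nu> = sets square_borel"
    and marginal: "\<And>pr B. pr = fst \<or> pr = snd \<Longrightarrow> B \<in> sets borel \<Longrightarrow>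
      emeasure \<nu> {z \<in> unit_square. pr z \<in> B} = emeasure lborel (B \<inter> {0..1})"
  shows "\<nu> \<in> permutons"
proof -
  have sp: "space \<nu> = unit_square" using sets_eq_imp_space_eq[OF s] by (simp add: space_restrict_space)
  have "emeasure \<nu> unit_square = 1" using marginal[of fst UNIV] by simp
  then have "prob_space \<nu>" using sp by (intro prob_spaceI) simp
  moreover have "distr \<nu> borel pr = uniform_measure lborel {0..1}" if pr: "pr = fst \<or> pr = snd" for pr
  proof (rule measure_eqI)
    fix B assume "B \<in> sets (distr \<nu> borel pr)"
    then have B: "B \<in> sets borel" by simp
    have "pr \<in> \<nu> \<rightarrow>\<^sub>M borel" using pr unfolding measurable_cong_sets[OF s refl]
      by (auto intro!: measurable_restrict_space1 simp: borel_prod[symmetric])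
    moreover have "pr -` B \<inter> space \<nu> = {z \<in> unit_square. pr z \<in> B}" using sp by auto
    ultimately show "emeasure (distr \<nu> borel pr) B = emeasure (uniform_measure lborel {0..1}) B"
      using B marginal[OF pr B] by (simp add: emeasure_distr emeasure_uniform_measure Int_commute divide_ennreal_def)
  qed simp
  ultimately show ?thesis using s by (simp add: permutons_def)
qed

section \<open>Strips and cells of the square\<close>

definition strip :: "nat \<Rightarrow> nat \<Rightarrow> real set" where
  "strip n k = {x. \<lceil>x * real n\<rceil> = int k}"

lemma strip_eq: "n > 0 \<Longrightarrow> strip n k = {(real k - 1) / n<..real k / n}"
  by (auto simp: strip_def ceiling_eq_iff field_simps)

lemma strip_borel [measurable]: "strip n k \<in> sets borel"
proof (cases "n = 0")
  case True then show ?thesis by (cases "k = 0") (simp_all add: strip_def)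
qed (simp add: strip_eq)

lemma emeasure_strip: "n > 0 \<Longrightarrow> emeasure lborel (strip n k) = ennreal (1 / n)"
  by (simp add: strip_eq divide_right_mono diff_divide_distrib[symmetric])

lemma strip_subset_pos: assumes "k \<in> {1..n}" shows "strip n k \<subseteq> {0<..1}"
proof
  fix x assume x: "x \<in> strip n k"
  have "0 \<le> (real k - 1) / n" "real k / n \<le> 1" "n > 0" using assms by auto
  moreover from this have "(real k - 1) / n < x" "x \<le> real k / n" using x by (simp_all add: strip_eq)
  ultimately show "x \<in> {0<..1}" unfolding greaterThanAtMost_iff by linarith
qed

lemma strip_subset: "k \<in> {1..n} \<Longrightarrow> strip n k \<subseteq> {0..1}"
  by (erule order_trans[OF strip_subset_pos]) auto

text \<open>The right-closed strips partition \<open>{0<..1}\<close>; only the null point 0 is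
  lost.\<close>

lemma sum_emeasure_strips:
  assumes "n > 0" "B \<in> sets borel"
  shows "(\<Sum>k\<in>{1..n}. emeasure lborel (B \<inter> strip n k)) = emeasure lborel (B \<inter> {0..1})"
proof -
  have "(\<Sum>k\<in>{1..n}. emeasure lborel (B \<inter> strip n k)) = emeasure lborel (\<Union>k\<in>{1..n}. B \<inter> strip n k)"
    using assms by (intro sum_emeasure) (auto simp: disjoint_family_on_def strip_def)
  also have "(\<Union>k\<in>{1..n}. B \<inter> strip n k) = B \<inter> {0<..1}"
  proof -
    have "x \<in> (\<Union>k\<in>{1..n}. strip n k)" if "0 < x" "x \<le> 1" for x
    proof -
      have "0 < x * n" "x * n \<le> n" using that assms(1) by (auto simp: mult_left_le_one_le)
      then have "1 \<le> \<lceil>x * n\<rceil>" "\<lceil>x * n\<rceil> \<le> int n" by (auto simp: ceiling_le_iff le_ceiling_iff)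
      then show ?thesis by (intro UN_I[of "nat \<lceil>x * n\<rceil>"]) (auto simp: strip_def nat_le_iff Suc_le_eq)
    qed
    then have "{0<..1} \<subseteq> (\<Union>k\<in>{1..n}. strip n k)" by (meson greaterThanAtMost_iff subsetI)
    moreover have "(\<Union>k\<in>{1..n}. strip n k) \<subseteq> {0<..1}" by (rule UN_least) (rule strip_subset_pos)
    ultimately have "(\<Union>k\<in>{1..n}. strip n k) = {0<..1}" by (rule subset_antisym[rotated])
    moreover have "(\<Union>k\<in>{1..n}. B \<inter> strip n k) = B \<inter> (\<Union>k\<in>{1..n}. strip n k)" by blast
    ultimately show ?thesis by simp
  qed
  also have "emeasure lborel (B \<inter> {0<..1}) = emeasure lborel (B \<inter> {0..1})"
  proof (intro emeasure_eq_AE)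
    show "AE x in lborel. (x \<in> B \<inter> {0<..1}) = (x \<in> B \<inter> {0..1})"
      using AE_lborel_singleton[of 0] by eventually_elim auto
  qed (use assms in auto)
  finally show ?thesis .
qed

lemma emeasure_lborel_Times:
  fixes P Q :: "real set"
  assumes "P \<in> sets borel" "Q \<in> sets borel"
  shows "emeasure lborel (P \<times> Q) = emeasure lborel P * emeasure lborel Q"
  unfolding lborel_prod[symmetric] using assms by (simp add: lborel.emeasure_pair_measure_Times)

abbreviation cell :: "nat list \<Rightarrow> nat \<Rightarrow> (real \<times> real) set" where
  "cell \<sigma> i \<equiv> strip (length \<sigma>) (Suc i) \<times> strip (length \<sigma>) (\<sigma> ! i)"

lemma perms_nth: "\<sigma> \<in> perms \<Longrightarrow> i < length \<sigma> \<Longrightarrow> \<sigma> ! i \<in> {1..length \<sigma>}"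
  using nth_mem[of i \<sigma>] by (simp add: perms_iff)

lemma cell_borel [measurable]: "cell \<sigma> i \<in> sets borel"
  unfolding borel_prod[symmetric] by measurable

lemma cell_subset: "\<sigma> \<in> perms \<Longrightarrow> i < length \<sigma> \<Longrightarrow> cell \<sigma> i \<subseteq> unit_square"
  using strip_subset[of "Suc i" "length \<sigma>"] strip_subset[OF perms_nth[of \<sigma> i]] by (intro Sigma_mono) auto

lemma emeasure_cell: "\<sigma> \<noteq> [] \<Longrightarrow> emeasure lborel (cell \<sigma> i) = ennreal (1 / length \<sigma> * (1 / length \<sigma>))"
  by (simp add: emeasure_lborel_Times[OF strip_borel strip_borel] emeasure_strip ennreal_mult[symmetric])

lemma sets_permuton_of: "sets (permuton_of \<sigma>) = sets square_borel"
  unfolding permuton_of_def Let_def by (simp add: sets_restrict_space)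

lemma emeasure_permuton_of:
  assumes \<sigma>: "\<sigma> \<in> perms" and A: "A \<in> sets square_borel"
  shows "emeasure (permuton_of \<sigma>) A = (\<Sum>i<length \<sigma>. of_nat (length \<sigma>) * emeasure lborel (A \<inter> cell \<sigma> i))"
proof -
  let ?n = "length \<sigma>"
  define h :: "real \<times> real \<Rightarrow> ennreal" where
    "h = (\<lambda>(x, y). if int (\<sigma> ! (nat \<lceil>x * real ?n\<rceil> - 1)) = \<lceil>y * real ?n\<rceil> then of_nat ?n else 0)"
  have n: "?n > 0" using \<sigma> by (auto simp: perms_iff)
  have A': "A \<in> sets borel" "A \<subseteq> unit_square" using A sets_square_borel by auto
  have hm: "h \<in> borel_measurable borel"
    unfolding h_def borel_prod[symmetric] by measurable
  have "emeasure (permuton_of \<sigma>) A = (\<integral>\<^sup>+z. h z * indicator A z \<partial>restrict_space lborel unit_square)"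
    unfolding permuton_of_def Let_def h_def[symmetric]
    using hm A by (intro emeasure_density) (auto simp: sets_restrict_space intro!: measurable_restrict_space1)
  also have "\<dots> = (\<integral>\<^sup>+z. h z * indicator A z * indicator unit_square z \<partial>lborel)"
    by (rule nn_integral_restrict_space) simp
  also have "\<dots> = (\<integral>\<^sup>+z. (\<Sum>i<?n. of_nat ?n * indicator (A \<inter> cell \<sigma> i) z) \<partial>lborel)"
  proof (rule nn_integral_cong_AE)
    \<comment> \<open>On the line x = 0 natural subtraction makes the density read the first entry
      of \<open>\<sigma>\<close>, whereas no cell meets this line; it is a null set.\<close>
    have "AE z in lborel. (z :: real \<times> real) \<bullet> (1, 0) \<noteq> 0"
      by (rule AE_lborel_inner_neq) (simp add: Basis_prod_def image_iff)
    then show "AE z in lborel. h z * indicator A z * indicator unit_square z =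
        (\<Sum>i<?n. of_nat ?n * indicator (A \<inter> cell \<sigma> i) z)"
    proof eventually_elim
      case (elim z)
      obtain x y where z: "z = (x, y)" by (cases z)
      show ?case
      proof (cases "z \<in> A")
        case True
        then have "0 < x" "x \<le> 1" using elim z A' by auto
        then have "0 < x * ?n" "x * ?n \<le> ?n" using n by (auto simp: mult_left_le_one_le)
        then have c: "1 \<le> \<lceil>x * ?n\<rceil>" "\<lceil>x * ?n\<rceil> \<le> int ?n" by (auto simp: ceiling_le_iff le_ceiling_iff)
        define j where "j = nat \<lceil>x * ?n\<rceil> - 1"
        have j: "j < ?n" "\<lceil>x * ?n\<rceil> = int (Suc j)" using c unfolding j_def by linarith+
        have "z \<in> cell \<sigma> i \<longleftrightarrow> \<lceil>x * ?n\<rceil> = int (Suc i) \<and> \<lceil>y * ?n\<rceil> = int (\<sigma> ! i)" for i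
          by (simp add: z strip_def)
        then have "z \<in> A \<inter> cell \<sigma> i \<longleftrightarrow> i = j \<and> \<lceil>y * ?n\<rceil> = int (\<sigma> ! j)" for i
          unfolding j(2) of_nat_eq_iff nat.inject using True by auto
        then have "(\<Sum>i<?n. of_nat ?n * indicator (A \<inter> cell \<sigma> i) z :: ennreal)
            = (\<Sum>i<?n. if i = j then (if \<lceil>y * ?n\<rceil> = int (\<sigma> ! j) then of_nat ?n else 0) else 0)"
          unfolding indicator_def by (intro sum.cong refl) simp
        also have "\<dots> = h z" using j(1) unfolding h_def z prod.case j_def by (simp add: eq_commute)
        finally show ?thesis using True subsetD[OF A'(2) True] by simp
      qed simp
    qed
  qed
  also have "\<dots> = (\<Sum>i<?n. of_nat ?n * emeasure lborel (A \<inter> cell \<sigma> i))"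
  proof -
    have "A \<inter> cell \<sigma> i \<in> sets lborel" for i using A'(1) cell_borel[of \<sigma> i] by simp
    then show ?thesis
      by (subst nn_integral_sum) (auto intro!: sum.cong nn_integral_cmult_indicator)
  qed
  finally show ?thesis .
qed

lemma ennreal_nat_cancel: "n > 0 \<Longrightarrow> of_nat n * (x * ennreal (1 / real n)) = x"
proof -
  assume n: "n > 0"
  have "of_nat n * ennreal (1 / real n) = 1"
    using n unfolding ennreal_of_nat_eq_real_of_nat by (subst ennreal_mult[symmetric]) auto
  then show ?thesis by (metis mult.assoc mult.commute mult_1)
qed

text \<open>Projected to one axis, a cell contributes \<open>n\<close> times the measure of its
  strip times \<open>1 / n\<close>. As \<open>\<sigma>\<close> is a permutation, each of the
  \<open>n\<close> strips is met exactly once on either axis.\<close>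

lemma permuton_of_permuton:
  assumes \<sigma>: "\<sigma> \<in> perms" shows "permuton_of \<sigma> \<in> permutons"
proof (rule permutonI[OF sets_permuton_of])
  let ?n = "length \<sigma>"
  have n: "?n > 0" and d: "distinct \<sigma>" "set \<sigma> = {1..?n}" using \<sigma> by (auto simp: perms_iff)
  fix pr :: "real \<times> real \<Rightarrow> real" and B :: "real set"
  assume pr: "pr = fst \<or> pr = snd" and B: "B \<in> sets borel"
  define c where "c i = (if pr = fst then Suc i else \<sigma> ! i)" for i
  have "(fst :: real \<times> real \<Rightarrow> real) \<noteq> snd" by (metis fst_conv snd_conv zero_neq_one)
  then have pr': "pr = fst \<and> c = Suc \<or> pr = snd \<and> c = (!) \<sigma>" using pr by (auto simp: c_def)
  have "emeasure (permuton_of \<sigma>) {z \<in> unit_square. pr z \<in> B} = (\<Sum>i<?n. emeasure lborel (B \<inter> strip ?n (c i)))"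
    unfolding emeasure_permuton_of[OF \<sigma> coordinate_sets[OF pr B]]
  proof (intro sum.cong refl)
    fix i assume "i \<in> {..<?n}"
    then have i: "i < ?n" by simp
    have "{z \<in> unit_square. pr z \<in> B} \<inter> cell \<sigma> i = {z \<in> cell \<sigma> i. pr z \<in> B}"
      using cell_subset[OF \<sigma> i] by blast
    also have "\<dots> = (if pr = fst then (B \<inter> strip ?n (Suc i)) \<times> strip ?n (\<sigma> ! i)
        else strip ?n (Suc i) \<times> (B \<inter> strip ?n (\<sigma> ! i)))" using pr by auto
    finally have "emeasure lborel ({z \<in> unit_square. pr z \<in> B} \<inter> cell \<sigma> i) = emeasure lborel (B \<inter> strip ?n (c i)) * ennreal (1 / ?n)"
      using B n by (simp only: c_def emeasure_lborel_Times sets.Int strip_borel emeasure_strip mult.commute split: if_split) simp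
    then show "of_nat ?n * emeasure lborel ({z \<in> unit_square. pr z \<in> B} \<inter> cell \<sigma> i) = emeasure lborel (B \<inter> strip ?n (c i))"
      using n by (simp only: ennreal_nat_cancel)
  qed
  also have "\<dots> = (\<Sum>k\<in>{1..?n}. emeasure lborel (B \<inter> strip ?n k))"
    using pr'
  proof (elim disjE conjE)
    assume "c = Suc" then show ?thesis by (simp add: sum.atLeast1_atMost_eq)
  next
    assume "c = (!) \<sigma>"
    then show ?thesis
      using bij_betw_nth[OF d(1) refl d(2)[symmetric]] by (simp only:) (intro sum.reindex_bij_betw, simp)
  qed
  finally show "emeasure (permuton_of \<sigma>) {z \<in> unit_square. pr z \<in> B} = emeasure lborel (B \<inter> {0..1})"
    using sum_emeasure_strips[OF n B] by simp
qed

text \<open>The points of the sum are the upper right corners of the cells. Each cell has mass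
  \<open>1 / n\<close> and both sides \<open>1 / n\<close>, so replacing \<open>f\<close> by its
  value at that corner costs at most \<open>2 * L / n\<close>.\<close>

lemma integral_permuton_of:
  assumes \<sigma>: "\<sigma> \<in> perms" and f: "continuous_on unit_square f"
    and L: "\<And>z z'. \<bar>f z - f z'\<bar> \<le> L * dist z z'"
  shows "\<bar>(\<integral>z. f z \<partial>permuton_of \<sigma>) - (\<Sum>i<length \<sigma>. f (real (Suc i) / length \<sigma>, real (\<sigma> ! i) / length \<sigma>)) / length \<sigma>\<bar>
     \<le> 2 * L / length \<sigma>"
proof -
  let ?n = "length \<sigma>" and ?\<mu> = "permuton_of \<sigma>"
  define p where "p i = (real (Suc i) / ?n, real (\<sigma> ! i) / ?n)" for i
  have n: "?n > 0" "\<sigma> \<noteq> []" using \<sigma> by (auto simp: perms_iff)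
  have \<mu>: "?\<mu> \<in> permutons" by (rule permuton_of_permuton[OF \<sigma>])
  then interpret prob_space ?\<mu> by (simp add: permutons_def)
  have cs: "cell \<sigma> i \<in> sets ?\<mu>" if "i < ?n" for i
    using cell_subset[OF \<sigma> that] unfolding sets_permuton_of sets_square_borel by simp
  have disj: "cell \<sigma> i \<inter> cell \<sigma> j = {}" if "i \<noteq> j" for i j using that by (auto simp: strip_def)
  have prob: "prob (cell \<sigma> i) = 1 / ?n" if i: "i < ?n" for i
  proof -
    have "emeasure ?\<mu> (cell \<sigma> i) = (\<Sum>j<?n. of_nat ?n * emeasure lborel (cell \<sigma> i \<inter> cell \<sigma> j))"
      using emeasure_permuton_of[OF \<sigma>] cs[OF i] sets_permuton_of by blast
    also have "\<dots> = (\<Sum>j<?n. if j = i then of_nat ?n * emeasure lborel (cell \<sigma> i) else 0)"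
      using disj by (intro sum.cong refl) (auto simp: Int_absorb)
    also have "\<dots> = of_nat ?n * ennreal (1 / ?n * (1 / ?n))" using i emeasure_cell[OF n(2)] by simp
    also have "\<dots> = ennreal (1 / ?n)"
      using ennreal_nat_cancel[OF n(1), of "ennreal (1 / ?n)"] by (subst ennreal_mult) auto
    finally show ?thesis unfolding measure_def by simp
  qed
  define s where "s z = (\<Sum>i<?n. f (p i) * indicator (cell \<sigma> i) z)" for z
  have si: "integrable ?\<mu> s" unfolding s_def
    using cs by (intro Bochner_Integration.integrable_sum integrable_mult_right integrable_real_indicator) (auto simp: emeasure_eq_measure)
  have fi: "integrable ?\<mu> f" by (rule integrable_permuton[OF \<mu> f])
  have "(\<integral>z. s z \<partial>?\<mu>) = (\<Sum>i<?n. f (p i) * prob (cell \<sigma> i))"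
    unfolding s_def using cs by (subst Bochner_Integration.integral_sum) (auto simp: emeasure_eq_measure intro!: integrable_mult_right integrable_real_indicator sum.cong)
  also have "\<dots> = (\<Sum>i<?n. f (p i)) / ?n" using prob by (simp add: sum_divide_distrib)
  finally have int_s: "(\<integral>z. s z \<partial>?\<mu>) = (\<Sum>i<?n. f (p i)) / ?n" .
  have "prob (\<Union>i<?n. cell \<sigma> i) = (\<Sum>i<?n. prob (cell \<sigma> i))"
    using cs disj by (intro finite_measure_finite_Union) (auto simp: disjoint_family_on_def)
  also have "\<dots> = 1" using prob n by simp
  finally have "AE z in ?\<mu>. z \<in> (\<Union>i<?n. cell \<sigma> i)" by (rule AE_prob_1)
  then have ae: "AE z in ?\<mu>. \<bar>f z - s z\<bar> \<le> 2 * L / ?n"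
  proof eventually_elim
    case (elim z)
    then obtain i where i: "i < ?n" "z \<in> cell \<sigma> i" by blast
    have "s z = (\<Sum>j<?n. if j = i then f (p i) else 0)"
      unfolding s_def using i disj by (intro sum.cong refl) (auto simp: indicator_def)
    then have sz: "s z = f (p i)" using i(1) by simp
    obtain x y where z: "z = (x, y)" by (cases z)
    have x: "\<bar>x - real (Suc i) / ?n\<bar> \<le> 1 / ?n" "\<bar>y - real (\<sigma> ! i) / ?n\<bar> \<le> 1 / ?n"
    proof -
      have "(real (Suc i) - 1) / ?n < x" "x \<le> real (Suc i) / ?n"
        "(real (\<sigma> ! i) - 1) / ?n < y" "y \<le> real (\<sigma> ! i) / ?n"
        using i(2) unfolding z by (simp_all add: strip_eq[OF n(1)])
      then show "\<bar>x - real (Suc i) / ?n\<bar> \<le> 1 / ?n" "\<bar>y - real (\<sigma> ! i) / ?n\<bar> \<le> 1 / ?n"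
        unfolding diff_divide_distrib by linarith+
    qed
    have "dist z (p i) \<le> dist x (real (Suc i) / ?n) + dist y (real (\<sigma> ! i) / ?n)"
      unfolding z p_def dist_Pair_Pair by (rule sqrt_sum_squares_le_sum) auto
    also have "\<dots> \<le> 2 / ?n" using x by (simp add: dist_real_def)
    finally have "dist z (p i) \<le> 2 / ?n" .
    moreover have "L \<ge> 0" using L[of "(0, 0)" "(1, 0)"] by (simp add: dist_Pair_Pair)
    ultimately have "L * dist z (p i) \<le> L * (2 / ?n)" by (rule mult_left_mono)
    then show ?case using L[of z "p i"] sz by (simp add: mult.commute)
  qed
  have "\<bar>(\<integral>z. f z \<partial>?\<mu>) - (\<integral>z. s z \<partial>?\<mu>)\<bar> = \<bar>\<integral>z. f z - s z \<partial>?\<mu>\<bar>" using fi si by simp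
  also have "\<dots> \<le> (\<integral>z. \<bar>f z - s z\<bar> \<partial>?\<mu>)" by (rule integral_abs_bound)
  also have "\<dots> \<le> (\<integral>z. 2 * L / ?n \<partial>?\<mu>)" using fi si ae by (intro integral_mono_AE) auto
  also have "\<dots> = 2 * L / ?n" by (simp add: prob_space)
  finally show ?thesis unfolding int_s p_def .
qed


section \<open>Mixtures of curves\<close>

abbreviation unit_lebesgue :: "real measure" where
  "unit_lebesgue \<equiv> restrict_space lborel {0..1}"

lemma space_unit_lebesgue [simp]: "space unit_lebesgue = {0..1}"
  by (simp add: space_restrict_space)

lemma prob_space_unit_lebesgue: "prob_space unit_lebesgue"
  by (rule prob_spaceI) (simp add: emeasure_restrict_space)

text \<open>A weighted sum of images of Lebesgue measure along curves, written as one push-forward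
  from \<open>I\<close> times the unit interval. It is therefore a measure by construction, to which
  the permutons given through \<open>measure_of\<close> can be compared.\<close>

definition mixture :: "'i set \<Rightarrow> ('i \<Rightarrow> real) \<Rightarrow> ('i \<Rightarrow> real \<Rightarrow> real \<times> real) \<Rightarrow> (real \<times> real) measure" where
  "mixture I c \<gamma> = distr (point_measure I (\<lambda>i. ennreal (c i)) \<Otimes>\<^sub>M unit_lebesgue) square_borel (\<lambda>(i, t). \<gamma> i t)"

lemma sets_mixture: "sets (mixture I c \<gamma>) = sets square_borel"
  by (simp add: mixture_def)

lemma measurable_mixture:
  assumes "finite I" "\<And>i. i \<in> I \<Longrightarrow> \<gamma> i \<in> unit_lebesgue \<rightarrow>\<^sub>M N"
  shows "(\<lambda>(i, t). \<gamma> i t) \<in> point_measure I (\<lambda>i. ennreal (c i)) \<Otimes>\<^sub>M unit_lebesgue \<rightarrow>\<^sub>M N"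
proof -
  have "(\<lambda>(i, t). \<gamma> i t) \<in> count_space I \<Otimes>\<^sub>M unit_lebesgue \<rightarrow>\<^sub>M N"
    using assms by (intro measurable_pair_measure_countable1) (auto simp: countable_finite)
  then show ?thesis
    by (simp add: measurable_cong_sets[OF sets_pair_measure_cong[OF sets_point_measure_count_space refl] refl])
qed

lemma emeasure_mixture:
  assumes I: "finite I" "\<And>i. i \<in> I \<Longrightarrow> \<gamma> i \<in> unit_lebesgue \<rightarrow>\<^sub>M square_borel" and A: "A \<in> sets square_borel"
  shows "emeasure (mixture I c \<gamma>) A = (\<Sum>i\<in>I. ennreal (c i) * emeasure unit_lebesgue (\<gamma> i -` A \<inter> {0..1}))"
proof -
  interpret K: prob_space unit_lebesgue by (rule prob_space_unit_lebesgue)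
  let ?P = "point_measure I (\<lambda>i. ennreal (c i))"
  let ?S = "(\<lambda>(i, t). \<gamma> i t) -` A \<inter> space (?P \<Otimes>\<^sub>M unit_lebesgue)"
  have "emeasure (mixture I c \<gamma>) A = emeasure (?P \<Otimes>\<^sub>M unit_lebesgue) ?S"
    unfolding mixture_def using measurable_mixture[OF I] A by (intro emeasure_distr) auto
  also have "\<dots> = (\<integral>\<^sup>+i. emeasure unit_lebesgue (Pair i -` ?S) \<partial>?P)"
    using measurable_mixture[OF I] A by (intro K.emeasure_pair_measure_alt measurable_sets) auto
  also have "\<dots> = (\<Sum>i\<in>I. ennreal (c i) * emeasure unit_lebesgue (Pair i -` ?S))"
    using I(1) by (rule nn_integral_point_measure_finite)
  also have "\<dots> = (\<Sum>i\<in>I. ennreal (c i) * emeasure unit_lebesgue (\<gamma> i -` A \<inter> {0..1}))"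
    by (intro sum.cong refl arg_cong2[where f = "(*)"] arg_cong[where f = "emeasure unit_lebesgue"])
       (auto simp: space_pair_measure space_point_measure)
  finally show ?thesis .
qed

lemma integral_mixture:
  fixes f :: "real \<times> real \<Rightarrow> real"
  assumes I: "finite I" "\<And>i. i \<in> I \<Longrightarrow> \<gamma> i \<in> unit_lebesgue \<rightarrow>\<^sub>M square_borel"
    and c: "\<And>i. i \<in> I \<Longrightarrow> c i \<ge> 0"
    and f: "f \<in> borel_measurable square_borel" "\<And>z. \<bar>f z\<bar> \<le> B"
  shows "(\<integral>z. f z \<partial>mixture I c \<gamma>) = (\<Sum>i\<in>I. c i * (\<integral>t. f (\<gamma> i t) \<partial>unit_lebesgue))"
proof -
  interpret K: prob_space unit_lebesgue by (rule prob_space_unit_lebesgue)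
  let ?P = "point_measure I (\<lambda>i. ennreal (c i))"
  interpret P: finite_measure ?P
    using I(1) by (intro finite_measureI) (simp add: space_point_measure emeasure_point_measure_finite)
  interpret PK: pair_sigma_finite ?P unit_lebesgue ..
  interpret F: finite_measure "?P \<Otimes>\<^sub>M unit_lebesgue"
    by (rule finite_measure_pair_measure) unfold_locales
  have m: "(\<lambda>(i, t). f (\<gamma> i t)) \<in> borel_measurable (?P \<Otimes>\<^sub>M unit_lebesgue)"
    using I f(1) by (intro measurable_mixture) (auto intro: measurable_compose)
  then have i: "integrable (?P \<Otimes>\<^sub>M unit_lebesgue) (\<lambda>(i, t). f (\<gamma> i t))"
    by (intro F.integrable_const_bound[where B = B] AE_I2) (simp_all add: case_prod_beta f(2))
  have "(\<integral>z. f z \<partial>mixture I c \<gamma>) = (\<integral>x. f ((\<lambda>(i, t). \<gamma> i t) x) \<partial>(?P \<Otimes>\<^sub>M unit_lebesgue))"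
    unfolding mixture_def using measurable_mixture[OF I] f(1) by (intro integral_distr) auto
  also have "\<dots> = (\<integral>i. \<integral>t. f (\<gamma> i t) \<partial>unit_lebesgue \<partial>?P)"
    using PK.integral_fst'[OF i] by (simp add: case_prod_unfold)
  also have "\<dots> = (\<Sum>i\<in>I. c i * (\<integral>t. f (\<gamma> i t) \<partial>unit_lebesgue))"
    by (subst lebesgue_integral_point_measure_finite[OF I(1)]) (simp_all add: c)
  finally show ?thesis .
qed

text \<open>\<open>measure_of\<close> retains the prescribed set function only if it is a measure. A
  measure \<open>M\<close> with the same values settles this and identifies the result at
  once.\<close>

lemma measure_of_square_borel:
  assumes "sets M = sets square_borel" "\<And>A. A \<in> sets square_borel \<Longrightarrow> g A = emeasure M A"
  shows "measure_of unit_square (sets square_borel) g = M"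
proof -
  have sp: "space M = unit_square" using sets_eq_imp_space_eq[OF assms(1)] by (simp add: space_restrict_space)
  have "measure_of unit_square (sets square_borel) g = measure_of unit_square (sets square_borel) (emeasure M)"
  proof (rule measure_of_eq)
    show "sets square_borel \<subseteq> Pow unit_square" using sets_square_borel by auto
    fix A assume "A \<in> sigma_sets unit_square (sets square_borel)"
    then have "A \<in> sets square_borel"
      using sets.sigma_sets_eq[of square_borel] by (simp add: space_restrict_space)
    then show "g A = emeasure M A" by (rule assms(2))
  qed
  also have "\<dots> = M" using measure_of_of_measure[of M] unfolding sp assms(1) .
  finally show ?thesis .
qed

section \<open>The limit shapes as mixtures of segments\<close>

definition curve :: "real \<times> real \<Rightarrow> real \<Rightarrow> real \<times> real" where
  "curve P t = (1 - t) *\<^sub>R P + t *\<^sub>R (1/2, 1/2)"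

abbreviation corners :: "(real \<times> real) set" where "corners \<equiv> {0, 1} \<times> {0, 1}"

definition affine_map :: "real \<Rightarrow> real \<Rightarrow> real \<times> real \<Rightarrow> real \<times> real" where
  "affine_map a s z = (a, a) + s *\<^sub>R z"

lemma unit_interval_affine: "a \<ge> 0 \<Longrightarrow> s \<ge> 0 \<Longrightarrow> a + s \<le> 1 \<Longrightarrow> x \<in> {0..1} \<Longrightarrow> a + s * x \<in> {0..1::real}"
  using mult_left_le[of x s] by auto

lemma affine_map_square: "a \<ge> 0 \<Longrightarrow> s \<ge> 0 \<Longrightarrow> a + s \<le> 1 \<Longrightarrow> z \<in> unit_square \<Longrightarrow> affine_map a s z \<in> unit_square"
  using unit_interval_affine[of a s "fst z"] unit_interval_affine[of a s "snd z"]
  by (cases z) (simp add: affine_map_def)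

lemma curve_square: "P \<in> corners \<Longrightarrow> t \<in> {0..1} \<Longrightarrow> curve P t \<in> unit_square"
  by (auto simp: curve_def)

lemma measurable_curve: "P \<in> corners \<Longrightarrow> curve P \<in> unit_lebesgue \<rightarrow>\<^sub>M square_borel"
proof (rule measurable_square_borelI)
  have "curve P \<in> borel_measurable borel" unfolding curve_def
    by (intro borel_measurable_continuous_onI continuous_intros)
  then show "curve P \<in> borel_measurable unit_lebesgue" by (auto intro: measurable_restrict_space1)
qed (simp add: curve_square)

lemma measurable_affine_map:
  assumes "a \<ge> 0" "s \<ge> 0" "a + s \<le> 1" shows "affine_map a s \<in> square_borel \<rightarrow>\<^sub>M square_borel"
proof (rule measurable_square_borelI)
  have "affine_map a s \<in> borel_measurable borel" unfolding affine_map_def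
    by (intro borel_measurable_continuous_onI continuous_intros)
  then show "affine_map a s \<in> borel_measurable square_borel" by (rule measurable_restrict_space1)
qed (use assms affine_map_square in \<open>auto simp: space_restrict_space\<close>)

lemma X_permuton_mixture: "X_permuton = mixture corners (\<lambda>P. 1 / 4) curve"
  unfolding X_permuton_def
proof (rule measure_of_square_borel[OF sets_mixture])
  fix A assume A: "A \<in> sets square_borel"
  have seg: "emeasure (segment_measure P (1/2, 1/2)) A = emeasure unit_lebesgue (curve P -` A \<inter> {0..1})" for P
  proof -
    have m: "curve P \<in> borel_measurable borel" unfolding curve_def
      by (intro borel_measurable_continuous_onI continuous_intros)
    have A': "A \<in> sets borel" using A sets_square_borel by blast
    have s: "curve P -` A \<in> sets borel" using measurable_sets[OF m A'] by simp
    have "emeasure (segment_measure P (1/2, 1/2)) A = emeasure (uniform_measure lborel {0..1}) (curve P -` A \<inter> UNIV)"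
      unfolding segment_measure_def curve_def[abs_def, symmetric]
      using m A' by (subst emeasure_distr) (auto simp: curve_def[abs_def] space_uniform_measure)
    also have "\<dots> = emeasure lborel (curve P -` A \<inter> {0..1})"
      using s by (simp add: emeasure_uniform_measure Int_commute divide_ennreal_def)
    also have "\<dots> = emeasure unit_lebesgue (curve P -` A \<inter> {0..1})"
      by (subst emeasure_restrict_space) auto
    finally show ?thesis .
  qed
  have q: "ennreal (1 / 4) * x = x / 4" for x
  proof -
    have "ennreal (1 / 4) = 1 / 4" by (simp add: divide_ennreal[symmetric])
    then show ?thesis by (simp add: divide_ennreal_def mult.commute)
  qed
  have "emeasure (mixture corners (\<lambda>P. 1 / 4) curve) A
      = (\<Sum>P\<in>corners. ennreal (1 / 4) * emeasure unit_lebesgue (curve P -` A \<inter> {0..1}))"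
    by (rule emeasure_mixture[OF _ measurable_curve A]) auto
  also have "\<dots> = ennreal (1 / 4) * (\<Sum>P\<in>corners. emeasure (segment_measure P (1/2, 1/2)) A)"
    unfolding seg sum_distrib_left ..
  also have "\<dots> = (\<Sum>P\<in>corners. emeasure (segment_measure P (1/2, 1/2)) A) / 4" by (rule q)
  finally show "(\<Sum>P\<in>corners. emeasure (segment_measure P (1/2, 1/2)) A) / 4 = emeasure (mixture corners (\<lambda>P. 1 / 4) curve) A" ..
qed

lemma emeasure_X_permuton:
  assumes "A \<in> sets square_borel"
  shows "emeasure X_permuton A = (\<Sum>P\<in>corners. ennreal (1 / 4) * emeasure unit_lebesgue (curve P -` A \<inter> {0..1}))"
  unfolding X_permuton_mixture by (rule emeasure_mixture[OF _ measurable_curve assms]) auto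

lemma sets_X_permuton: "sets X_permuton = sets square_borel"
  unfolding X_permuton_mixture by (rule sets_mixture)

text \<open>Offset and side length of a diagonal block; \<open>True\<close> stands for the lower
  left one.\<close>

abbreviation block :: "real \<Rightarrow> bool \<Rightarrow> real \<times> real" where
  "block u b \<equiv> (if b then (0, u) else (u, 1 - u))"

lemma emeasure_distr_affine_map:
  assumes "a \<ge> 0" "s \<ge> 0" "a + s \<le> 1" "A \<in> sets square_borel"
  shows "emeasure (distr X_permuton square_borel (affine_map a s)) A = emeasure X_permuton (affine_map a s -` A \<inter> unit_square)"
proof -
  have "affine_map a s \<in> X_permuton \<rightarrow>\<^sub>M square_borel"
    using measurable_affine_map[OF assms(1-3)] by (simp add: measurable_cong_sets[OF sets_X_permuton refl])
  moreover have "space X_permuton = unit_square"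
    using sets_eq_imp_space_eq[OF sets_X_permuton] by (simp add: space_restrict_space)
  ultimately show ?thesis using assms(4) by (simp add: emeasure_distr)
qed

lemma vimage_affine_map_sets:
  assumes "a \<ge> 0" "s \<ge> 0" "a + s \<le> 1" "A \<in> sets square_borel"
  shows "affine_map a s -` A \<inter> unit_square \<in> sets square_borel"
  using measurable_sets[OF measurable_affine_map[OF assms(1-3)] assms(4)] by (simp add: space_restrict_space)

abbreviation XX_curve :: "real \<Rightarrow> (real \<times> real) \<times> bool \<Rightarrow> real \<Rightarrow> real \<times> real" where
  "XX_curve u \<equiv> (\<lambda>(P, b) t. affine_map (fst (block u b)) (snd (block u b)) (curve P t))"

lemma measurable_XX_curve:
  assumes "u \<in> {0..1}" "i \<in> corners \<times> UNIV" shows "XX_curve u i \<in> unit_lebesgue \<rightarrow>\<^sub>M square_borel"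
  using assms by (cases i) (auto intro!: measurable_compose[OF measurable_curve measurable_affine_map])

lemma emeasure_XX_permuton_aux:
  assumes u: "u \<in> {0..1}" and A: "A \<in> sets square_borel"
  shows "ennreal u * emeasure (distr X_permuton square_borel (\<lambda>z. u *\<^sub>R z)) A
        + ennreal (1 - u) * emeasure (distr X_permuton square_borel (\<lambda>z. (u, u) + (1 - u) *\<^sub>R z)) A
    = ennreal u * emeasure X_permuton (affine_map 0 u -` A \<inter> unit_square)
        + ennreal (1 - u) * emeasure X_permuton (affine_map u (1 - u) -` A \<inter> unit_square)"
proof -
  have e: "(\<lambda>z. u *\<^sub>R z) = affine_map 0 u" "(\<lambda>z. (u, u) + (1 - u) *\<^sub>R z) = affine_map u (1 - u)"
    by (auto simp: fun_eq_iff affine_map_def zero_prod_def[symmetric])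
  show ?thesis unfolding e using u A by (simp add: emeasure_distr_affine_map)
qed

lemma emeasure_XX_mixture:
  assumes u: "u \<in> {0..1}" and A: "A \<in> sets square_borel"
  shows "emeasure (mixture (corners \<times> UNIV) (\<lambda>(P, b). snd (block u b) / 4) (XX_curve u)) A
    = ennreal u * emeasure X_permuton (affine_map 0 u -` A \<inter> unit_square)
        + ennreal (1 - u) * emeasure X_permuton (affine_map u (1 - u) -` A \<inter> unit_square)"
proof -
  have X: "ennreal s * emeasure X_permuton (affine_map a s -` A \<inter> unit_square)
      = (\<Sum>P\<in>corners. ennreal (s / 4) * emeasure unit_lebesgue ((\<lambda>t. affine_map a s (curve P t)) -` A \<inter> {0..1}))"
    if "a \<ge> 0" "s \<ge> 0" "a + s \<le> 1" for a s
  proof -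
    have "ennreal s * emeasure X_permuton (affine_map a s -` A \<inter> unit_square)
        = (\<Sum>P\<in>corners. ennreal s * (ennreal (1 / 4) * emeasure unit_lebesgue (curve P -` (affine_map a s -` A \<inter> unit_square) \<inter> {0..1})))"
      unfolding emeasure_X_permuton[OF vimage_affine_map_sets[OF that A]] sum_distrib_left ..
    also have "\<dots> = (\<Sum>P\<in>corners. ennreal (s / 4) * emeasure unit_lebesgue ((\<lambda>t. affine_map a s (curve P t)) -` A \<inter> {0..1}))"
    proof (intro sum.cong refl)
      fix P assume P: "P \<in> corners"
      have "curve P -` (affine_map a s -` A \<inter> unit_square) \<inter> {0..1} = (\<lambda>t. affine_map a s (curve P t)) -` A \<inter> {0..1}"
        using curve_square[OF P] by blast
      moreover have "ennreal s * ennreal (1 / 4) = ennreal (s / 4)"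
        using that(2) by (simp add: ennreal_mult[symmetric])
      ultimately show "ennreal s * (ennreal (1 / 4) * emeasure unit_lebesgue (curve P -` (affine_map a s -` A \<inter> unit_square) \<inter> {0..1}))
          = ennreal (s / 4) * emeasure unit_lebesgue ((\<lambda>t. affine_map a s (curve P t)) -` A \<inter> {0..1})"
        by (simp add: mult.assoc[symmetric])
    qed
    finally show ?thesis .
  qed
  have "emeasure (mixture (corners \<times> UNIV) (\<lambda>(P, b). snd (block u b) / 4) (XX_curve u)) A
      = (\<Sum>i\<in>corners \<times> UNIV. ennreal (case i of (P, b) \<Rightarrow> snd (block u b) / 4) * emeasure unit_lebesgue (XX_curve u i -` A \<inter> {0..1}))"
    by (rule emeasure_mixture[OF _ measurable_XX_curve[OF u] A]) auto
  also have "\<dots> = (\<Sum>P\<in>corners. \<Sum>b\<in>UNIV. ennreal (snd (block u b) / 4) *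
      emeasure unit_lebesgue ((\<lambda>t. affine_map (fst (block u b)) (snd (block u b)) (curve P t)) -` A \<inter> {0..1}))"
    by (simp only: sum.cartesian_product) (auto intro!: sum.cong)
  also have "\<dots> = ennreal u * emeasure X_permuton (affine_map 0 u -` A \<inter> unit_square)
        + ennreal (1 - u) * emeasure X_permuton (affine_map u (1 - u) -` A \<inter> unit_square)"
    using u by (simp only: UNIV_bool) (simp add: X sum.distrib add.commute)
  finally show ?thesis .
qed

lemma XX_permuton_mixture:
  assumes u: "u \<in> {0..1}"
  shows "XX_permuton u = mixture (corners \<times> UNIV) (\<lambda>(P, b). snd (block u b) / 4) (XX_curve u)"
  unfolding XX_permuton_def
  by (rule measure_of_square_borel[OF sets_mixture])
     (simp only: emeasure_XX_permuton_aux[OF u] emeasure_XX_mixture[OF u])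

lemma emeasure_XX_permuton:
  assumes u: "u \<in> {0..1}" and A: "A \<in> sets square_borel"
  shows "emeasure (XX_permuton u) A = ennreal u * emeasure X_permuton (affine_map 0 u -` A \<inter> unit_square)
        + ennreal (1 - u) * emeasure X_permuton (affine_map u (1 - u) -` A \<inter> unit_square)"
  unfolding XX_permuton_mixture[OF u] by (rule emeasure_XX_mixture[OF assms])


section \<open>The limiting permutons\<close>

text \<open>Change of variables along one coordinate of a segment. Slopes of both signs occur, as
  segments start at 0 or at 1; slope 0 occurs for the degenerate blocks at \<open>u = 0\<close> and
  \<open>u = 1\<close>, and then both sides vanish.\<close>

lemma emeasure_affine_vimage:
  fixes B :: "real set"
  assumes B: "B \<in> sets borel"
  shows "ennreal \<bar>c\<bar> * emeasure lborel {t \<in> {0..1}. a + c * t \<in> B} = emeasure lborel (B \<inter> {min a (a + c)..max a (a + c)})"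
proof (cases "c = 0")
  case True
  have "emeasure lborel (B \<inter> {a}) \<le> emeasure lborel {a}" using B by (intro emeasure_mono) auto
  then show ?thesis using True by simp
next
  case False
  let ?S = "B \<inter> {min a (a + c)..max a (a + c)}"
  have S: "?S \<in> sets borel" using B by simp
  have T: "{t \<in> {0..1}. a + c * t \<in> B} \<in> sets borel"
  proof -
    have "(\<lambda>t. a + c * t) \<in> borel_measurable borel" by simp
    from measurable_sets[OF this B] have "(\<lambda>t. a + c * t) -` B \<in> sets borel" by simp
    then have "(\<lambda>t. a + c * t) -` B \<inter> {0..1} \<in> sets borel" by simp
    moreover have "(\<lambda>t. a + c * t) -` B \<inter> {0..1} = {t \<in> {0..1}. a + c * t \<in> B}" by auto
    ultimately show ?thesis by simp
  qed
  have iff: "a + c * t \<in> {min a (a + c)..max a (a + c)} \<longleftrightarrow> t \<in> {0..1}" for t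
  proof (cases "c > 0")
    case True
    then have "c * t \<le> c \<longleftrightarrow> t \<le> 1" "0 \<le> c * t \<longleftrightarrow> 0 \<le> t" by (auto simp: zero_le_mult_iff)
    then show ?thesis using True by (auto simp: min_def max_def)
  next
    case F: False
    then have "c < 0" using False by simp
    then have "c \<le> c * t \<longleftrightarrow> t \<le> 1" "c * t \<le> 0 \<longleftrightarrow> 0 \<le> t" by (auto simp: mult_le_0_iff)
    then show ?thesis using \<open>c < 0\<close> by (auto simp: min_def max_def)
  qed
  have "emeasure lborel ?S = (\<integral>\<^sup>+x. indicator ?S x \<partial>lborel)" using S by simp
  also have "\<dots> = ennreal \<bar>c\<bar> * (\<integral>\<^sup>+x. indicator ?S (a + c * x) \<partial>lborel)"
    using S False by (intro nn_integral_real_affine) auto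
  also have "(\<lambda>x. indicator ?S (a + c * x) :: ennreal) = indicator {t \<in> {0..1}. a + c * t \<in> B}"
    using iff by (intro ext) (auto simp: indicator_def)
  finally show ?thesis using T by simp
qed

lemma emeasure_split_at:
  fixes B :: "real set"
  assumes "B \<in> sets borel" "a \<le> b" "b \<le> c"
  shows "emeasure lborel (B \<inter> {a..b}) + emeasure lborel (B \<inter> {b..c}) = emeasure lborel (B \<inter> {a..c})"
proof -
  have "emeasure lborel (B \<inter> {b..c}) = emeasure lborel (B \<inter> {b<..c})"
  proof (intro emeasure_eq_AE)
    show "AE x in lborel. (x \<in> B \<inter> {b..c}) = (x \<in> B \<inter> {b<..c})"
      using AE_lborel_singleton[of b] by eventually_elim auto
  qed (use assms in auto)
  moreover have "emeasure lborel (B \<inter> {a..b}) + emeasure lborel (B \<inter> {b<..c})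
     = emeasure lborel ((B \<inter> {a..b}) \<union> (B \<inter> {b<..c}))"
    using assms by (intro plus_emeasure) auto
  moreover have "(B \<inter> {a..b}) \<union> (B \<inter> {b<..c}) = B \<inter> {a..c}" using assms by auto
  ultimately show ?thesis by simp
qed

text \<open>In each coordinate two of the four segments run from 0 to 1/2 and two from 1 to 1/2. A
  pair has total weight 1/2 and slope 1/2 in absolute value, so it puts exactly Lebesgue measure on
  its half of the interval.\<close>

lemma X_permuton_marginal:
  assumes pr: "pr = fst \<or> pr = snd" and B: "B \<in> sets borel"
  shows "emeasure X_permuton {z \<in> unit_square. pr z \<in> B} = emeasure lborel (B \<inter> {0..1})"
proof -
  define e where "e p = emeasure unit_lebesgue {t \<in> {0..1}. (1 - t) * p + t / 2 \<in> B}" for p :: real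
  have e: "e p = emeasure lborel {t \<in> {0..1}. (1 - t) * p + t / 2 \<in> B}" for p
    unfolding e_def by (subst emeasure_restrict_space) auto
  have prc: "pr (curve P t) = (1 - t) * pr P + t / 2" for P t using pr by (auto simp: curve_def)
  have "emeasure X_permuton {z \<in> unit_square. pr z \<in> B} = (\<Sum>P\<in>corners. ennreal (1 / 4) * e (pr P))"
    unfolding emeasure_X_permuton[OF coordinate_sets[OF assms]]
  proof (intro sum.cong refl)
    fix P assume P: "P \<in> corners"
    have "curve P -` {z \<in> unit_square. pr z \<in> B} \<inter> {0..1} = {t \<in> {0..1}. (1 - t) * pr P + t / 2 \<in> B}"
      using curve_square[OF P] prc by auto
    then show "ennreal (1 / 4) * emeasure unit_lebesgue (curve P -` {z \<in> unit_square. pr z \<in> B} \<inter> {0..1}) = ennreal (1 / 4) * e (pr P)"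
      by (simp add: e_def)
  qed
  also have "\<dots> = ennreal (1 / 2) * e 0 + ennreal (1 / 2) * e 1"
  proof -
    have h: "ennreal (1 / 4) * x + ennreal (1 / 4) * x = ennreal (1 / 2) * x" for x
      unfolding distrib_right[symmetric] by (subst ennreal_plus[symmetric]) auto
    have "(\<Sum>P\<in>corners. ennreal (1 / 4) * e (pr P))
       = (ennreal (1 / 4) * e 0 + ennreal (1 / 4) * e 0) + (ennreal (1 / 4) * e 1 + ennreal (1 / 4) * e 1)"
      using pr by (auto simp: sum.cartesian_product[symmetric] add_ac)
    then show ?thesis unfolding h .
  qed
  also have "ennreal (1 / 2) * e 0 = emeasure lborel (B \<inter> {0..1/2})"
    using emeasure_affine_vimage[OF B, of "1/2" 0] by (simp add: e)
  also have "ennreal (1 / 2) * e 1 = emeasure lborel (B \<inter> {1/2..1})"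
  proof -
    have "(1 - t) * 1 + t / 2 = 1 + (- 1 / 2) * t" for t :: real by (simp add: field_simps)
    then show ?thesis using emeasure_affine_vimage[OF B, of "-1/2" 1] by (simp add: e)
  qed
  also have "emeasure lborel (B \<inter> {0..1/2}) + emeasure lborel (B \<inter> {1/2..1}) = emeasure lborel (B \<inter> {0..1})"
    by (rule emeasure_split_at[OF B]) auto
  finally show ?thesis .
qed

lemma XX_permuton_marginal:
  assumes pr: "pr = fst \<or> pr = snd" and B: "B \<in> sets borel" and u: "u \<in> {0..1}"
  shows "emeasure (XX_permuton u) {z \<in> unit_square. pr z \<in> B} = emeasure lborel (B \<inter> {0..1})"
proof -
  have E: "ennreal s * emeasure X_permuton (affine_map a s -` {z \<in> unit_square. pr z \<in> B} \<inter> unit_square)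
      = emeasure lborel (B \<inter> {a..a + s})" if as: "a \<ge> 0" "s \<ge> 0" "a + s \<le> 1" for a s
  proof -
    have m: "(\<lambda>x. a + s * x) -` B \<in> sets borel"
      using measurable_sets[of "\<lambda>x. a + s * x" borel borel B] B by simp
    have "pr (affine_map a s z) = a + s * pr z" for z using pr by (cases z) (auto simp: affine_map_def)
    then have "affine_map a s -` {z \<in> unit_square. pr z \<in> B} \<inter> unit_square = {z \<in> unit_square. pr z \<in> (\<lambda>x. a + s * x) -` B}"
      using affine_map_square[OF as] by auto
    then have "emeasure X_permuton (affine_map a s -` {z \<in> unit_square. pr z \<in> B} \<inter> unit_square)
        = emeasure lborel ((\<lambda>x. a + s * x) -` B \<inter> {0..1})"
      using X_permuton_marginal[OF pr m] by simp
    also have "(\<lambda>x. a + s * x) -` B \<inter> {0..1} = {t \<in> {0..1}. a + s * t \<in> B}" by auto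
    finally show ?thesis using emeasure_affine_vimage[OF B, of s a] as by simp
  qed
  have "emeasure (XX_permuton u) {z \<in> unit_square. pr z \<in> B}
     = emeasure lborel (B \<inter> {0..0 + u}) + emeasure lborel (B \<inter> {u..u + (1 - u)})"
    unfolding emeasure_XX_permuton[OF u coordinate_sets[OF pr B]] using u by (subst (1 2) E) auto
  then show ?thesis using emeasure_split_at[OF B, of 0 u 1] u by simp
qed

lemma XX_permuton_permuton: "u \<in> {0..1} \<Longrightarrow> XX_permuton u \<in> permutons"
  by (rule permutonI) (simp_all add: XX_permuton_marginal XX_permuton_mixture[THEN arg_cong[where f = sets]] sets_mixture)

text \<open>The mean of \<open>f\<close> over the X shape moved to a block, with total weight one
  whatever the side \<open>s\<close>; the mass of the block enters separately.\<close>

definition X_average :: "(real \<times> real \<Rightarrow> real) \<Rightarrow> real \<Rightarrow> real \<Rightarrow> real" where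
  "X_average f a s = (\<Sum>P\<in>corners. \<integral>t. f (affine_map a s (curve P t)) \<partial>unit_lebesgue) / 4"

lemma continuous_affine_curve:
  "continuous_on UNIV f \<Longrightarrow> continuous_on A (\<lambda>t. f (affine_map a s (curve P t)))"
  by (rule continuous_on_compose2[where t = UNIV and g = f])
     (auto simp: affine_map_def curve_def intro!: continuous_intros)

lemma integral_XX_permuton:
  assumes f: "lipschitz_test f" and u: "u \<in> {0..1}"
  shows "(\<integral>z. f z \<partial>XX_permuton u) = u * X_average f 0 u + (1 - u) * X_average f u (1 - u)"
proof -
  obtain B where B: "\<And>z. \<bar>f z\<bar> \<le> B" using f unfolding lipschitz_test_def by blast
  have "f \<in> borel_measurable borel"
    by (intro borel_measurable_continuous_onI lipschitz_test_continuous f)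
  then have m: "f \<in> borel_measurable square_borel" by (rule measurable_restrict_space1)
  have "(\<integral>z. f z \<partial>XX_permuton u) = (\<Sum>i\<in>corners \<times> UNIV. (case i of (P, b) \<Rightarrow> snd (block u b) / 4)
      * (\<integral>t. f (XX_curve u i t) \<partial>unit_lebesgue))"
    unfolding XX_permuton_mixture[OF u] using u
    by (intro integral_mixture[OF _ measurable_XX_curve[OF u] _ m B]) (auto split: if_splits)
  also have "\<dots> = (\<Sum>P\<in>corners. \<Sum>b\<in>UNIV. snd (block u b) / 4
      * (\<integral>t. f (affine_map (fst (block u b)) (snd (block u b)) (curve P t)) \<partial>unit_lebesgue))"
    by (simp only: sum.cartesian_product) (auto intro!: sum.cong)
  also have "\<dots> = u * X_average f 0 u + (1 - u) * X_average f u (1 - u)"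
    by (simp only: UNIV_bool) (simp add: X_average_def sum.distrib sum_distrib_left sum_divide_distrib add_divide_distrib distrib_left add_ac mult_ac)
  finally show ?thesis .
qed

lemma integral_unit_lebesgue:
  fixes h :: "real \<Rightarrow> real"
  assumes "continuous_on {0..1} h"
  shows "(\<integral>t. h t \<partial>unit_lebesgue) = integral {0..1} h"
proof -
  have "(\<integral>t. h t \<partial>unit_lebesgue) = (LINT t:{0..1}|lborel. h t)"
    unfolding set_lebesgue_integral_def by (rule integral_restrict_space) simp
  also have "\<dots> = integral {0..1} h"
    by (intro set_borel_integral_eq_integral(2) borel_integrable_atLeastAtMost' assms)
  finally show ?thesis .
qed

lemma continuous_X_average:
  assumes f: "continuous_on UNIV f" and a: "continuous_on {0..1} a" and s: "continuous_on {0..1} s"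
  shows "continuous_on {0..1} (\<lambda>u. X_average f (a u) (s u))"
proof -
  have "continuous_on {0..1} (\<lambda>u. \<integral>t. f (affine_map (a u) (s u) (curve P t)) \<partial>unit_lebesgue)" for P
  proof -
    have "continuous_on ({0..1} \<times> cbox 0 1) (\<lambda>(u, t). f (affine_map (a u) (s u) (curve P t)))"
      unfolding affine_map_def curve_def case_prod_beta
      by (rule continuous_on_compose2[OF f])
         (auto intro!: continuous_intros continuous_on_compose2[OF a] continuous_on_compose2[OF s])
    then have "continuous_on {0..1} (\<lambda>u. integral (cbox 0 1) (\<lambda>t. f (affine_map (a u) (s u) (curve P t))))"
      by (rule integral_continuous_on_param)
    then show ?thesis by (simp add: integral_unit_lebesgue continuous_affine_curve f)
  qed
  then show ?thesis unfolding X_average_def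
    by (intro continuous_on_divide continuous_on_sum continuous_on_const) auto
qed

interpretation XX: permuton_path XX_permuton
proof
  fix f assume f: "lipschitz_test f"
  have "continuous_on {0..1} (\<lambda>u. u * X_average f 0 u + (1 - u) * X_average f u (1 - u))"
    by (intro continuous_intros continuous_X_average lipschitz_test_continuous f)
  then show "continuous_on {0..1} (\<lambda>u. \<integral>z. f z \<partial>XX_permuton u)"
    using integral_XX_permuton[OF f] by (subst continuous_on_cong[OF refl]) auto
qed (rule XX_permuton_permuton)


section \<open>Permutons of balanced permutations\<close>

text \<open>Abel summation: \<open>e\<close> enters only through its partial sums, and
  \<open>h\<close> through its increments. The induction carries the boundary term
  \<open>(\<Sum>i<m. e i) * h m\<close> along, which is estimated at the end.\<close>

lemma summation_by_parts_bound:
  fixes e h :: "nat \<Rightarrow> real"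
  assumes "\<And>t. t \<le> n \<Longrightarrow> \<bar>\<Sum>i<t. e i\<bar> \<le> d" "\<And>t. t < n \<Longrightarrow> \<bar>h (Suc t) - h t\<bar> \<le> c" "\<bar>h n\<bar> \<le> B"
  shows "\<bar>\<Sum>t<n. e t * h t\<bar> \<le> d * (B + n * c)"
proof -
  have "\<bar>(\<Sum>t<m. e t * h t) - (\<Sum>i<m. e i) * h m\<bar> \<le> d * (m * c)" if "m \<le> n" for m
    using that
  proof (induction m)
    case (Suc m)
    have "\<bar>(\<Sum>i<Suc m. e i) * (h m - h (Suc m))\<bar> \<le> d * c"
      unfolding abs_mult using assms(1)[of "Suc m"] assms(2)[of m] Suc.prems
      by (intro mult_mono) (auto simp: abs_minus_commute)
    moreover have "(\<Sum>t<Suc m. e t * h t) - (\<Sum>i<Suc m. e i) * h (Suc m)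
        = ((\<Sum>t<m. e t * h t) - (\<Sum>i<m. e i) * h m) + (\<Sum>i<Suc m. e i) * (h m - h (Suc m))"
      by (simp add: algebra_simps)
    moreover have "d * (real (Suc m) * c) = d * (m * c) + d * c" by (simp add: algebra_simps)
    ultimately show ?case using Suc.IH Suc.prems by linarith
  qed simp
  from this[of n] have 1: "\<bar>(\<Sum>t<n. e t * h t) - (\<Sum>i<n. e i) * h n\<bar> \<le> d * (n * c)" by simp
  have d0: "0 \<le> d" using assms(1)[of 0] by simp
  have "\<bar>(\<Sum>i<n. e i) * h n\<bar> \<le> d * B"
    unfolding abs_mult using assms(1)[of n] assms(3) d0 by (intro mult_mono) auto
  then show ?thesis using 1 by (simp add: distrib_left)
qed

text \<open>On each of the \<open>n\<close> subintervals \<open>h\<close> is compared with its value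
  at the left endpoint, at a cost of \<open>\<omega> / n\<close>.\<close>

lemma riemann_sum_bound:
  fixes h :: "real \<Rightarrow> real"
  assumes h: "continuous_on {0..1} h" and n: "n > 0"
    and w: "\<And>x y. x \<in> {0..1} \<Longrightarrow> y \<in> {0..1} \<Longrightarrow> \<bar>x - y\<bar> \<le> 1 / real n \<Longrightarrow> \<bar>h x - h y\<bar> \<le> \<omega>"
  shows "\<bar>(\<Sum>t<n. h (real t / n)) / n - integral {0..1} h\<bar> \<le> \<omega>"
proof -
  have int: "h integrable_on {a..b}" if "0 \<le> a" "b \<le> 1" for a b
    using h that by (intro integrable_continuous_interval) (auto intro: continuous_on_subset)
  have "\<bar>(\<Sum>t<m. h (real t / n)) / n - integral {0..real m / n} h\<bar> \<le> \<omega> * m / n" if "m \<le> n" for m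
    using that
  proof (induction m)
    case (Suc m)
    let ?a = "real m / n" and ?b = "real (Suc m) / n"
    have ab: "0 \<le> ?a" "?a \<le> ?b" "?b \<le> 1" "?b - ?a = 1 / n"
      using Suc.prems n by (auto simp: divide_right_mono diff_divide_distrib[symmetric])
    have "\<bar>integral {?a..?b} h - integral {?a..?b} (\<lambda>_. h ?a)\<bar> \<le> \<omega> * (?b - ?a)"
    proof -
      have "\<bar>integral {?a..?b} h - integral {?a..?b} (\<lambda>_. h ?a)\<bar> = norm (integral {?a..?b} (\<lambda>x. h x - h ?a))"
        using int[OF ab(1,3)] by (subst integral_diff) (auto intro: integrable_const_ivl)
      also have "\<dots> \<le> \<omega> * (?b - ?a)"
      proof (rule integral_bound)
        show "continuous_on {?a..?b} (\<lambda>x. h x - h ?a)"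
          using ab by (intro continuous_intros continuous_on_subset[OF h]) auto
        fix x assume "x \<in> {?a..?b}"
        then have "?a \<le> x" "x \<le> ?b" by (simp_all only: atLeastAtMost_iff)
        then have "x \<in> {0..1}" "?a \<in> {0..1}" "\<bar>x - ?a\<bar> \<le> 1 / n"
          using ab unfolding atLeastAtMost_iff by linarith+
        then show "norm (h x - h ?a) \<le> \<omega>" unfolding real_norm_def by (rule w)
      qed (use ab in auto)
      finally show ?thesis .
    qed
    moreover have "integral {?a..?b} (\<lambda>_. h ?a) = h ?a / n" using ab by simp
    moreover have "integral {0..?b} h = integral {0..?a} h + integral {?a..?b} h"
      using Henstock_Kurzweil_Integration.integral_combine[OF ab(1,2) int[OF _ ab(3)]] by simp
    moreover have "\<omega> * real (Suc m) / n = \<omega> * m / n + \<omega> * (1 / n)"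
      by (simp add: add_divide_distrib distrib_left)
    moreover have "(\<Sum>t<Suc m. h (real t / n)) / n = (\<Sum>t<m. h (real t / n)) / n + h ?a / n"
      by (simp add: add_divide_distrib)
    ultimately show ?case using Suc.IH Suc.prems ab(4) by simp
  qed simp
  from this[of n] show ?thesis using n by simp
qed

lemma count_list_take_sum:
  "t \<le> length bs \<Longrightarrow> 2 * real (count_list (take t bs) False) = t + (\<Sum>i<t. if bs ! i then - 1 else 1)"
proof (induction t)
  case (Suc t)
  then show ?case by (simp add: take_Suc_conv_app_nth)
qed simp

text \<open>The idealisation of \<open>pos\<close> in which exactly half of the \<open>t\<close>
  earlier letters lie on the low side.\<close>

definition path_pos :: "nat \<Rightarrow> bool \<Rightarrow> nat \<Rightarrow> real" where
  "path_pos n b t = (if b then n - t / 2 else t / 2)"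

text \<open>Twice the number of earlier low letters is \<open>t\<close> plus a signed sum, so the
  number is within \<open>d / 2\<close> of \<open>t / 2\<close>. The extra 1 is the starting value
  of low positions.\<close>

lemma pos_near_path:
  assumes "t < length bs" "\<bar>\<Sum>i<t. if bs ! i then - 1 else 1 :: real\<bar> \<le> d"
  shows "\<bar>real (pos bs t) - path_pos (length bs) (bs ! t) t\<bar> \<le> d / 2 + 1"
  using count_list_take_sum[of t bs] assms unfolding pos_def path_pos_def
  by (auto simp: of_nat_diff field_simps abs_le_iff split: if_splits)

definition corner_point :: "bool \<times> bool \<Rightarrow> real \<times> real" where
  "corner_point l = (if fst l then 1 else 0, if snd l then 1 else 0)"

lemma bij_corner_point: "bij_betw corner_point UNIV corners"
proof (rule bij_betwI')
  fix P :: "real \<times> real" assume "P \<in> corners"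
  then show "\<exists>l\<in>UNIV. P = corner_point l"
    by (auto simp: corner_point_def intro: exI[of _ True] exI[of _ False])
qed (auto simp: corner_point_def prod_eq_iff split: if_splits)

text \<open>Fourier inversion on the four-element group of corners.\<close>

lemma indicator_chi:
  "(if l = l' then 1 else 0 :: real) = (1 + chi_x l * chi_x l' + chi_y l * chi_y l' + chi_xy l * chi_xy l') / 4"
  by (cases l; cases l') (auto simp: chi_x_def chi_y_def chi_xy_def)

lemma dist_le_coordinates: "dist (x, y) (x', y') \<le> \<bar>x - x'\<bar> + \<bar>y - y'\<bar>" for x y :: real
  unfolding dist_Pair_Pair dist_real_def by (rule sqrt_sum_squares_le_sum) auto

context
  fixes f :: "real \<times> real \<Rightarrow> real" and B L :: real
  assumes fB: "\<And>z. \<bar>f z\<bar> \<le> B" and fL: "\<And>z z'. \<bar>f z - f z'\<bar> \<le> L * dist z z'"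
begin

lemma L_nonneg: "L \<ge> 0"
  using fL[of "(0, 0)" "(1, 0)"] by (simp add: dist_Pair_Pair)

lemma B_nonneg: "B \<ge> 0"
  using fB[of undefined] by linarith

lemma f_diff_le: "\<bar>x - x'\<bar> \<le> r \<Longrightarrow> \<bar>y - y'\<bar> \<le> r \<Longrightarrow> \<bar>f (x, y) - f (x', y')\<bar> \<le> L * (2 * r)"
proof -
  assume "\<bar>x - x'\<bar> \<le> r" "\<bar>y - y'\<bar> \<le> r"
  then have "dist (x, y) (x', y') \<le> 2 * r" using dist_le_coordinates[of x y x' y'] by linarith
  from mult_left_mono[OF this L_nonneg] show ?thesis using fL[of "(x, y)" "(x', y')"] by linarith
qed

lemma is_lipschitz_test: "lipschitz_test f"
  unfolding lipschitz_test_def using fB fL by blast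

lemma affine_curve_diff:
  assumes "P \<in> corners" "s \<ge> 0"
  shows "\<bar>f (affine_map a s (curve P t)) - f (affine_map a s (curve P t'))\<bar> \<le> L * (s * \<bar>t - t'\<bar>)"
proof -
  have c: "\<bar>(a + s * ((1 - t) * p + t * (1 / 2))) - (a + s * ((1 - t') * p + t' * (1 / 2)))\<bar> \<le> s * \<bar>t - t'\<bar> / 2"
    if "p \<in> {0, 1}" for p
  proof -
    have "(a + s * ((1 - t) * p + t * (1 / 2))) - (a + s * ((1 - t') * p + t' * (1 / 2))) = s * ((t - t') * (1 / 2 - p))"
      by (simp add: field_simps)
    also have "\<bar>\<dots>\<bar> = s * \<bar>t - t'\<bar> / 2" using that assms(2) by (auto simp: abs_mult)
    finally show ?thesis by simp
  qed
  show ?thesis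
    using f_diff_le[OF c[of "fst P"] c[of "snd P"]] assms(1)
    by (cases P) (auto simp: affine_map_def curve_def)
qed

text \<open>Three replacements are made: the actual points by points on the four segments, the
  letter at time \<open>t\<close> by the average over all letters, and Riemann sums by integrals.
  They cost \<open>L * (d + 2)\<close>, \<open>3 * (d * (B + L))\<close> and
  \<open>L\<close>.\<close>

lemma balanced_sum_estimate:
  assumes w: "balanced d w" and N: "a + length w \<le> N" "N > 0"
  shows "\<bar>(\<Sum>i<length w. f (real (a + Suc i) / N, real (a + perm_of w ! i) / N))
     - length w * X_average f (real a / N) (real (length w) / N)\<bar> \<le> (4 * L + 3 * B) * d + 3 * L"
proof (cases "length w = 0")
  case True
  have "0 \<le> d" using w unfolding balanced_def by (auto dest: spec[of _ 0])
  then show ?thesis using True L_nonneg B_nonneg by simp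
next
  case False
  let ?n = "length w" and ?xs = "map fst w" and ?ys = "map snd w"
  define s where "s = real ?n / N"
  define b where "b = real a / N"
  have s: "0 \<le> s" "s \<le> 1" using N by (auto simp: s_def)
  define g where "g l r = f (affine_map b s (curve (corner_point l) r))" for l r
  let ?P = "\<Sum>t<?n. f (real (a + pos ?xs t) / N, real (a + pos ?ys t) / N)"
    and ?Q = "\<Sum>t<?n. g (w ! t) (real t / ?n)"
  let ?R = "\<lambda>l. \<Sum>t<?n. g l (real t / ?n)"
  have cp: "corner_point l \<in> corners" for l by (auto simp: corner_point_def)
  have d: "\<bar>\<Sum>i<t. \<psi> (w ! i)\<bar> \<le> d" if "\<psi> \<in> {chi_x, chi_y, chi_xy}" "t \<le> ?n" for \<psi> t
    using w that unfolding balanced_def by blast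
  have d0: "0 \<le> d" using d[of chi_x 0] by simp
  have "(\<Sum>i<?n. f (real (a + Suc i) / N, real (a + perm_of w ! i) / N))
      = ?P"
    by (rule sum_perm_of)
  \<comment> \<open>Both coordinates are off by at most \<open>(d / 2 + 1) / N\<close>; summing over
    the letters leaves a factor \<open>length w / N\<close>, at most one.\<close>
  moreover have "\<bar>?P - ?Q\<bar> \<le> L * (d + 2)"
  proof -
    have "\<bar>f (real (a + pos ?xs t) / N, real (a + pos ?ys t) / N) - g (w ! t) (real t / ?n)\<bar> \<le> L * (2 * ((d / 2 + 1) / N))" if t: "t < ?n" for t
    proof -
      have near: "\<bar>real (pos (map p w) t) - path_pos ?n (p (w ! t)) t\<bar> \<le> d / 2 + 1"
        if "\<psi> \<in> {chi_x, chi_y}" "\<And>l. \<psi> l = (if p l then - 1 else 1)" for p \<psi>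
      proof -
        have "(\<Sum>i<t. if map p w ! i then - 1 else 1) = (\<Sum>i<t. \<psi> (w ! i))"
          using t by (intro sum.cong refl) (simp add: that(2))
        then show ?thesis using pos_near_path[of t "map p w" d] d[of \<psi> t] t that(1) by auto
      qed
      have close: "\<bar>real (a + k) / N - (real a + y) / N\<bar> \<le> (d / 2 + 1) / N" if "\<bar>real k - y\<bar> \<le> d / 2 + 1" for k y
        using N(2) that by (simp add: diff_divide_distrib[symmetric] abs_divide divide_right_mono)
      \<comment> \<open>The idealised position lies exactly on the rescaled segment from the corner
        to the centre, at parameter \<open>t / length w\<close>.\<close>
      have "(real a + path_pos ?n c t) / N = b + s * ((1 - real t / ?n) * (if c then 1 else 0) + real t / ?n * (1 / 2))" for c
        using False N(2) unfolding path_pos_def b_def s_def by (auto simp: field_simps)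
      then have "g (w ! t) (real t / ?n) = f ((real a + path_pos ?n (fst (w ! t)) t) / N, (real a + path_pos ?n (snd (w ! t)) t) / N)"
        by (simp add: g_def affine_map_def curve_def corner_point_def)
      then show ?thesis
        using f_diff_le[OF close[OF near[of chi_x fst]] close[OF near[of chi_y snd]]]
        by (simp add: chi_x_def chi_y_def)
    qed
    then have "\<bar>?P - ?Q\<bar>
       \<le> (\<Sum>t<?n. L * (2 * ((d / 2 + 1) / N)))"
      unfolding sum_subtractf[symmetric] by (intro order_trans[OF sum_abs] sum_mono) auto
    also have "\<dots> = L * (d + 2) * s" by (simp add: s_def mult_ac)
    also have "\<dots> \<le> L * (d + 2)" using s L_nonneg d0 by (intro mult_left_le) auto
    finally show ?thesis .
  qed
  \<comment> \<open>Expanded into characters by \<open>indicator_chi\<close>, the trivial one yields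
    the average over the corners. The other three have small partial sums along \<open>w\<close>,
    while \<open>g l\<close> changes by at most \<open>L / length w\<close> per step, so summation
    by parts applies.\<close>
  moreover have "\<bar>?Q - (\<Sum>l\<in>UNIV. ?R l) / 4\<bar> \<le> 3 * (d * (B + L))"
  proof -
    define A where "A \<psi> l = (\<Sum>t<?n. \<psi> (w ! t) * g l (real t / ?n))" for \<psi> :: "bool \<times> bool \<Rightarrow> real" and l
    have A: "\<bar>A \<psi> l\<bar> \<le> d * (B + L)" if "\<psi> \<in> {chi_x, chi_y, chi_xy}" for \<psi> l
    proof -
      have "\<bar>g l (real (Suc t) / ?n) - g l (real t / ?n)\<bar> \<le> L / ?n" for t
      proof -
        have "\<bar>g l (real (Suc t) / ?n) - g l (real t / ?n)\<bar> \<le> L * (s * (1 / ?n))"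
          using affine_curve_diff[OF cp s(1), of b l "real (Suc t) / ?n" "real t / ?n"]
          unfolding g_def by (simp add: diff_divide_distrib[symmetric])
        also have "\<dots> \<le> L * (1 * (1 / ?n))" using s L_nonneg by (intro mult_left_mono mult_right_mono) auto
        finally show ?thesis by simp
      qed
      then have "\<bar>A \<psi> l\<bar> \<le> d * (B + ?n * (L / ?n))"
        unfolding A_def using d[OF that] fB by (intro summation_by_parts_bound) (auto simp: g_def)
      then show ?thesis using False by simp
    qed
    have "?Q = (\<Sum>t<?n. \<Sum>l\<in>UNIV. (if l = w ! t then 1 else 0) * g l (real t / ?n))"
    proof (intro sum.cong refl)
      fix t
      have "(\<Sum>l\<in>UNIV. (if l = w ! t then 1 else 0) * g l (real t / ?n)) = (\<Sum>l\<in>UNIV. if l = w ! t then g (w ! t) (real t / ?n) else 0)"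
        by (intro sum.cong) auto
      then show "g (w ! t) (real t / ?n) = (\<Sum>l\<in>UNIV. (if l = w ! t then 1 else 0) * g l (real t / ?n))" by simp
    qed
    also have "\<dots> = (\<Sum>l\<in>UNIV. \<Sum>t<?n. (if l = w ! t then 1 else 0) * g l (real t / ?n))"
      by (rule sum.swap)
    also have "\<dots> = (\<Sum>l\<in>UNIV. (?R l + (chi_x l * A chi_x l + chi_y l * A chi_y l + chi_xy l * A chi_xy l)) / 4)"
      unfolding A_def sum_distrib_left sum.distrib[symmetric] sum_divide_distrib
      by (intro sum.cong refl) (simp add: indicator_chi field_simps)
    also have "\<dots> = (\<Sum>l\<in>UNIV. ?R l) / 4 + (\<Sum>l\<in>UNIV. chi_x l * A chi_x l + chi_y l * A chi_y l + chi_xy l * A chi_xy l) / 4"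
      by (simp add: sum_divide_distrib[symmetric] sum.distrib add_divide_distrib)
    finally have "\<bar>?Q - (\<Sum>l\<in>UNIV. ?R l) / 4\<bar>
      = \<bar>\<Sum>l\<in>UNIV. chi_x l * A chi_x l + chi_y l * A chi_y l + chi_xy l * A chi_xy l\<bar> / 4" by simp
    moreover have "\<bar>\<Sum>l\<in>UNIV. chi_x l * A chi_x l + chi_y l * A chi_y l + chi_xy l * A chi_xy l\<bar> \<le> (\<Sum>l\<in>(UNIV :: (bool \<times> bool) set). 3 * (d * (B + L)))"
    proof (intro order_trans[OF sum_abs] sum_mono)
      fix l
      have one: "\<bar>\<psi> l * A \<psi> l\<bar> \<le> d * (B + L)" if "\<psi> \<in> {chi_x, chi_y, chi_xy}" for \<psi>
      proof -
        have "\<bar>\<psi> l\<bar> = 1" using that by (auto simp: chi_x_def chi_y_def chi_xy_def)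
        then show ?thesis using A[OF that] by (simp add: abs_mult)
      qed
      show "\<bar>chi_x l * A chi_x l + chi_y l * A chi_y l + chi_xy l * A chi_xy l\<bar> \<le> 3 * (d * (B + L))"
        using one[of chi_x] one[of chi_y] one[of chi_xy] by simp
    qed
    moreover have "(\<Sum>l\<in>(UNIV :: (bool \<times> bool) set). 3 * (d * (B + L))) = 4 * (3 * (d * (B + L)))"
      unfolding UNIV_corner by simp
    ultimately show ?thesis by linarith
  qed
  moreover have "\<bar>(\<Sum>l\<in>UNIV. ?R l) / 4 - ?n * X_average f b s\<bar> \<le> L"
  proof -
    have R: "\<bar>?R l / ?n - integral {0..1} (g l)\<bar> \<le> L / ?n" for l
    proof (rule riemann_sum_bound)
      show "continuous_on {0..1} (g l)"
        unfolding g_def[abs_def] by (intro continuous_affine_curve lipschitz_test_continuous is_lipschitz_test)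
      fix x y :: real assume "\<bar>x - y\<bar> \<le> 1 / ?n"
      then have "s * \<bar>x - y\<bar> \<le> 1 * (1 / ?n)" using s by (intro mult_mono) auto
      from mult_left_mono[OF this L_nonneg] affine_curve_diff[OF cp s(1), of b l x y]
      show "\<bar>g l x - g l y\<bar> \<le> L / ?n" by (simp add: g_def)
    qed (use False in simp)
    have "X_average f b s = (\<Sum>l\<in>UNIV. integral {0..1} (g l)) / 4"
      unfolding X_average_def g_def
      by (subst sum.reindex_bij_betw[OF bij_corner_point, symmetric])
         (simp add: integral_unit_lebesgue continuous_affine_curve lipschitz_test_continuous is_lipschitz_test)
    moreover have "?n * (S / ?n - I) = S - ?n * I" for S I :: real using False by (simp add: right_diff_distrib)
    ultimately have "(\<Sum>l\<in>UNIV. ?R l) / 4 - ?n * X_average f b s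
       = (\<Sum>l\<in>UNIV. ?n * (?R l / ?n - integral {0..1} (g l))) / 4"
      by (simp only: sum_subtractf sum_distrib_left[symmetric] diff_divide_distrib times_divide_eq_right)
    also have "\<bar>\<dots>\<bar> \<le> (\<Sum>l\<in>(UNIV :: (bool \<times> bool) set). L) / 4"
    proof -
      have "\<bar>?n * (?R l / ?n - integral {0..1} (g l))\<bar> \<le> L" for l
        using mult_left_mono[OF R[of l], of ?n] False by (simp add: abs_mult)
      then have "\<bar>\<Sum>l\<in>UNIV. ?n * (?R l / ?n - integral {0..1} (g l))\<bar>
          \<le> (\<Sum>l\<in>(UNIV :: (bool \<times> bool) set). L)"
        by (intro order_trans[OF sum_abs] sum_mono)
      from divide_right_mono[OF this, of 4] show ?thesis by (simp only: abs_divide abs_numeral)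
    qed
    also have "\<dots> = L" unfolding UNIV_corner by simp
    finally show ?thesis .
  qed
  moreover have "L * (d + 2) + 3 * (d * (B + L)) + L = (4 * L + 3 * B) * d + 3 * L" by (simp add: algebra_simps)
  ultimately show ?thesis unfolding b_def s_def by linarith
qed

lemma sum_lessThan_add: "(\<Sum>i<k + m. F i) = (\<Sum>i<k. F i) + (\<Sum>i<m. F (k + i))" for F :: "nat \<Rightarrow> real"
  by (induction m) (auto simp: add.assoc)

text \<open>The two blocks are estimated separately, with offsets 0 and
  \<open>length \<sigma>\<close> in the common square of side \<open>N\<close>. Passing from the
  permuton to the sum over its points adds \<open>2 * L / N\<close>.\<close>

lemma direct_sum_estimate:
  assumes \<sigma>: "\<sigma> \<in> X_class" "\<sigma> \<in> balanced_perms d" and \<tau>: "\<tau> \<in> X_class" "\<tau> \<in> balanced_perms d"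
    and N: "N = length \<sigma> + length \<tau>"
  shows "\<bar>(\<integral>z. f z \<partial>permuton_of (direct_sum \<sigma> \<tau>)) - (\<integral>z. f z \<partial>XX_permuton (length \<sigma> / N))\<bar>
     \<le> ((8 * L + 6 * B) * d + 8 * L) / N"
proof -
  let ?\<pi> = "direct_sum \<sigma> \<tau>" and ?k = "length \<sigma>" and ?m = "length \<tau>"
  have N0: "N > 0" using N X_class_perms[OF \<sigma>(1)] by (auto simp: perms_iff)
  obtain v w where v: "perm_of v = \<sigma>" "balanced d v" and w: "perm_of w = \<tau>" "balanced d w"
    using \<sigma>(2) \<tau>(2) unfolding balanced_perms_def by blast
  have len: "length v = ?k" "length w = ?m" using v(1) w(1) by auto
  let ?F = "\<lambda>i. f (real (Suc i) / N, real (?\<pi> ! i) / N)"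
  have "(\<Sum>i<N. ?F i) = (\<Sum>i<?k. ?F i) + (\<Sum>i<?m. ?F (?k + i))"
    using sum_lessThan_add[of ?F ?k ?m] unfolding N[symmetric] .
  also have "(\<Sum>i<?k. ?F i) = (\<Sum>i<length v. f (real (0 + Suc i) / N, real (0 + perm_of v ! i) / N))"
    unfolding len v(1) by (intro sum.cong refl) (simp add: direct_sum_def nth_append)
  also have "(\<Sum>i<?m. ?F (?k + i)) = (\<Sum>i<length w. f (real (?k + Suc i) / N, real (?k + perm_of w ! i) / N))"
    unfolding len w(1) by (intro sum.cong refl) (simp add: direct_sum_def nth_append add.commute)
  finally have sum: "(\<Sum>i<N. ?F i) = (\<Sum>i<length v. f (real (0 + Suc i) / N, real (0 + perm_of v ! i) / N))
      + (\<Sum>i<length w. f (real (?k + Suc i) / N, real (?k + perm_of w ! i) / N))" .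
  let ?u = "?k / N"
  have "real N - ?k = ?m" "?k \<le> N" using N by simp_all
  moreover have "1 - ?u = (real N - ?k) / N" using N0 by (simp add: diff_divide_distrib)
  ultimately have u: "?u \<in> {0..1}" "1 - ?u = ?m / N" using N0 by simp_all
  have "(\<integral>z. f z \<partial>XX_permuton ?u) = (?k * X_average f 0 ?u + ?m * X_average f ?u (?m / N)) / N"
    unfolding integral_XX_permuton[OF is_lipschitz_test u(1)] u(2) by (simp add: add_divide_distrib)
  moreover have "\<bar>(\<Sum>i<N. ?F i) - (?k * X_average f 0 ?u + ?m * X_average f ?u (?m / N))\<bar> \<le> 2 * ((4 * L + 3 * B) * d + 3 * L)"
    using balanced_sum_estimate[OF v(2), of 0 N] balanced_sum_estimate[OF w(2), of ?k N] N N0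
    unfolding sum len by simp
  then have "\<bar>(\<Sum>i<N. ?F i) / N - (?k * X_average f 0 ?u + ?m * X_average f ?u (?m / N)) / N\<bar> \<le> 2 * ((4 * L + 3 * B) * d + 3 * L) / N"
    unfolding diff_divide_distrib[symmetric] abs_divide using N0 by (simp add: divide_right_mono)
  moreover have "\<bar>(\<integral>z. f z \<partial>permuton_of ?\<pi>) - (\<Sum>i<N. ?F i) / N\<bar> \<le> 2 * L / N"
    using integral_permuton_of[OF direct_sum_perms[OF X_class_perms[OF \<sigma>(1)] X_class_perms[OF \<tau>(1)]]
        lipschitz_test_continuous[OF is_lipschitz_test] fL] N by simp
  moreover have "2 * ((4 * L + 3 * B) * d + 3 * L) / N + 2 * L / N = ((8 * L + 6 * B) * d + 8 * L) / N"
    by (simp add: add_divide_distrib[symmetric] algebra_simps)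
  ultimately show ?thesis by linarith
qed

end


section \<open>Asymptotic counting\<close>

lemma growth_gt_1: "1 < growth"
  using real_sqrt_gt_zero[of 2] by linarith

lemma growth_power_pos: "0 < growth ^ n"
  by (intro zero_less_power add_pos_pos) auto

lemma card_X_asymptotics: "(\<lambda>n. card (of_size X_class n) / growth ^ n) \<longlonglongrightarrow> 1 / (2 * growth)"
proof -
  have s: "1 < sqrt 2" "sqrt 2 < 2" by (auto intro: real_less_lsqrt)
  have "growth > 0" "growth' > 0" "growth' < growth" using s by linarith+
  then have "\<bar>growth' / growth\<bar> < 1" unfolding abs_divide by (simp only: abs_of_pos divide_less_eq_1_pos)
  then have "(\<lambda>n. (growth' / growth) ^ n) \<longlonglongrightarrow> 0" by (rule LIMSEQ_abs_realpow_zero2[unfolded abs_abs])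
  then have "(\<lambda>n. (1 + (growth' / growth) ^ n) / (2 * growth)) \<longlonglongrightarrow> (1 + 0) / (2 * growth)"
  proof (intro tendsto_divide tendsto_add tendsto_const)
    have "2 * growth > 0" by (intro mult_pos_pos add_pos_pos) auto
    then show "2 * growth \<noteq> 0" by (rule less_imp_neq[THEN not_sym])
  qed
  moreover have "(1 + (growth' / growth) ^ n) / (2 * growth) = card (of_size X_class (Suc n)) / growth ^ Suc n" for n
  proof -
    have "(1 + (x / y) ^ n) / (2 * y) = (y ^ n + x ^ n) / 2 / y ^ Suc n" if "y > 0" for x y :: real
      using that by (simp add: power_divide field_simps)
    from this[of growth growth'] growth_power_pos[of 1] show ?thesis
      unfolding card_X power_one_right by blast
  qed
  ultimately have "(\<lambda>n. card (of_size X_class (Suc n)) / growth ^ Suc n) \<longlonglongrightarrow> 1 / (2 * growth)" by simp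
  then show ?thesis by (rule LIMSEQ_imp_Suc)
qed

lemma card_right_asymptotics: "(\<lambda>n. card (right_part n) / growth ^ n) \<longlonglongrightarrow> 1 / (2 * growth)"
proof -
  have "(\<lambda>n. 1 / growth ^ n) \<longlonglongrightarrow> 0"
    using LIMSEQ_divide_realpow_zero[OF growth_gt_1] .
  from tendsto_diff[OF card_X_asymptotics this]
  have "(\<lambda>n. card (of_size X_class n) / growth ^ n - 1 / growth ^ n) \<longlonglongrightarrow> 1 / (2 * growth)" by simp
  then show ?thesis
  proof (rule Lim_transform_eventually)
    show "\<forall>\<^sub>F n in sequentially. card (of_size X_class n) / growth ^ n - 1 / growth ^ n = card (right_part n) / growth ^ n"
    proof (rule eventually_sequentiallyI[of 1])
      fix n :: nat assume n: "1 \<le> n"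
      have "card (of_size X_class n) \<ge> 1"
        using X_class_direct_sum_increasing[of "[]" n] n
        by (simp add: Suc_le_eq card_gt_0_iff del: upt_Suc) (auto simp: of_size_def direct_sum_def simp del: upt_Suc)
      then show "card (of_size X_class n) / growth ^ n - 1 / growth ^ n = card (right_part n) / growth ^ n"
        unfolding card_right_part[OF n] by (simp add: of_nat_diff diff_divide_distrib)
    qed
  qed
qed

text \<open>The subtracted share \<open>1 / growth\<close> belongs to the permutations ending with
  their maximum, which correspond to those one size smaller.\<close>

lemma card_left_asymptotics:
  "(\<lambda>n. card (left_part n) / growth ^ n) \<longlonglongrightarrow> 1 / (2 * growth) - 1 / (2 * growth) / growth"
proof (rule LIMSEQ_imp_Suc)
  have "(\<lambda>n. card (of_size X_class (Suc n)) / growth ^ Suc n - card (of_size X_class n) / growth ^ n / growth)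
      \<longlonglongrightarrow> 1 / (2 * growth) - 1 / (2 * growth) / growth"
    using growth_gt_1 by (intro tendsto_intros card_X_asymptotics LIMSEQ_Suc) auto
  then show "(\<lambda>n. card (left_part (Suc n)) / growth ^ Suc n) \<longlonglongrightarrow> 1 / (2 * growth) - 1 / (2 * growth) / growth"
  proof (rule Lim_transform_eventually)
    show "\<forall>\<^sub>F n in sequentially. card (of_size X_class (Suc n)) / growth ^ Suc n - card (of_size X_class n) / growth ^ n / growth
        = card (left_part (Suc n)) / growth ^ Suc n"
    proof (rule eventually_sequentiallyI[of 1])
      fix n :: nat assume n: "1 \<le> n"
      have "card (of_size X_class n) \<le> card (of_size X_class (Suc n))"
        unfolding card_corner_X[OF n, of "(True, True)", symmetric] by (intro card_mono) auto
      then show "card (of_size X_class (Suc n)) / growth ^ Suc n - card (of_size X_class n) / growth ^ n / growth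
        = card (left_part (Suc n)) / growth ^ Suc n"
        unfolding card_left_part[OF n] by (simp add: of_nat_diff diff_divide_distrib mult.commute)
    qed
  qed
qed

section \<open>Cesaro means, Riemann sums and convolutions\<close>

lemma cesaro_zero:
  fixes x :: "nat \<Rightarrow> real"
  assumes x: "x \<longlonglongrightarrow> 0" shows "(\<lambda>n. (\<Sum>k\<le>n. \<bar>x k\<bar>) / n) \<longlonglongrightarrow> 0"
proof (rule LIMSEQ_I)
  fix e :: real assume e: "e > 0"
  then obtain K where K: "\<And>k. k \<ge> K \<Longrightarrow> \<bar>x k\<bar> < e / 2" using LIMSEQ_D[OF x, of "e / 2"] by auto
  let ?S = "\<lambda>n. \<Sum>k\<le>n. \<bar>x k\<bar>"
  have S: "?S (K + n) \<le> ?S K + n * (e / 2)" for n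
  proof (induction n)
    case (Suc n)
    have "real (Suc n) * (e / 2) = n * (e / 2) + e / 2" by (simp add: field_simps)
    moreover have "?S (K + Suc n) = ?S (K + n) + \<bar>x (K + Suc n)\<bar>" by simp
    ultimately show ?case using Suc K[of "K + Suc n"] by linarith
  qed simp
  obtain M :: nat where M: "2 * ?S K / e < M" using reals_Archimedean2 by blast
  have "norm (?S n / n - 0) < e" if n: "n \<ge> max (Suc K) (Suc M)" for n
  proof -
    have n0: "n > 0" "n \<ge> K" "real n > M" using n by auto
    have "?S n \<le> ?S K + (n - K) * (e / 2)" using S[of "n - K"] n0 by (simp add: of_nat_diff)
    also have "\<dots> \<le> ?S K + n * (e / 2)" using e by (intro add_left_mono mult_right_mono) auto
    finally have "?S n \<le> ?S K + n * (e / 2)" .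
    moreover have "2 * ?S K < n * e" using less_trans[OF M n0(3)] e by (simp add: pos_divide_less_eq)
    ultimately have "?S n < n * e" by simp
    moreover have "0 \<le> ?S n" by (intro sum_nonneg) auto
    ultimately show ?thesis using n0(1) by (simp add: field_simps)
  qed
  then show "\<exists>no. \<forall>n\<ge>no. norm (?S n / n - 0) < e" by blast
qed

lemma riemann_sum_tendsto:
  fixes G :: "real \<Rightarrow> real"
  assumes G: "continuous_on {0..1} G"
  shows "(\<lambda>n. (\<Sum>k\<le>n. G (real k / n)) / n) \<longlonglongrightarrow> integral {0..1} G"
proof -
  have "(\<lambda>n. (\<Sum>k<n. G (real k / n)) / n) \<longlonglongrightarrow> integral {0..1} G"
  proof (rule LIMSEQ_I)
    fix e :: real assume e: "e > 0"
    have "uniformly_continuous_on {0..1} G" by (rule compact_uniformly_continuous[OF G]) simp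
    then obtain d where d: "d > 0" "\<And>x y. x \<in> {0..1} \<Longrightarrow> y \<in> {0..1} \<Longrightarrow> dist y x < d \<Longrightarrow> dist (G y) (G x) < e / 2"
      unfolding uniformly_continuous_on_def using half_gt_zero[OF e] by metis
    obtain M :: nat where M: "1 / d < M" using reals_Archimedean2 by blast
    have "norm ((\<Sum>k<n. G (real k / n)) / n - integral {0..1} G) < e" if n: "n \<ge> Suc M" for n
    proof -
      have "1 / d < n" using M n by simp
      then have nd: "1 / real n < d" using d(1) n by (simp add: field_simps)
      have "\<bar>(\<Sum>k<n. G (real k / n)) / n - integral {0..1} G\<bar> \<le> e / 2"
      proof (rule riemann_sum_bound[OF G])
        fix x y :: real assume "x \<in> {0..1}" "y \<in> {0..1}" "\<bar>x - y\<bar> \<le> 1 / n"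
        then show "\<bar>G x - G y\<bar> \<le> e / 2" using d(2)[of y x] nd by (simp add: dist_real_def)
      qed (use n in simp)
      then show ?thesis using e by simp
    qed
    then show "\<exists>no. \<forall>n\<ge>no. norm ((\<Sum>k<n. G (real k / n)) / n - integral {0..1} G) < e" by blast
  qed
  moreover have "(\<lambda>n. G 1 / real n) \<longlonglongrightarrow> 0" by real_asymp
  ultimately have "(\<lambda>n. (\<Sum>k<n. G (real k / n)) / n + G 1 / real n) \<longlonglongrightarrow> integral {0..1} G + 0"
    by (rule tendsto_add)
  moreover have "(\<Sum>k<n. G (real k / n)) / n + G 1 / real n = (\<Sum>k\<le>n. G (real k / n)) / n" for n
    by (cases "n = 0") (simp_all add: lessThan_Suc_atMost[symmetric] add_divide_distrib)
  ultimately show ?thesis by simp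
qed

text \<open>Replacing \<open>p k * q (n - k)\<close> by \<open>P * Q\<close> costs Cesaro means of
  null sequences. The weights thus become constant in \<open>k\<close> and a Riemann sum of
  \<open>G\<close> remains: this is where the uniform law of the splitting point comes from.\<close>

lemma convolution_tendsto:
  fixes p q :: "nat \<Rightarrow> real" and G :: "real \<Rightarrow> real"
  assumes p: "p \<longlonglongrightarrow> P" and q: "q \<longlonglongrightarrow> Q" and q1: "\<And>k. \<bar>q k\<bar> \<le> 1"
    and G: "continuous_on {0..1} G" and M: "\<And>u. u \<in> {0..1} \<Longrightarrow> \<bar>G u\<bar> \<le> M"
  shows "(\<lambda>n. (\<Sum>k\<le>n. G (real k / n) * (p k * q (n - k))) / n) \<longlonglongrightarrow> P * Q * integral {0..1} G"
proof -
  let ?D = "\<lambda>n. (\<Sum>k\<le>n. G (real k / n) * (p k * q (n - k) - P * Q)) / n"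
  let ?E = "\<lambda>n. M * ((\<Sum>k\<le>n. \<bar>p k - P\<bar>) / n + \<bar>P\<bar> * ((\<Sum>k\<le>n. \<bar>q k - Q\<bar>) / n))"
  have M0: "0 \<le> M" using M[of 0] by auto
  have "(\<lambda>k. p k - P) \<longlonglongrightarrow> 0" "(\<lambda>k. q k - Q) \<longlonglongrightarrow> 0" using p q by (simp_all add: LIM_zero)
  then have "?E \<longlonglongrightarrow> M * (0 + \<bar>P\<bar> * 0)" by (intro tendsto_intros cesaro_zero)
  then have E: "?E \<longlonglongrightarrow> 0" by simp
  have "norm (?D n) \<le> ?E n" for n
  proof -
    have "\<bar>G (real k / n) * (p k * q (n - k) - P * Q)\<bar> \<le> M * (\<bar>p k - P\<bar> + \<bar>P\<bar> * \<bar>q (n - k) - Q\<bar>)" if "k \<le> n" for k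
    proof -
      have "p k * q (n - k) - P * Q = (p k - P) * q (n - k) + P * (q (n - k) - Q)" by (simp add: algebra_simps)
      then have "\<bar>p k * q (n - k) - P * Q\<bar> \<le> \<bar>p k - P\<bar> * \<bar>q (n - k)\<bar> + \<bar>P\<bar> * \<bar>q (n - k) - Q\<bar>"
        by (metis abs_mult abs_triangle_ineq)
      also have "\<dots> \<le> \<bar>p k - P\<bar> * 1 + \<bar>P\<bar> * \<bar>q (n - k) - Q\<bar>"
        using q1 by (intro add_right_mono mult_left_mono) auto
      finally have "\<bar>p k * q (n - k) - P * Q\<bar> \<le> \<bar>p k - P\<bar> + \<bar>P\<bar> * \<bar>q (n - k) - Q\<bar>" by simp
      moreover have "\<bar>G (real k / n)\<bar> \<le> M" using that by (intro M) (auto simp: divide_le_eq_1)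
      ultimately show ?thesis unfolding abs_mult using M0 by (intro mult_mono) auto
    qed
    then have "\<bar>\<Sum>k\<le>n. G (real k / n) * (p k * q (n - k) - P * Q)\<bar> \<le> (\<Sum>k\<le>n. M * (\<bar>p k - P\<bar> + \<bar>P\<bar> * \<bar>q (n - k) - Q\<bar>))"
      by (intro order_trans[OF sum_abs] sum_mono) auto
    also have "\<dots> = M * ((\<Sum>k\<le>n. \<bar>p k - P\<bar>) + \<bar>P\<bar> * (\<Sum>k\<le>n. \<bar>q (n - k) - Q\<bar>))"
      by (simp add: sum_distrib_left sum.distrib distrib_left)
    also have "(\<Sum>k\<le>n. \<bar>q (n - k) - Q\<bar>) = (\<Sum>k\<le>n. \<bar>q k - Q\<bar>)"
      by (rule sum.nat_diff_reindex[of "\<lambda>k. \<bar>q k - Q\<bar>" "Suc n", simplified lessThan_Suc_atMost diff_Suc_Suc])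
    finally have "\<bar>\<Sum>k\<le>n. G (real k / n) * (p k * q (n - k) - P * Q)\<bar> / n \<le> M * ((\<Sum>k\<le>n. \<bar>p k - P\<bar>) + \<bar>P\<bar> * (\<Sum>k\<le>n. \<bar>q k - Q\<bar>)) / n"
      by (rule divide_right_mono) simp
    then show ?thesis by (simp add: add_divide_distrib distrib_left)
  qed
  then have "?D \<longlonglongrightarrow> 0" by (intro Lim_null_comparison[OF _ E] always_eventually) blast
  moreover have "(\<lambda>n. P * Q * ((\<Sum>k\<le>n. G (real k / n)) / n)) \<longlonglongrightarrow> P * Q * integral {0..1} G"
    by (intro tendsto_intros riemann_sum_tendsto G)
  ultimately have "(\<lambda>n. ?D n + P * Q * ((\<Sum>k\<le>n. G (real k / n)) / n)) \<longlonglongrightarrow> 0 + P * Q * integral {0..1} G"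
    by (rule tendsto_add)
  moreover have "?D n + P * Q * ((\<Sum>k\<le>n. G (real k / n)) / n) = (\<Sum>k\<le>n. G (real k / n) * (p k * q (n - k))) / n" for n
    by (simp add: right_diff_distrib sum_subtractf diff_divide_distrib sum_distrib_left mult_ac)
  ultimately show ?thesis by simp
qed

text \<open>The product of the limits for the left and the right summands; the class has about
  \<open>XX_constant * n * growth ^ n\<close> elements of size \<open>n\<close>.\<close>

definition XX_constant :: real where
  "XX_constant = (1 / (2 * growth) - 1 / (2 * growth) / growth) * (1 / (2 * growth))"

lemma XX_constant_pos: "XX_constant > 0"
proof -
  have "1 / (2 * growth) / growth < 1 / (2 * growth)" using growth_gt_1 by (simp add: divide_less_eq)
  then show ?thesis using growth_gt_1 unfolding XX_constant_def by (intro mult_pos_pos) auto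
qed

text \<open>Uniform in \<open>k\<close>, since the threshold refers to \<open>n\<close>. The choice
  \<open>z = \<delta> / 8\<close> minimises \<open>4 * z\<^sup>2 * n - z * \<delta> * n\<close>,
  with minimum \<open>- \<delta>\<^sup>2 / 16 * n\<close>.\<close>

lemma card_unbalanced_X_le:
  fixes k n :: nat and \<delta> :: real
  assumes "0 < \<delta>" "\<delta> \<le> 1" "k \<le> n"
  shows "real (card (of_size X_class k - balanced_perms (\<delta> * n))) \<le> 12 * exp 1 * (real n + 1) * exp (- (\<delta>\<^sup>2 / 16) * n) * growth ^ k"
proof -
  note g0 = less_imp_le[OF growth_power_pos[of k]]
  have "real (card (of_size X_class k - balanced_perms (\<delta> * n)))
      \<le> 12 * exp 1 * (real k + 1) * growth ^ k * exp (4 * (\<delta> / 8)\<^sup>2 * k - \<delta> / 8 * (\<delta> * n))"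
    using assms by (intro card_unbalanced_X) auto
  also have "\<dots> \<le> 12 * exp 1 * (real n + 1) * growth ^ k * exp (- (\<delta>\<^sup>2 / 16) * n)"
  proof (intro mult_mono)
    have "(\<delta>\<^sup>2 / 16) * k \<le> (\<delta>\<^sup>2 / 16) * n" using assms by (intro mult_left_mono) auto
    then show "exp (4 * (\<delta> / 8)\<^sup>2 * k - \<delta> / 8 * (\<delta> * n)) \<le> exp (- (\<delta>\<^sup>2 / 16) * n)"
      by (simp add: power2_eq_square field_simps)
  qed (use assms g0 in auto)
  finally show ?thesis by (simp add: mult_ac)
qed

text \<open>For an upper bound the summands may range over all of X. A pair of balanced permutations
  costs \<open>e\<close>; any other pair costs at most \<open>2 * M\<close> and has an unbalanced
  member, on the left or on the right. The 48 is 2 * 2 * 12.\<close>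

lemma sum_pairs_bound:
  fixes \<Phi> :: "nat list \<Rightarrow> real"
  assumes \<delta>: "0 < \<delta>" "\<delta> \<le> 1" and kn: "k \<le> n" and e: "e \<ge> 0" and M: "M \<ge> 0"
    and good: "\<And>\<sigma> \<tau>. \<sigma> \<in> of_size X_class k \<inter> balanced_perms (\<delta> * n) \<Longrightarrow> \<tau> \<in> of_size X_class (n - k) \<inter> balanced_perms (\<delta> * n)
       \<Longrightarrow> \<bar>\<Phi> (direct_sum \<sigma> \<tau>) - g\<bar> \<le> e"
    and all: "\<And>\<sigma> \<tau>. \<sigma> \<in> of_size X_class k \<Longrightarrow> \<tau> \<in> of_size X_class (n - k) \<Longrightarrow> \<bar>\<Phi> (direct_sum \<sigma> \<tau>) - g\<bar> \<le> 2 * M"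
  shows "(\<Sum>\<sigma>\<in>left_part k. \<Sum>\<tau>\<in>right_part (n - k). \<bar>\<Phi> (direct_sum \<sigma> \<tau>) - g\<bar>)
     \<le> (e + 48 * M * exp 1 * (real n + 1) * exp (- (\<delta>\<^sup>2 / 16) * n)) * growth ^ n"
proof -
  let ?X = "of_size X_class k" and ?Y = "of_size X_class (n - k)" and ?b = "balanced_perms (\<delta> * n)"
  define \<epsilon> where "\<epsilon> = 12 * exp 1 * (real n + 1) * exp (- (\<delta>\<^sup>2 / 16) * n)"
  have \<epsilon>: "real (card (?X - ?b)) \<le> \<epsilon> * growth ^ k" "real (card (?Y - ?b)) \<le> \<epsilon> * growth ^ (n - k)"
    unfolding \<epsilon>_def using card_unbalanced_X_le[OF \<delta>] kn by simp_all
  note g0 = less_imp_le[OF growth_power_pos]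
  have ind: "(\<Sum>x\<in>S. if x \<in> T then 0 else 1) = real (card (S - T))" if "finite S" for S T :: "nat list set"
    using that by (simp add: sum.If_cases Diff_eq)
  have "(\<Sum>\<sigma>\<in>left_part k. \<Sum>\<tau>\<in>right_part (n - k). \<bar>\<Phi> (direct_sum \<sigma> \<tau>) - g\<bar>)
      \<le> (\<Sum>\<sigma>\<in>?X. \<Sum>\<tau>\<in>right_part (n - k). \<bar>\<Phi> (direct_sum \<sigma> \<tau>) - g\<bar>)"
    by (intro sum_mono2 sum_nonneg) (auto simp: left_part_def)
  also have "\<dots> \<le> (\<Sum>\<sigma>\<in>?X. \<Sum>\<tau>\<in>?Y. \<bar>\<Phi> (direct_sum \<sigma> \<tau>) - g\<bar>)"
    by (intro sum_mono sum_mono2) (auto simp: right_part_def)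
  also have "\<dots> \<le> (\<Sum>\<sigma>\<in>?X. \<Sum>\<tau>\<in>?Y. e + 2 * M * (if \<sigma> \<in> ?b then 0 else 1) + 2 * M * (if \<tau> \<in> ?b then 0 else 1))"
  proof (intro sum_mono)
    fix \<sigma> \<tau> assume s: "\<sigma> \<in> ?X" "\<tau> \<in> ?Y"
    show "\<bar>\<Phi> (direct_sum \<sigma> \<tau>) - g\<bar> \<le> e + 2 * M * (if \<sigma> \<in> ?b then 0 else 1) + 2 * M * (if \<tau> \<in> ?b then 0 else 1)"
      using good[of \<sigma> \<tau>] all[OF s] s e M by (cases "\<sigma> \<in> ?b"; cases "\<tau> \<in> ?b") auto
  qed
  also have "\<dots> = e * (real (card ?X) * real (card ?Y)) + 2 * M * (real (card (?X - ?b)) * real (card ?Y) + real (card ?X) * real (card (?Y - ?b)))"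
  proof -
    have "(\<Sum>\<tau>\<in>?Y. e + 2 * M * (if \<sigma> \<in> ?b then 0 else 1) + 2 * M * (if \<tau> \<in> ?b then 0 else 1))
       = card ?Y * e + 2 * M * card ?Y * (if \<sigma> \<in> ?b then 0 else 1) + 2 * M * card (?Y - ?b)" for \<sigma>
      using ind[of ?Y ?b] by (simp add: sum.distrib sum_distrib_left[symmetric] distrib_left)
    then have "(\<Sum>\<sigma>\<in>?X. \<Sum>\<tau>\<in>?Y. e + 2 * M * (if \<sigma> \<in> ?b then 0 else 1) + 2 * M * (if \<tau> \<in> ?b then 0 else 1))
       = card ?X * (card ?Y * e) + 2 * M * card ?Y * card (?X - ?b) + card ?X * (2 * M * card (?Y - ?b))"
      using ind[of ?X ?b] by (simp add: sum.distrib sum_distrib_left[symmetric])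
    then show ?thesis by (simp add: algebra_simps)
  qed
  also have "\<dots> \<le> e * (growth ^ k * growth ^ (n - k)) + 2 * M * ((\<epsilon> * growth ^ k) * growth ^ (n - k) + growth ^ k * (\<epsilon> * growth ^ (n - k)))"
    using e M g0 \<epsilon> by (intro add_mono mult_left_mono mult_mono card_X_le) (auto simp: \<epsilon>_def)
  also have "\<dots> = (e + 4 * M * \<epsilon>) * (growth ^ k * growth ^ (n - k))" by (simp add: algebra_simps)
  also have "growth ^ k * growth ^ (n - k) = growth ^ n" using kn by (simp flip: power_add)
  finally show ?thesis by (simp add: \<epsilon>_def algebra_simps)
qed

text \<open>The interface between geometry and counting. One \<open>\<delta>\<close> serves all
  large \<open>n\<close> and all splittings, and balance is measured against the total size for both
  summands.\<close>

definition approximates_on_sums :: "(nat list \<Rightarrow> real) \<Rightarrow> (real \<Rightarrow> real) \<Rightarrow> bool" where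
  "approximates_on_sums \<Phi> G \<longleftrightarrow> (\<forall>e>0. \<exists>\<delta>>0. \<delta> \<le> 1 \<and> (\<exists>n0. \<forall>n\<ge>n0. \<forall>\<sigma>\<in>X_class \<inter> balanced_perms (\<delta> * real n).
     \<forall>\<tau>\<in>X_class \<inter> balanced_perms (\<delta> * real n). length \<sigma> + length \<tau> = n \<longrightarrow>
       \<bar>\<Phi> (direct_sum \<sigma> \<tau>) - G (real (length \<sigma>) / n)\<bar> \<le> e))"

lemma XX_class_sum_asymptotics:
  fixes \<Phi> :: "nat list \<Rightarrow> real" and G :: "real \<Rightarrow> real"
  assumes M: "\<And>\<pi>. \<pi> \<in> perms \<Longrightarrow> \<bar>\<Phi> \<pi>\<bar> \<le> M" "\<And>u. u \<in> {0..1} \<Longrightarrow> \<bar>G u\<bar> \<le> M"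
    and G: "continuous_on {0..1} G"
    and close: "approximates_on_sums \<Phi> G"
  shows "(\<lambda>n. (\<Sum>\<pi>\<in>of_size XX_class n. \<Phi> \<pi>) / (n * growth ^ n)) \<longlonglongrightarrow> XX_constant * integral {0..1} G"
proof -
  let ?S = "\<lambda>n. \<Sum>\<pi>\<in>of_size XX_class n. \<Phi> \<pi>"
  let ?T = "\<lambda>n. \<Sum>k\<le>n. G (real k / n) * (card (left_part k) * card (right_part (n - k)))"
  let ?w = "\<lambda>n. real n * growth ^ n"
  have M0: "0 \<le> M" using M(2)[of 0] by auto
  note g0 = growth_power_pos
  let ?P = "\<lambda>n. \<Sum>k\<le>n. G (real k / n) * (card (left_part k) / growth ^ k * (card (right_part (n - k)) / growth ^ (n - k)))"
  have T: "(\<lambda>n. ?T n / ?w n) \<longlonglongrightarrow> XX_constant * integral {0..1} G"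
  proof -
    have "\<bar>real (card (right_part k)) / growth ^ k\<bar> \<le> 1" for k
    proof -
      have "card (right_part k) \<le> card (of_size X_class k)" by (intro card_mono) (auto simp: right_part_def)
      then have "real (card (right_part k)) \<le> growth ^ k" using card_X_le[of k] by linarith
      then show ?thesis using g0[of k] by (simp add: divide_le_eq_1)
    qed
    from convolution_tendsto[OF card_left_asymptotics card_right_asymptotics this G M(2)]
    have "(\<lambda>n. ?P n / n)
       \<longlonglongrightarrow> XX_constant * integral {0..1} G" by (simp add: XX_constant_def)
    moreover have "?P n / n = ?T n / ?w n" for n
    proof -
      have "G (real k / n) * (card (left_part k) / growth ^ k * (card (right_part (n - k)) / growth ^ (n - k)))
          = G (real k / n) * (card (left_part k) * card (right_part (n - k))) / growth ^ n" if "k \<le> n" for k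
      proof -
        have "growth ^ n = growth ^ k * growth ^ (n - k)" using that by (simp flip: power_add)
        then show ?thesis by simp
      qed
      then have "?P n
          = ?T n / growth ^ n" unfolding sum_divide_distrib by (intro sum.cong) auto
      then show ?thesis by (simp add: mult.commute)
    qed
    ultimately show ?thesis by simp
  qed
  have "(\<lambda>n. (?S n - ?T n) / ?w n) \<longlonglongrightarrow> 0"
  proof (rule LIMSEQ_I)
    fix e :: real assume e: "e > 0"
    \<comment> \<open>Good pairs enter with weight (n + 1) / n <= 2, so \<open>e / 4\<close> costs
      at most \<open>e / 2\<close> and leaves room for \<open>r n < e / 4\<close>.\<close>
    then have "e / 4 > 0" by simp
    from close[unfolded approximates_on_sums_def, rule_format, OF this] obtain \<delta> n0 where \<delta>: "0 < \<delta>" "\<delta> \<le> 1" and n0: "\<And>n \<sigma> \<tau>. n \<ge> n0 \<Longrightarrow> \<sigma> \<in> X_class \<inter> balanced_perms (\<delta> * real n) \<Longrightarrow>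
        \<tau> \<in> X_class \<inter> balanced_perms (\<delta> * real n) \<Longrightarrow> length \<sigma> + length \<tau> = n \<Longrightarrow>
          \<bar>\<Phi> (direct_sum \<sigma> \<tau>) - G (real (length \<sigma>) / n)\<bar> \<le> e / 4" by blast
    define \<kappa> where "\<kappa> = \<delta>\<^sup>2 / 16"
    have \<kappa>: "\<kappa> > 0" using \<delta> by (simp add: \<kappa>_def)
    \<comment> \<open>The first term comes from the elements outside \<open>genuine_sums\<close>,
      the second from pairs with an unbalanced member, over n + 1 splittings; there the exponential
      beats the polynomial factors.\<close>
    define r where "r n = M / n + (real n + 1) / n * (48 * M * exp 1 * (real n + 1) * exp (- \<kappa> * n))" for n :: nat
    have bound: "\<bar>?S n - ?T n\<bar> \<le> ?w n * (r n + (real n + 1) / n * (e / 4))" if n: "n \<ge> n0" "n > 0" for n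
    proof -
      let ?E = "48 * M * exp 1 * (real n + 1) * exp (- \<kappa> * n)"
      have fin: "finite (of_size XX_class n)" by (intro finite_of_size XX_class_perms)
      have "?S n = (\<Sum>\<pi>\<in>of_size XX_class n - genuine_sums n. \<Phi> \<pi>) + (\<Sum>\<pi>\<in>genuine_sums n. \<Phi> \<pi>)"
        by (rule sum.subset_diff[OF XX_class_eq(1) fin])
      moreover have "\<bar>\<Sum>\<pi>\<in>of_size XX_class n - genuine_sums n. \<Phi> \<pi>\<bar> \<le> M * growth ^ n"
      proof -
        have "\<bar>\<Sum>\<pi>\<in>of_size XX_class n - genuine_sums n. \<Phi> \<pi>\<bar> \<le> (\<Sum>\<pi>\<in>of_size XX_class n - genuine_sums n. M)"
          using M(1) XX_class_perms by (intro order_trans[OF sum_abs] sum_mono) (auto simp: of_size_def)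
        also have "\<dots> = real (card (of_size XX_class n - genuine_sums n)) * M" by simp
        also have "\<dots> \<le> growth ^ n * M"
        proof (intro mult_right_mono M0)
          have "card (of_size XX_class n - genuine_sums n) \<le> card (of_size X_class n)"
            by (intro card_mono XX_class_eq(2)) simp
          then show "real (card (of_size XX_class n - genuine_sums n)) \<le> growth ^ n" using card_X_le[of n] by linarith
        qed
        finally show ?thesis by (simp add: mult.commute)
      qed
      moreover have "\<bar>(\<Sum>\<pi>\<in>genuine_sums n. \<Phi> \<pi>) - ?T n\<bar> \<le> (real n + 1) * ((e / 4 + ?E) * growth ^ n)"
      proof -
        have "?T n = (\<Sum>k\<le>n. \<Sum>\<sigma>\<in>left_part k. \<Sum>\<tau>\<in>right_part (n - k). G (real k / n))" by (simp add: mult_ac)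
        then have "(\<Sum>\<pi>\<in>genuine_sums n. \<Phi> \<pi>) - ?T n
          = (\<Sum>k\<le>n. \<Sum>\<sigma>\<in>left_part k. \<Sum>\<tau>\<in>right_part (n - k). \<Phi> (direct_sum \<sigma> \<tau>) - G (real k / n))"
          by (simp only: sum_genuine_sums sum_subtractf)
        then have "\<bar>(\<Sum>\<pi>\<in>genuine_sums n. \<Phi> \<pi>) - ?T n\<bar>
          \<le> (\<Sum>k\<le>n. \<Sum>\<sigma>\<in>left_part k. \<Sum>\<tau>\<in>right_part (n - k). \<bar>\<Phi> (direct_sum \<sigma> \<tau>) - G (real k / n)\<bar>)"
          by (simp only:) (intro order_trans[OF sum_abs] sum_mono order_refl)
        also have "\<dots> \<le> (\<Sum>k\<le>n. (e / 4 + ?E) * growth ^ n)"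
        proof (intro sum_mono)
          fix k assume "k \<in> {..n}"
          then have k: "k \<le> n" by simp
          then have "\<bar>G (real k / n)\<bar> \<le> M" using n by (intro M(2)) (auto simp: divide_le_eq_1)
          moreover have "\<bar>\<Phi> (direct_sum \<sigma> \<tau>)\<bar> \<le> M" if "\<sigma> \<in> of_size X_class k" "\<tau> \<in> of_size X_class (n - k)" for \<sigma> \<tau>
            using that direct_sum_perms X_class_perms by (intro M(1)) (auto simp: of_size_def)
          ultimately have all: "\<bar>\<Phi> (direct_sum \<sigma> \<tau>) - G (real k / n)\<bar> \<le> 2 * M" if "\<sigma> \<in> of_size X_class k" "\<tau> \<in> of_size X_class (n - k)" for \<sigma> \<tau>
            using that by (smt (verit))
          have good: "\<bar>\<Phi> (direct_sum \<sigma> \<tau>) - G (real k / n)\<bar> \<le> e / 4"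
            if "\<sigma> \<in> of_size X_class k \<inter> balanced_perms (\<delta> * n)" "\<tau> \<in> of_size X_class (n - k) \<inter> balanced_perms (\<delta> * n)" for \<sigma> \<tau>
            using n0[OF n(1), of \<sigma> \<tau>] that k by (auto simp: of_size_def)
          show "(\<Sum>\<sigma>\<in>left_part k. \<Sum>\<tau>\<in>right_part (n - k). \<bar>\<Phi> (direct_sum \<sigma> \<tau>) - G (real k / n)\<bar>) \<le> (e / 4 + ?E) * growth ^ n"
            unfolding \<kappa>_def
          proof (rule sum_pairs_bound[OF \<delta> k])
            show "0 \<le> e / 4" "0 \<le> M" using e M0 by auto
          qed (erule (1) good, erule (1) all)
        qed
        also have "\<dots> = (real n + 1) * ((e / 4 + ?E) * growth ^ n)" by simp
        finally show ?thesis .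
      qed
      moreover have "?w n * (r n + (real n + 1) / n * (e / 4)) = M * growth ^ n + (real n + 1) * ((e / 4 + ?E) * growth ^ n)"
        using n(2) unfolding r_def by (simp add: field_simps)
      ultimately show ?thesis by linarith
    qed
    have "r \<longlonglongrightarrow> 0" unfolding r_def using \<kappa> by real_asymp
    then obtain n1 where n1: "\<And>n. n \<ge> n1 \<Longrightarrow> \<bar>r n\<bar> < e / 4" using LIMSEQ_D[of r 0 "e / 4"] e by auto
    have "norm ((?S n - ?T n) / ?w n - 0) < e" if n: "n \<ge> max (max n0 n1) 1" for n
    proof -
      have w: "?w n > 0" using n g0 by simp
      have "\<bar>(?S n - ?T n) / ?w n\<bar> \<le> r n + (real n + 1) / n * (e / 4)"
        using bound[of n] n w by (simp add: abs_divide divide_le_eq mult.commute)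
      also have "\<dots> \<le> r n + 2 * (e / 4)" using n e by (intro add_left_mono mult_right_mono) (auto simp: divide_le_eq)
      also have "\<dots> < e" using n1[of n] n by simp
      finally show ?thesis by simp
    qed
    then show "\<exists>no. \<forall>n\<ge>no. norm ((?S n - ?T n) / ?w n - 0) < e" by blast
  qed
  from tendsto_add[OF this T] show ?thesis by (simp add: diff_divide_distrib)
qed

lemma XX_class_average_tendsto:
  fixes \<Phi> :: "nat list \<Rightarrow> real" and G :: "real \<Rightarrow> real"
  assumes "\<And>\<pi>. \<pi> \<in> perms \<Longrightarrow> \<bar>\<Phi> \<pi>\<bar> \<le> M" "\<And>u. u \<in> {0..1} \<Longrightarrow> \<bar>G u\<bar> \<le> M"
    and "continuous_on {0..1} G"
    and "approximates_on_sums \<Phi> G"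
  shows "(\<lambda>n. (\<Sum>\<pi>\<in>of_size XX_class n. \<Phi> \<pi>) / card (of_size XX_class n)) \<longlonglongrightarrow> integral {0..1} G"
proof -
  let ?S = "\<lambda>n. \<Sum>\<pi>\<in>of_size XX_class n. \<Phi> \<pi>" and ?c = "\<lambda>n. real (card (of_size XX_class n))"
  let ?w = "\<lambda>n. real n * growth ^ n"
  have cancel: "(x / w) / (y / w) = x / y" if "w \<noteq> 0" for x y w :: real using that by simp
  \<comment> \<open>Applied to the constant function 1, the same asymptotics count the
    class.\<close>
  have "(\<lambda>n. (\<Sum>\<pi>\<in>of_size XX_class n. 1 :: real) / ?w n) \<longlonglongrightarrow> XX_constant * integral {0..1} (\<lambda>u::real. 1)"
    by (rule XX_class_sum_asymptotics[where M = 1]) (auto simp: approximates_on_sums_def intro!: exI[of _ 1])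
  then have c: "(\<lambda>n. ?c n / ?w n) \<longlonglongrightarrow> XX_constant" by simp
  have "(\<lambda>n. (?S n / ?w n) / (?c n / ?w n)) \<longlonglongrightarrow> XX_constant * integral {0..1} G / XX_constant"
    using XX_constant_pos by (intro tendsto_divide XX_class_sum_asymptotics[OF assms] c) auto
  then have "(\<lambda>n. (?S n / ?w n) / (?c n / ?w n)) \<longlonglongrightarrow> integral {0..1} G"
    using XX_constant_pos by simp
  then show ?thesis
  proof (rule Lim_transform_eventually)
    show "\<forall>\<^sub>F n in sequentially. (?S n / ?w n) / (?c n / ?w n)
       = ?S n / ?c n"
    proof (rule eventually_sequentiallyI[of 1])
      fix n :: nat assume "1 \<le> n"
      then have "?w n \<noteq> 0" using growth_power_pos[of n] by (metis mult_eq_0_iff not_one_le_zero of_nat_eq_0_iff order_less_irrefl)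
      then show "(?S n / ?w n) / (?c n / ?w n)
       = ?S n / ?c n" by (rule cancel)
    qed
  qed
qed


section \<open>Convergence in distribution\<close>

text \<open>Only finitely many test functions decide closeness, so one constant \<open>C\<close>
  dominates all their bounds and Lipschitz constants, and \<open>direct_sum_estimate\<close> becomes
  uniform over them.\<close>

lemma permuton_of_direct_sum_close:
  assumes F: "continuous_map permuton_topology euclideanreal F"
  shows "approximates_on_sums (\<lambda>\<pi>. F (permuton_of \<pi>)) (\<lambda>u. F (XX_permuton u))"
  unfolding approximates_on_sums_def
proof (intro allI impI)
  fix e :: real assume e: "e > 0"
  obtain A \<eta> where A: "finite A" "Ball A lipschitz_test" "\<eta> > 0"
    and close: "\<And>u \<nu>. u \<in> {0..1} \<Longrightarrow> \<nu> \<in> permuton_nbhd A \<eta> (XX_permuton u) \<Longrightarrow> \<bar>F \<nu> - F (XX_permuton u)\<bar> < e"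
    using XX.uniformly_continuous_at_path[OF F e] by blast
  have "\<forall>f\<in>A. \<exists>x. \<forall>z z'. \<bar>f z\<bar> \<le> fst x \<and> \<bar>f z - f z'\<bar> \<le> snd x * dist z z'"
    using A(2) unfolding lipschitz_test_def by auto
  then obtain BL where "\<forall>f\<in>A. \<forall>z z'. \<bar>f z\<bar> \<le> fst (BL f) \<and> \<bar>f z - f z'\<bar> \<le> snd (BL f) * dist z z'"
    by (rule bchoice[THEN exE])
  then have BL: "\<And>z. \<bar>f z\<bar> \<le> fst (BL f)" "\<And>z z'. \<bar>f z - f z'\<bar> \<le> snd (BL f) * dist z z'" if "f \<in> A" for f
    using that by blast+
  define C where "C = 1 + (\<Sum>f\<in>A. 8 * \<bar>snd (BL f)\<bar> + 6 * \<bar>fst (BL f)\<bar>)"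
  have C: "8 * snd (BL f) + 6 * fst (BL f) \<le> C" "8 * snd (BL f) \<le> C" if "f \<in> A" for f
  proof -
    have "8 * \<bar>snd (BL f)\<bar> + 6 * \<bar>fst (BL f)\<bar> \<le> (\<Sum>f\<in>A. 8 * \<bar>snd (BL f)\<bar> + 6 * \<bar>fst (BL f)\<bar>)"
      using that A(1) by (intro member_le_sum) auto
    then show "8 * snd (BL f) + 6 * fst (BL f) \<le> C" "8 * snd (BL f) \<le> C" unfolding C_def by linarith+
  qed
  have C1: "C \<ge> 1" unfolding C_def by (simp add: sum_nonneg)
  \<comment> \<open>Imbalance then costs at most \<open>\<eta> / 4\<close>, and \<open>n0\<close> is
    chosen so that the remaining \<open>C / n\<close> is below \<open>\<eta> / 4\<close>
    too.\<close>
  define \<delta> where "\<delta> = min 1 (\<eta> / (4 * C))"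
  have \<delta>: "0 < \<delta>" "\<delta> \<le> 1" "C * \<delta> \<le> \<eta> / 4"
  proof -
    have "C * \<delta> \<le> C * (\<eta> / (4 * C))" unfolding \<delta>_def using C1 by (intro mult_left_mono) auto
    then show "C * \<delta> \<le> \<eta> / 4" using C1 by simp
  qed (use A(3) C1 in \<open>auto simp: \<delta>_def\<close>)
  obtain n0 :: nat where n0: "4 * C / \<eta> < n0" using reals_Archimedean2 by blast
  have "\<bar>F (permuton_of (direct_sum \<sigma> \<tau>)) - F (XX_permuton (real (length \<sigma>) / n))\<bar> \<le> e"
    if n: "n \<ge> n0" and \<sigma>: "\<sigma> \<in> X_class \<inter> balanced_perms (\<delta> * real n)" and \<tau>: "\<tau> \<in> X_class \<inter> balanced_perms (\<delta> * real n)"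
      and len: "length \<sigma> + length \<tau> = n" for n \<sigma> \<tau>
  proof -
    have perm: "direct_sum \<sigma> \<tau> \<in> perms" using \<sigma> \<tau> X_class_perms direct_sum_perms by blast
    have n_pos: "0 < n" using len \<sigma> X_class_perms by (auto simp: perms_iff)
    have u: "real (length \<sigma>) / n \<in> {0..1}" using len n_pos by (auto simp: divide_le_eq_1)
    have "4 * C / \<eta> < n" using n0 n by simp
    then have Cn: "C / n < \<eta> / 4" using A(3) n_pos by (simp add: field_simps)
    have "permuton_of (direct_sum \<sigma> \<tau>) \<in> permuton_nbhd A \<eta> (XX_permuton (real (length \<sigma>) / n))"
      unfolding permuton_nbhd_def
    proof (intro CollectI conjI ballI)
      show "permuton_of (direct_sum \<sigma> \<tau>) \<in> permutons" by (rule permuton_of_permuton[OF perm])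
      fix f assume f: "f \<in> A"
      let ?B = "fst (BL f)" and ?L = "snd (BL f)"
      have "\<bar>(\<integral>z. f z \<partial>permuton_of (direct_sum \<sigma> \<tau>)) - (\<integral>z. f z \<partial>XX_permuton (real (length \<sigma>) / n))\<bar>
          \<le> ((8 * ?L + 6 * ?B) * (\<delta> * n) + 8 * ?L) / n"
        using \<sigma> \<tau> len by (intro direct_sum_estimate[OF BL[OF f]]) auto
      also have "\<dots> = (8 * ?L + 6 * ?B) * \<delta> + 8 * ?L / n" using n_pos by (simp add: add_divide_distrib)
      also have "\<dots> \<le> C * \<delta> + C / n" using C[OF f] \<delta>(1) by (intro add_mono mult_right_mono divide_right_mono) auto
      also have "\<dots> < \<eta>" using \<delta>(3) Cn A(3) by linarith
      finally show "\<bar>(\<integral>z. f z \<partial>permuton_of (direct_sum \<sigma> \<tau>)) - (\<integral>z. f z \<partial>XX_permuton (real (length \<sigma>) / n))\<bar> < \<eta>" .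
    qed
    from close[OF u this] show ?thesis by simp
  qed
  then show "\<exists>\<delta>>0. \<delta> \<le> 1 \<and> (\<exists>n0. \<forall>n\<ge>n0. \<forall>\<sigma>\<in>X_class \<inter> balanced_perms (\<delta> * real n).
     \<forall>\<tau>\<in>X_class \<inter> balanced_perms (\<delta> * real n). length \<sigma> + length \<tau> = n \<longrightarrow>
       \<bar>F (permuton_of (direct_sum \<sigma> \<tau>)) - F (XX_permuton (real (length \<sigma>) / n))\<bar> \<le> e)"
    using \<delta>(1,2) by blast
qed

theorem proposition7p8:
  fixes N :: "nat \<Rightarrow> 'a measure" and \<sigma> :: "nat \<Rightarrow> 'a \<Rightarrow> nat list"
    and M :: "'b measure" and U :: "'b \<Rightarrow> real"
  assumes "\<And>n. n \<ge> 1 \<Longrightarrow> prob_space (N n)"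
    and "\<And>n. n \<ge> 1 \<Longrightarrow> \<sigma> n \<in> N n \<rightarrow>\<^sub>M count_space (of_size XX_class n)"
    and "\<And>n. n \<ge> 1 \<Longrightarrow> distr (N n) (count_space (of_size XX_class n)) (\<sigma> n)
           = uniform_count_measure (of_size XX_class n)"
    and "prob_space M"
    and "\<And>\<omega>. \<omega> \<in> space M \<Longrightarrow> U \<omega> \<in> {0..1}"
    and "distributed M lborel U (indicator {0..1})"
  shows "converges_in_distribution permuton_topology
           N (\<lambda>n \<omega>. permuton_of (\<sigma> n \<omega>)) M (\<lambda>\<omega>. XX_permuton (U \<omega>))"
  unfolding converges_in_distribution_def
proof (intro conjI allI impI)
  have space: "space (borel_of permuton_topology) = permutons"
    unfolding borel_of_def topspace_permuton_topology[symmetric]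
    by (rule space_measure_of) (auto dest: openin_subset)
  have XX_perms: "permuton_of \<pi> \<in> permutons" if "\<pi> \<in> of_size XX_class n" for \<pi> n
    using that XX_class_perms permuton_of_permuton by (auto simp: of_size_def)
  show "\<forall>\<^sub>F n in sequentially. prob_space (N n) \<and> (\<lambda>\<omega>. permuton_of (\<sigma> n \<omega>)) \<in> N n \<rightarrow>\<^sub>M borel_of permuton_topology"
  proof (rule eventually_sequentiallyI[of 1], rule conjI)
    fix n :: nat assume n: "1 \<le> n"
    show "prob_space (N n)" using assms(1)[OF n] .
    have "permuton_of \<in> count_space (of_size XX_class n) \<rightarrow>\<^sub>M borel_of permuton_topology"
      using XX_perms space by simp
    with assms(2)[OF n] show "(\<lambda>\<omega>. permuton_of (\<sigma> n \<omega>)) \<in> N n \<rightarrow>\<^sub>M borel_of permuton_topology"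
      by (rule measurable_compose)
  qed
  show "prob_space M" by (rule assms(4))
  have U: "U \<in> borel_measurable M" using distributed_measurable[OF assms(6)] by simp
  show "(\<lambda>\<omega>. XX_permuton (U \<omega>)) \<in> M \<rightarrow>\<^sub>M borel_of permuton_topology"
  proof (rule measurable_compose[where f = U and g = XX_permuton])
    show "U \<in> M \<rightarrow>\<^sub>M restrict_space borel {0..1}" using U assms(5) by (intro measurable_restrict_space2) auto
    \<comment> \<open>The target sigma-algebra is generated by the open sets, whose preimages under
      the continuous path are relatively open.\<close>
    show "XX_permuton \<in> restrict_space borel {0..1} \<rightarrow>\<^sub>M borel_of permuton_topology"
      unfolding borel_of_def
    proof (rule measurable_measure_of)
      show "{S. openin permuton_topology S} \<subseteq> Pow (topspace permuton_topology)" using openin_subset by auto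
      show "XX_permuton \<in> space (restrict_space borel {0..1}) \<rightarrow> topspace permuton_topology"
        using XX_permuton_permuton by (auto simp: topspace_permuton_topology space_restrict_space)
      fix S assume "S \<in> {S. openin permuton_topology S}"
      then have "openin (top_of_set {0..1}) {u \<in> topspace (top_of_set {0..1}). XX_permuton u \<in> S}"
        using openin_continuous_map_preimage[OF XX.path_continuous] by blast
      moreover have "{u \<in> topspace (top_of_set {0..1}). XX_permuton u \<in> S} = XX_permuton -` S \<inter> {0..1}" by auto
      ultimately obtain T where "open T" "XX_permuton -` S \<inter> {0..1} = {0..1} \<inter> T" by (auto simp: openin_open)
      then show "XX_permuton -` S \<inter> space (restrict_space borel {0..1}) \<in> sets (restrict_space borel {0..1})"
        by (simp add: space_restrict_space sets_restrict_space_iff)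
    qed
  qed
  fix F :: "(real \<times> real) measure \<Rightarrow> real"
  assume F: "continuous_map permuton_topology euclideanreal F" and bdd: "bounded (F ` topspace permuton_topology)"
  obtain K where K: "\<bar>F \<mu>\<bar> \<le> K" if "\<mu> \<in> permutons" for \<mu>
    using bdd unfolding bounded_iff topspace_permuton_topology by auto
  let ?G = "\<lambda>u. F (XX_permuton u)"
  have G: "continuous_on {0..1} ?G"
    using continuous_map_compose[OF XX.path_continuous F] by (simp add: comp_def continuous_map_iff_continuous)
  have lim: "(\<lambda>n. (\<Sum>\<pi>\<in>of_size XX_class n. F (permuton_of \<pi>)) / card (of_size XX_class n)) \<longlonglongrightarrow> integral {0..1} ?G"
    using K permuton_of_permuton XX_permuton_permuton permuton_of_direct_sum_close[OF F]
    by (intro XX_class_average_tendsto[OF _ _ G, where M = K]) auto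
  have mean: "(\<integral>\<omega>. F (permuton_of (\<sigma> n \<omega>)) \<partial>N n) = (\<Sum>\<pi>\<in>of_size XX_class n. F (permuton_of \<pi>)) / card (of_size XX_class n)"
    if n: "n \<ge> 1" for n
  proof -
    have "(\<integral>\<omega>. F (permuton_of (\<sigma> n \<omega>)) \<partial>N n)
        = (\<integral>\<pi>. F (permuton_of \<pi>) \<partial>distr (N n) (count_space (of_size XX_class n)) (\<sigma> n))"
      using assms(2)[OF n] by (subst integral_distr) auto
    also have "\<dots> = (\<Sum>\<pi>\<in>of_size XX_class n. F (permuton_of \<pi>)) / card (of_size XX_class n)"
      unfolding assms(3)[OF n] by (intro integral_uniform_count_measure finite_of_size XX_class_perms)
    finally show ?thesis .
  qed
  have limit: "(\<integral>\<omega>. F (XX_permuton (U \<omega>)) \<partial>M) = integral {0..1} ?G"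
  proof -
    let ?g = "\<lambda>u. indicator {0..1} u *\<^sub>R ?G u"
    have int: "set_integrable lborel {0..1} ?G" by (rule borel_integrable_atLeastAtMost'[OF G])
    have g: "?g \<in> borel_measurable lborel"
      using int unfolding set_integrable_def by (rule borel_measurable_integrable)
    have "(\<lambda>x. ennreal (indicator {0..1} x)) = (indicator {0..1} :: real \<Rightarrow> ennreal)"
      by (simp add: fun_eq_iff ennreal_indicator)
    then have D: "distributed M lborel U (\<lambda>x. ennreal (indicator {0..1} x))" using assms(6) by simp
    have "(\<integral>\<omega>. F (XX_permuton (U \<omega>)) \<partial>M) = (\<integral>\<omega>. ?g (U \<omega>) \<partial>M)"
      using assms(5) by (intro Bochner_Integration.integral_cong) auto
    also have "\<dots> = (\<integral>x. indicator {0..1} x * ?g x \<partial>lborel)"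
      using distributed_integral[OF D g] by simp
    also have "\<dots> = (LINT u:{0..1}|lborel. ?G u)"
      unfolding set_lebesgue_integral_def by (intro Bochner_Integration.integral_cong) (auto simp: indicator_def)
    also have "\<dots> = integral {0..1} ?G" by (rule set_borel_integral_eq_integral(2)[OF int])
    finally show ?thesis .
  qed
  show "(\<lambda>n. \<integral>\<omega>. F (permuton_of (\<sigma> n \<omega>)) \<partial>N n) \<longlonglongrightarrow> (\<integral>\<omega>. F (XX_permuton (U \<omega>)) \<partial>M)"
    unfolding limit
    by (rule Lim_transform_eventually[OF lim], rule eventually_sequentiallyI[of 1]) (simp add: mean)
qed

end
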